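(* Let $T>0$, $n,\nu\in\mathbb{N}^{\ast}$, and let $\eta:\mathbb{R}_+\to\mathbb{R}_+$ be an increasing function. Let $P$ and $Q=(Q^{\delta_n^l})_{l\in\mathbb{N}}$ be as in the context, and let $\alpha>0$, $\beta\in\mathbb{N}$. Assume that: (1) $P$ propagates regularity, $Q$ propagates regularity, $P$ dually propagates regularity and $Q$ dually propagates regularity; (2) for every $l\in\{1,\ldots,l(\nu,\alpha)\}$ the short time estimate $E_n(l,\alpha,\beta,P,Q)$ and the dual short time estimate $E_n(l,\alpha,\beta,P,Q)^{\ast}$ hold; (3) the regularization properties $R_{q_\nu,\eta}(Q^{\delta_n^1})$ and $R_{q_\nu,\eta}(P)$ hold. Then there is a constant $C$, not depending on $n$ or $f$, such that for every $f\in\mathcal{M}_b(\mathbb{R}^d)$, $$\Vert P_Tf-\hat{Q}^{\nu,\delta_n^0}_{0,T}f\Vert_\infty\leqslant\frac{C}{T(\nu)^{\eta(q_\nu)}}\,\Vert f\Vert_\infty\,\frac{1}{n^\nu},$$ where $P_T:=P_{0,T}$ and $T(\nu)=\inf\left\{t\in\pi^{\delta_n^1}:\ t\geqslant T\frac{n-m(0,\nu)}{n(m(0,\nu)+1)}\right\}$.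
   Context: **Function spaces.** $\mathbb{N}=\{0,1,2,\ldots\}$, $\mathbb{N}^{\ast}=\mathbb{N}\setminus\{0\}$, $d\in\mathbb{N}^{\ast}$. $\mathcal{M}_b(\mathbb{R}^d)$: bounded measurable functions $\mathbb{R}^d\to\mathbb{R}$. $\mathcal{C}_b^q(\mathbb{R}^d)$: functions having bounded derivatives up to order $q$ (order $0$ included). $\mathcal{C}_1^q(\mathbb{R}^d)$: functions having derivatives up to order $q$, all in $L_1(\mathbb{R}^d)$. $\mathcal{C}_c^q(\mathbb{R}^d)$: compactly supported functions having derivatives up to order $q$. $\Vert f\Vert_{r,\infty}=\sum_{|\gamma|\leqslant r}\Vert\partial_\gamma f\Vert_\infty$ and $\Vert f\Vert_{r,1}=\sum_{|\gamma|\leqslant r}\Vert\partial_\gamma f\Vert_{L_1}$. **Grids and discrete semigroups.** For $T>0$, $n\in\mathbb{N}^{\ast}$, $l\in\mathbb{N}$: $\delta_n^l=T/n^l$; for $\delta>0$: $\pi^\delta=\{k\delta:k\in\mathbb{N}\}$. Given finite positive transition measures $(\mu^\delta_t(x,dy))_{t\in\pi^\delta}$ on $\mathbb{R}^d$, measurable in $x$, with $\sup_{t\in\pi^\delta}\sup_x\mu^\delta_t(x,\mathbb{R}^d)<\infty$, write $\mu_t^\delta f(x)=\int f(y)\mu_t^\delta(x,dy)$; the associated discrete semigroup is $(Q^\delta_{s,t})_{s\leqslant t\in\pi^\delta}$ with $Q^\delta_{t,t}f=f$ and $Q^\delta_{t,t+(r+1)\delta}f=Q^\delta_{t,t+r\delta}\,\mu^\delta_{t+r\delta}f$,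 $r\in\mathbb{N}$, $f\in\mathcal{M}_b(\mathbb{R}^d)$. It satisfies $Q_{t,u}=Q_{t,s}Q_{s,u}$ for $t\leqslant s\leqslant u$. $P$ denotes a family of discrete semigroups $((P^\delta_{s,t})_{s\leqslant t\in\pi^\delta})_{\delta>0}$ that is grid independent: $P^\delta_{s,t}=P^{\bar\delta}_{s,t}=:P_{s,t}$ whenever $s,t\in\pi^\delta\cap\pi^{\bar\delta}$. $Q=(Q^{\delta_n^l})_{l\in\mathbb{N}}$ is a family of discrete semigroups, $Q^{\delta_n^l}$ living on $\pi^{\delta_n^l}$. The dual $Q^{\ast}$ of an operator $Q$ is taken with respect to the $L_2(\mathbb{R}^d)$ scalar product: $\int (Qg)f\,dx=\int g\,(Q^{\ast}f)\,dx$. **Constants.** In all properties below $C$ is a generic constant which may depend on $d,T,r,q,\nu,\alpha,\beta,\eta$ but not on $n$, the step of the grid, the times, or $f$. The constant in the conclusion depends only on these parameters and on the constants in the hypotheses. **Hypotheses.** - $P$ propagates regularity: for all $r\in\mathbb{N}$, $f\in\mathcal{C}_b^r(\mathbb{R}^d)$: $P_{s,t}f\in\mathcal{C}_b^r(\mathbb{R}^d)$ and $\sup_{t\geqslant s\geqslant0}\Vert P_{s,t}f\Vert_{r,\infty}\leqslant C\Vert f\Vert_{r,\infty}$. - $Q$ propagates regularity: for all $l,r\in\mathbb{N}$, $f\in\mathcal{C}_b^r(\mathbb{R}^d)$ and $s\leqslant t$ in $\pi^{\delta_n^l}$: $Q^{\delta_n^l}_{s,t}f\in\mathcal{C}_b^r(\mathbb{R}^d)$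 and $\Vert Q^{\delta_n^l}_{s,t}f\Vert_{r,\infty}\leqslant C\Vert f\Vert_{r,\infty}$. - $P$ (resp. $Q$) dually propagates regularity: the same statements with $P_{s,t}$ (resp. $Q^{\delta_n^l}_{s,t}$) replaced by its dual, $\mathcal{C}_b^r$ by $\mathcal{C}_1^r$ and $\Vert\cdot\Vert_{r,\infty}$ by $\Vert\cdot\Vert_{r,1}$. - $E_n(l,\alpha,\beta,P,Q)$: for all $r\in\mathbb{N}$, $f\in\mathcal{C}_b^{\beta+r}(\mathbb{R}^d)$, $t\in\pi^{\delta_n^l}$: $\Vert P_{t,t+\delta_n^l}f-Q^{\delta_n^l}_{t,t+\delta_n^l}f\Vert_{r,\infty}\leqslant C\Vert f\Vert_{\beta+r,\infty}(\delta_n^l)^{\alpha+1}$. - $E_n(l,\alpha,\beta,P,Q)^{\ast}$: for all $r\in\mathbb{N}$, $f\in\mathcal{C}_1^{\beta+r}(\mathbb{R}^d)$, $t\in\pi^{\delta_n^l}$: $\Vert P^{\ast}_{t,t+\delta_n^l}f-Q^{\delta_n^l,\ast}_{t,t+\delta_n^l}f\Vert_{r,1}\leqslant C\Vert f\Vert_{\beta+r,1}(\delta_n^l)^{\alpha+1}$. - $R_{q,\eta}(Q^\delta)$, for a family of operators $(Q^\delta_{s,t})_{s<t\in\pi^\delta}$ (not necessarily a semigroup): (i) $Q^\delta_{s,t}f\in\mathcal{C}_b^\infty(\mathbb{R}^d)$ for all $f\in\mathcal{M}_b(\mathbb{R}^d)$ and $s<t$ in $\pi^\delta$; (ii) for all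 $r\in\mathbb{N}$ and multi-indices $\gamma$ with $|\gamma|+r\leqslant q$, all $f\in\mathcal{C}_c^\infty(\mathbb{R}^d)$ and $s<t$ in $\pi^\delta$: $\Vert Q^\delta_{s,t}\partial_\gamma f\Vert_{r,\infty}\leqslant\frac{C}{(t-s)^{\eta(q)}}\Vert f\Vert_\infty$. $R_{q,\eta}(P)$ is the same property for $P_{s,t}$, for all $s<t$ for which $P_{s,t}$ is defined. **Parameters.** $l(\nu,\alpha)=\lceil\nu/\alpha\rceil$, and for $l\in\mathbb{N}$: $m(l,\nu)=\left\lceil\frac{\nu}{(1+\alpha)l+\alpha}\right\rceil$, $q_i(l,\nu)=\nu+\lceil i-(1+\alpha)(l+1)(i-1)\rceil$, and recursively $\kappa(l,\nu)=\max\left\{\beta m(l,\nu),\max_{1\leqslant i\leqslant m(l,\nu)-1}i\,\kappa(l+1,q_i(l,\nu))\right\}$ (only the first term when $m(l,\nu)=1$). Finally $q_\nu=\max_{i\in\{1,\ldots,m(0,\nu)\}}i\max(\beta,\kappa(1,q_i(0,\nu)))$, where the formula for $q_i$ is also used for $i=m(0,\nu)$. **The approximation $\hat Q$.** For $t\in\pi^{\delta_n^l}$, recursively $$\hat Q^{\nu,\delta_n^l}_{t,t+\delta_n^l}=Q^{\delta_n^{l+1}}_{t,t+\delta_n^l}+\sum_{i=1}^{m(l,\nu)-1}\hat I^{\delta_n^{l+1}}_{t,t+\delta_n^l,i},$$ $$\hat I^{\delta_n^{l+1}}_{t,t+\delta_n^l,i}=\sum_{\substack{t=t_0<t_1<\cdots<t_i\leqslant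 t+\delta_n^l\\ t_1,\ldots,t_i\in\pi^{\delta_n^{l+1}}}}\ \prod_{j=1}^i\left[Q^{\delta_n^{l+1}}_{t_{j-1},t_j-\delta_n^{l+1}}\left(\hat Q^{q_i(l,\nu),\delta_n^{l+1}}_{t_j-\delta_n^{l+1},t_j}-Q^{\delta_n^{l+1}}_{t_j-\delta_n^{l+1},t_j}\right)\right]Q^{\delta_n^{l+1}}_{t_i,t+\delta_n^l},$$ operator products being ordered from left to right in increasing $j$. The recursion terminates: when $m(l,\nu)=1$, $\hat Q^{\nu,\delta_n^l}_{t,t+\delta_n^l}=Q^{\delta_n^{l+1}}_{t,t+\delta_n^l}$. Since $\delta_n^0=T$, $\hat Q^{\nu,\delta_n^0}_{0,T}$ is defined. **Convention.** When $T(\nu)=0$ the right-hand side of the conclusion is understood as $+\infty$. *)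

theory Defs
  imports "HOL-Analysis.Analysis"
begin

section \<open>Partial derivatives and function spaces\<close>

definition partial :: "'n::finite \<Rightarrow> (real ^ 'n \<Rightarrow> real) \<Rightarrow> real ^ 'n \<Rightarrow> real" where
  "partial i f = (\<lambda>x. deriv (\<lambda>h. f (x + h *\<^sub>R axis i 1)) 0)"

definition coords :: "'n::finite list" where
  "coords = (SOME is. distinct is \<and> set is = UNIV)"

definition multi_size :: "('n::finite \<Rightarrow> nat) \<Rightarrow> nat" where
  "multi_size \<gamma> = (\<Sum>i\<in>UNIV. \<gamma> i)"

text \<open>A multi-index is a function \<open>'n \<Rightarrow> nat\<close>. The index type carries no order, so the derivatives are
  composed along an arbitrary enumeration of the coordinates; for functions of class \<open>C_class |\<gamma>|\<close>,
  the only ones the definition is used for, the choice is irrelevant by Schwarz's theorem.\<close>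

definition mderiv :: "('n::finite \<Rightarrow> nat) \<Rightarrow> (real ^ 'n \<Rightarrow> real) \<Rightarrow> real ^ 'n \<Rightarrow> real" where
  "mderiv \<gamma> f = foldr (\<lambda>i. partial i ^^ \<gamma> i) coords f"

text \<open>\<open>C_class q f\<close>: all partial derivatives of \<open>f\<close> of order at most \<open>q\<close> exist everywhere and are
  continuous (order 0 included).\<close>

fun C_class :: "nat \<Rightarrow> (real ^ 'n::finite \<Rightarrow> real) \<Rightarrow> bool" where
  "C_class 0 f \<longleftrightarrow> continuous_on UNIV f"
| "C_class (Suc q) f \<longleftrightarrow> continuous_on UNIV f \<and>
     (\<forall>i. (\<forall>x. (\<lambda>h. f (x + h *\<^sub>R axis i 1)) differentiable (at 0)) \<and> C_class q (partial i f))"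

definition M_b :: "(real ^ 'n::finite \<Rightarrow> real) set" where
  "M_b = {f \<in> borel_measurable borel. bounded (range f)}"

definition C_b :: "nat \<Rightarrow> (real ^ 'n::finite \<Rightarrow> real) set" where
  "C_b q = {f. C_class q f \<and> (\<forall>\<gamma>. multi_size \<gamma> \<le> q \<longrightarrow> bounded (range (mderiv \<gamma> f)))}"

definition C_1 :: "nat \<Rightarrow> (real ^ 'n::finite \<Rightarrow> real) set" where
  "C_1 q = {f. C_class q f \<and> (\<forall>\<gamma>. multi_size \<gamma> \<le> q \<longrightarrow> integrable lborel (mderiv \<gamma> f))}"

definition C_b_infty :: "(real ^ 'n::finite \<Rightarrow> real) set" where
  "C_b_infty = (\<Inter>q. C_b q)"

definition C_c_infty :: "(real ^ 'n::finite \<Rightarrow> real) set" where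
  "C_c_infty = {f. (\<forall>q. C_class q f) \<and> compact (closure {x. f x \<noteq> 0})}"

text \<open>Norms take values in \<open>[0, \<infinity>]\<close>, so they are meaningful for every (measurable) function.\<close>

definition sup_norm :: "(real ^ 'n::finite \<Rightarrow> real) \<Rightarrow> ennreal" where
  "sup_norm f = (SUP x. ennreal \<bar>f x\<bar>)"

definition L1_norm :: "(real ^ 'n::finite \<Rightarrow> real) \<Rightarrow> ennreal" where
  "L1_norm f = (\<integral>\<^sup>+x. ennreal \<bar>f x\<bar> \<partial>lborel)"

definition C_b_norm :: "nat \<Rightarrow> (real ^ 'n::finite \<Rightarrow> real) \<Rightarrow> ennreal" where
  "C_b_norm r f = (\<Sum>\<gamma> | multi_size \<gamma> \<le> r. sup_norm (mderiv \<gamma> f))"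

definition C_1_norm :: "nat \<Rightarrow> (real ^ 'n::finite \<Rightarrow> real) \<Rightarrow> ennreal" where
  "C_1_norm r f = (\<Sum>\<gamma> | multi_size \<gamma> \<le> r. L1_norm (mderiv \<gamma> f))"

section \<open>Grids and discrete semigroups\<close>

type_synonym 'n oper = "(real ^ 'n \<Rightarrow> real) \<Rightarrow> real ^ 'n \<Rightarrow> real"

definition grid :: "real \<Rightarrow> real set" where
  "grid \<delta> = {real k * \<delta> | k::nat. True}"

definition grid_pairs :: "real \<Rightarrow> (real \<times> real) set" where
  "grid_pairs \<delta> = {(s, t). s \<in> grid \<delta> \<and> t \<in> grid \<delta> \<and> s \<le> t}"

definition all_grid_pairs :: "(real \<times> real) set" where
  "all_grid_pairs = (\<Union>\<delta>\<in>{0<..}. grid_pairs \<delta>)"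

definition step :: "real \<Rightarrow> nat \<Rightarrow> nat \<Rightarrow> real" where
  "step T n l = T / real n ^ l"

definition transition_measures ::
    "real \<Rightarrow> (real \<Rightarrow> real ^ 'n::finite \<Rightarrow> (real ^ 'n) measure) \<Rightarrow> bool" where
  "transition_measures \<delta> \<mu> \<longleftrightarrow>
     (\<forall>t\<in>grid \<delta>. \<forall>x. sets (\<mu> t x) = sets borel \<and> finite_measure (\<mu> t x)) \<and>
     (\<forall>t\<in>grid \<delta>. \<forall>A\<in>sets borel. (\<lambda>x. emeasure (\<mu> t x) A) \<in> borel_measurable borel) \<and>
     (SUP t\<in>grid \<delta>. SUP x. emeasure (\<mu> t x) UNIV) < \<infinity>"

text \<open>Operators act on \<open>M_b\<close>; their values on other functions are irrelevant throughout.\<close>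

definition discrete_semigroup :: "real \<Rightarrow> (real \<Rightarrow> real \<Rightarrow> 'n::finite oper) \<Rightarrow> bool" where
  "discrete_semigroup \<delta> Q \<longleftrightarrow>
     (\<exists>\<mu>. transition_measures \<delta> \<mu> \<and>
       (\<forall>t\<in>grid \<delta>. \<forall>f\<in>M_b. Q t t f = f \<and>
         (\<forall>r::nat. Q t (t + (real r + 1) * \<delta>) f
            = Q t (t + real r * \<delta>) (\<lambda>x. \<integral>y. f y \<partial>\<mu> (t + real r * \<delta>) x))))"

text \<open>A grid independent family of discrete semigroups is given directly by the common values
  \<open>P s t\<close>, \<open>(s, t) \<in> all_grid_pairs\<close>, which form a discrete semigroup on every grid.\<close>

definition grid_independent_family :: "(real \<Rightarrow> real \<Rightarrow> 'n::finite oper) \<Rightarrow> bool" where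
  "grid_independent_family P \<longleftrightarrow> (\<forall>\<delta>>0. discrete_semigroup \<delta> P)"

text \<open>\<open>is_dual A f h\<close>: the \<open>L\<^sub>2\<close>-dual of \<open>A\<close> is defined at \<open>f\<close> and \<open>h\<close> is a version of its value
  there. The dual is only determined almost everywhere; a continuous version is unique.\<close>

definition is_dual :: "'n::finite oper \<Rightarrow> (real ^ 'n \<Rightarrow> real) \<Rightarrow> (real ^ 'n \<Rightarrow> real) \<Rightarrow> bool" where
  "is_dual A f h \<longleftrightarrow> integrable lborel h \<and>
     (\<forall>g\<in>M_b. (\<integral>x. A g x * f x \<partial>lborel) = (\<integral>x. g x * h x \<partial>lborel))"

section \<open>Hypotheses\<close>

text \<open>In each property, \<open>K\<close> is the constant, possibly depending on the order \<open>r\<close> of the norm.\<close>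

definition propagates_regularity ::
    "(real \<times> real) set \<Rightarrow> (real \<Rightarrow> real \<Rightarrow> 'n::finite oper) \<Rightarrow> (nat \<Rightarrow> real) \<Rightarrow> bool" where
  "propagates_regularity I A K \<longleftrightarrow>
     (\<forall>r. \<forall>f\<in>C_b r. \<forall>(s, t)\<in>I.
        A s t f \<in> C_b r \<and> C_b_norm r (A s t f) \<le> ennreal (K r) * C_b_norm r f)"

definition dually_propagates_regularity ::
    "(real \<times> real) set \<Rightarrow> (real \<Rightarrow> real \<Rightarrow> 'n::finite oper) \<Rightarrow> (nat \<Rightarrow> real) \<Rightarrow> bool" where
  "dually_propagates_regularity I A K \<longleftrightarrow>
     (\<forall>r. \<forall>f\<in>C_1 r. \<forall>(s, t)\<in>I.
        \<exists>h\<in>C_1 r. is_dual (A s t) f h \<and> C_1_norm r h \<le> ennreal (K r) * C_1_norm r f)"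

definition short_time_estimate ::
    "real \<Rightarrow> real \<Rightarrow> nat \<Rightarrow> (real \<Rightarrow> real \<Rightarrow> 'n::finite oper) \<Rightarrow> (real \<Rightarrow> real \<Rightarrow> 'n oper) \<Rightarrow>
      (nat \<Rightarrow> real) \<Rightarrow> bool" where
  "short_time_estimate \<delta> \<alpha> \<beta> P Q K \<longleftrightarrow>
     (\<forall>r. \<forall>f\<in>C_b (\<beta> + r). \<forall>t\<in>grid \<delta>.
        C_b_norm r (\<lambda>x. P t (t + \<delta>) f x - Q t (t + \<delta>) f x)
          \<le> ennreal (K r * \<delta> powr (\<alpha> + 1)) * C_b_norm (\<beta> + r) f)"

definition dual_short_time_estimate ::
    "real \<Rightarrow> real \<Rightarrow> nat \<Rightarrow> (real \<Rightarrow> real \<Rightarrow> 'n::finite oper) \<Rightarrow> (real \<Rightarrow> real \<Rightarrow> 'n oper) \<Rightarrow>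
      (nat \<Rightarrow> real) \<Rightarrow> bool" where
  "dual_short_time_estimate \<delta> \<alpha> \<beta> P Q K \<longleftrightarrow>
     (\<forall>r. \<forall>f\<in>C_1 (\<beta> + r). \<forall>t\<in>grid \<delta>.
        \<exists>h\<in>C_1 r. \<exists>k\<in>C_1 r. is_dual (P t (t + \<delta>)) f h \<and> is_dual (Q t (t + \<delta>)) f k \<and>
          C_1_norm r (\<lambda>x. h x - k x)
            \<le> ennreal (K r * \<delta> powr (\<alpha> + 1)) * C_1_norm (\<beta> + r) f)"

definition regularizes ::
    "(real \<times> real) set \<Rightarrow> (real \<Rightarrow> real \<Rightarrow> 'n::finite oper) \<Rightarrow> nat \<Rightarrow> (real \<Rightarrow> real) \<Rightarrow> real \<Rightarrow> bool"
  where
  "regularizes I A q \<eta> K \<longleftrightarrow>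
     (\<forall>(s, t)\<in>I. s < t \<longrightarrow> (\<forall>f\<in>M_b. A s t f \<in> C_b_infty)) \<and>
     (\<forall>r \<gamma>. multi_size \<gamma> + r \<le> q \<longrightarrow>
        (\<forall>f\<in>C_c_infty. \<forall>(s, t)\<in>I. s < t \<longrightarrow>
           C_b_norm r (A s t (mderiv \<gamma> f)) \<le> ennreal (K / (t - s) powr \<eta> (real q)) * sup_norm f))"

section \<open>Parameters\<close>

definition l_par :: "real \<Rightarrow> nat \<Rightarrow> nat" where
  "l_par \<alpha> \<nu> = nat \<lceil>real \<nu> / \<alpha>\<rceil>"

definition m_par :: "real \<Rightarrow> nat \<Rightarrow> nat \<Rightarrow> nat" where
  "m_par \<alpha> l \<nu> = nat \<lceil>real \<nu> / ((1 + \<alpha>) * real l + \<alpha>)\<rceil>"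

definition q_par :: "real \<Rightarrow> nat \<Rightarrow> nat \<Rightarrow> nat \<Rightarrow> nat" where
  "q_par \<alpha> l \<nu> i = nat (int \<nu> + \<lceil>real i - (1 + \<alpha>) * (real l + 1) * (real i - 1)\<rceil>)"

text \<open>For the indices \<open>i\<close> that occur the conversion to \<open>nat\<close> does not truncate.\<close>

lemma int_q_par:
  assumes "0 < \<alpha>" "1 \<le> i" "i \<le> m_par \<alpha> l \<nu>"
  shows "int (q_par \<alpha> l \<nu> i) = int \<nu> + \<lceil>real i - (1 + \<alpha>) * (real l + 1) * (real i - 1)\<rceil>"
proof -
  define a where "a = (1 + \<alpha>) * real l + \<alpha>"
  have a: "0 < a" unfolding a_def using assms(1) by (simp add: add_nonneg_pos)
  have "int i \<le> \<lceil>real \<nu> / a\<rceil>"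
    using assms(2,3) unfolding m_par_def a_def by linarith
  then have "real i - 1 < real \<nu> / a" by linarith
  then have "a * (real i - 1) < real \<nu>" using a by (simp add: field_simps)
  moreover have "real i - (1 + \<alpha>) * (real l + 1) * (real i - 1) = 1 - a * (real i - 1)"
    unfolding a_def by (simp add: algebra_simps)
  ultimately have "- real \<nu> < real i - (1 + \<alpha>) * (real l + 1) * (real i - 1)" by linarith
  then have "- int \<nu> \<le> \<lceil>real i - (1 + \<alpha>) * (real l + 1) * (real i - 1)\<rceil>" by linarith
  then show ?thesis unfolding q_par_def by simp
qed

definition depth :: "real \<Rightarrow> nat \<Rightarrow> nat \<Rightarrow> nat" where
  "depth \<alpha> l \<nu> = nat \<lceil>(real \<nu> - ((1 + \<alpha>) * real l + \<alpha>)) / \<alpha>\<rceil>"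

lemma depth_decreases:
  assumes "0 < \<alpha>" "1 \<le> i" "i \<le> m_par \<alpha> l \<nu> - 1"
  shows "depth \<alpha> (Suc l) (q_par \<alpha> l \<nu> i) < depth \<alpha> l \<nu>"
proof -
  define a where "a = (1 + \<alpha>) * real l + \<alpha>"
  have a: "0 < a" unfolding a_def using assms(1) by (simp add: add_nonneg_pos)
  have "2 \<le> \<lceil>real \<nu> / a\<rceil>" using assms(2,3) unfolding m_par_def a_def by linarith
  then have "1 < real \<nu> / a" by linarith
  then have pos: "a < real \<nu>" using a by (simp add: field_simps)
  have "0 \<le> a * (real i - 1)" using a assms(2) by simp
  moreover have "real i - (1 + \<alpha>) * (real l + 1) * (real i - 1) = 1 - a * (real i - 1)"
    unfolding a_def by (simp add: algebra_simps)
  ultimately have "\<lceil>real i - (1 + \<alpha>) * (real l + 1) * (real i - 1)\<rceil> \<le> 1" by linarith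
  then have q: "real (q_par \<alpha> l \<nu> i) \<le> real \<nu> + 1" unfolding q_par_def by linarith
  have "(real (q_par \<alpha> l \<nu> i) - ((1 + \<alpha>) * real (Suc l) + \<alpha>)) / \<alpha> \<le> (real \<nu> - a - \<alpha>) / \<alpha>"
    using q assms(1) unfolding a_def by (intro divide_right_mono) (auto simp: algebra_simps)
  also have "\<dots> = (real \<nu> - a) / \<alpha> - 1" using assms(1) by (simp add: field_simps)
  finally have "\<lceil>(real (q_par \<alpha> l \<nu> i) - ((1 + \<alpha>) * real (Suc l) + \<alpha>)) / \<alpha>\<rceil>
      \<le> \<lceil>(real \<nu> - a) / \<alpha>\<rceil> - 1" by linarith
  moreover have "0 < \<lceil>(real \<nu> - a) / \<alpha>\<rceil>" using pos assms(1) by simp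
  ultimately show ?thesis unfolding depth_def a_def by linarith
qed

text \<open>The recursions below are meant for \<open>\<alpha> > 0\<close>, where they terminate; the other branches are
  arbitrary and only make the functions total.\<close>

function kappa :: "real \<Rightarrow> nat \<Rightarrow> nat \<Rightarrow> nat \<Rightarrow> nat" where
  "kappa \<alpha> \<beta> l \<nu> =
     (if 0 < \<alpha>
      then Max (insert (\<beta> * m_par \<alpha> l \<nu>)
             ((\<lambda>i. i * kappa \<alpha> \<beta> (Suc l) (q_par \<alpha> l \<nu> i)) ` {1..m_par \<alpha> l \<nu> - 1}))
      else 0)"
  by pat_completeness auto
termination
  by (relation "Wellfounded.measure (\<lambda>(\<alpha>, \<beta>, l, \<nu>). depth \<alpha> l \<nu>)") (auto intro!: depth_decreases)

declare kappa.simps [simp del]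

definition q_nu :: "real \<Rightarrow> nat \<Rightarrow> nat \<Rightarrow> nat" where
  "q_nu \<alpha> \<beta> \<nu> =
     Max ((\<lambda>i. i * max \<beta> (kappa \<alpha> \<beta> 1 (q_par \<alpha> 0 \<nu> i))) ` {1..m_par \<alpha> 0 \<nu>})"

definition T_nu :: "real \<Rightarrow> real \<Rightarrow> nat \<Rightarrow> nat \<Rightarrow> real" where
  "T_nu T \<alpha> n \<nu> =
     Inf {t \<in> grid (step T n 1).
       t \<ge> T * ((real n - real (m_par \<alpha> 0 \<nu>)) / (real n * (real (m_par \<alpha> 0 \<nu>) + 1)))}"

section \<open>The approximation scheme\<close>

text \<open>\<open>chain \<delta> Q R u t\<^sub>0 [t\<^sub>1, \<dots>, t\<^sub>i]\<close> is the operator product, from left to right, of the factors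
  \<open>Q t\<^sub>j\<^sub>-\<^sub>1 (t\<^sub>j - \<delta>) \<circ> (R (t\<^sub>j - \<delta>) - Q (t\<^sub>j - \<delta>) t\<^sub>j)\<close> followed by \<open>Q t\<^sub>i u\<close>, where \<open>R s\<close> stands for an
  operator acting over the step \<open>[s, s + \<delta>]\<close>.\<close>

fun chain :: "real \<Rightarrow> (real \<Rightarrow> real \<Rightarrow> 'n::finite oper) \<Rightarrow> (real \<Rightarrow> 'n oper) \<Rightarrow> real \<Rightarrow>
    real \<Rightarrow> real list \<Rightarrow> 'n oper" where
  "chain \<delta> Q R u s [] f = Q s u f"
| "chain \<delta> Q R u s (t # ts) f =
     Q s (t - \<delta>)
       (\<lambda>x. R (t - \<delta>) (chain \<delta> Q R u t ts f) x - Q (t - \<delta>) t (chain \<delta> Q R u t ts f) x)"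

definition time_lists :: "real \<Rightarrow> real \<Rightarrow> real \<Rightarrow> nat \<Rightarrow> real list set" where
  "time_lists \<delta> t u i =
     {ts. length ts = i \<and> sorted_wrt (<) (t # ts) \<and> (\<forall>s\<in>set ts. s \<in> grid \<delta> \<and> s \<le> u)}"

definition I_hat :: "real \<Rightarrow> (real \<Rightarrow> real \<Rightarrow> 'n::finite oper) \<Rightarrow> (real \<Rightarrow> 'n oper) \<Rightarrow>
    real \<Rightarrow> real \<Rightarrow> nat \<Rightarrow> 'n oper" where
  "I_hat \<delta> Q R t u i f = (\<lambda>x. \<Sum>ts\<in>time_lists \<delta> t u i. chain \<delta> Q R u t ts f x)"

text \<open>\<open>Q_hat \<alpha> T n Q l \<nu> t\<close> is the operator \<open>\<hat>Q\<close> of order \<open>\<nu>\<close> over the single step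
  \<open>[t, t + step T n l]\<close> of the grid of level \<open>l\<close>; \<open>Q \<delta>\<close> is the discrete semigroup on \<open>grid \<delta>\<close>.\<close>

function Q_hat :: "real \<Rightarrow> real \<Rightarrow> nat \<Rightarrow> (real \<Rightarrow> real \<Rightarrow> real \<Rightarrow> 'n::finite oper) \<Rightarrow>
    nat \<Rightarrow> nat \<Rightarrow> real \<Rightarrow> 'n oper" where
  "Q_hat \<alpha> T n Q l \<nu> =
     (if 0 < \<alpha>
      then (\<lambda>t f x.
        Q (step T n (Suc l)) t (t + step T n l) f x +
        (\<Sum>i\<in>{1..m_par \<alpha> l \<nu> - 1}.
           I_hat (step T n (Suc l)) (Q (step T n (Suc l)))
             (Q_hat \<alpha> T n Q (Suc l) (q_par \<alpha> l \<nu> i)) t (t + step T n l) i f x))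
      else undefined)"
  by pat_completeness auto
termination
  by (relation "Wellfounded.measure (\<lambda>(\<alpha>, T, n, Q, l, \<nu>). depth \<alpha> l \<nu>)") (auto intro!: depth_decreases)

declare Q_hat.simps [simp del]

end

theory Submission
  imports Defs
begin

text \<open>Over one step of length \<open>T/n^l\<close> the scheme of level \<open>l\<close> compares the semigroup \<open>P\<close> with the cheap
  semigroup \<open>Q\<close> on the finer grid of mesh \<open>d = T/n^(l+1)\<close>. Let \<open>D t = P (t - d) t - Q (t - d) t\<close>. Iterating
  Duhamel's formula writes \<open>P\<close> over the step as the sum over \<open>i < m\<close> and over all times \<open>t1 < ... < ti\<close> of the
  products \<open>Q (D t1) Q ... (D ti) Q\<close>, plus the products with \<open>m\<close> factors that end in \<open>P\<close> instead of \<open>Q\<close>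
  (\<open>expansion\<close>). The scheme keeps the terms with \<open>i < m\<close> and replaces each \<open>D t\<close> by \<open>D' t\<close>, the
  difference between the scheme of level \<open>l + 1\<close> and \<open>Q\<close>. Its error thus consists of the products
  with \<open>m\<close> factors and, for \<open>0 < i < m\<close>, of differences of two products. The latter telescope into products
  with one factor \<open>D t - D' t\<close>, which is the error of the scheme one level further down.

  The size is a matter of counting. There are at most \<open>n^i\<close> choices of times, each \<open>D t\<close> has size
  \<open>d powr (1 + \<alpha>)\<close> by the short time estimate, and if the error one level down is of order \<open>n^(-q)\<close>
  for the prescribed \<open>q\<close>, then \<open>D' t\<close> is as small as \<open>D t\<close> and each sum is of order \<open>n^(-\<mu>)\<close>, where \<open>\<mu>\<close>
  is the accuracy asked for at level \<open>l\<close> (\<open>correction_count\<close>, \<open>remainder_count\<close>). Induction over the levels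
  gives the size at all of them, with constants chosen before \<open>n\<close>, \<open>P\<close> and \<open>Q\<close> (\<open>uniform_correction_bounds\<close>).

  The price is derivatives: each \<open>D t\<close> costs \<open>\<beta>\<close> of them. Below the top level they are charged to the
  argument, once for the operator on \<open>C_b\<close> and once for its dual on \<open>C_1\<close> (\<open>order_bound\<close>). At the top level
  the argument has no derivatives to offer. There the steps \<open>D t\<close> in a product leave at most \<open>m + 1\<close> gaps, one of
  which has length at least \<open>T_nu\<close> (\<open>long_gap_exists\<close>, \<open>T_nu_lower\<close>), so that the product has the form \<open>A R B\<close>
  with \<open>R\<close> regularizing. Since \<open>R\<close> absorbs derivatives on both sides, the losses of \<open>A\<close> can be paid on \<open>C_b\<close>, and
  those of \<open>B\<close> on \<open>C_1\<close> through the dual. To make this rigorous, \<open>f \<mapsto> A (R f) x\<close> is viewed as a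
  signed measure. The regularization property says that its distributional derivatives are finite measures,
  so it is a limit of densities bounded in \<open>C_1\<close> (\<open>smooth_dual_densities\<close>), and the dual of \<open>B\<close> can be
  applied to these (\<open>smoothing_bound_regularizing\<close>).

  All of this bounds the error on bounded continuous functions. The bound passes to bounded measurable
  functions because the former are dense in \<open>L\<^sup>1\<close> of the finite measures that represent the error at a
  point (\<open>sup_norm_bound_extends\<close>).\<close>

section \<open>Kernels acting on bounded functions\<close>

lemma M_bI: "f \<in> borel_measurable borel \<Longrightarrow> (\<And>x. \<bar>f x\<bar> \<le> c) \<Longrightarrow> f \<in> M_b"
  unfolding M_b_def by (auto simp: bounded_iff)

lemma M_b_bounded:
  assumes "f \<in> M_b"
  shows "\<exists>c\<ge>0. \<forall>x. \<bar>f x\<bar> \<le> c"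
proof -
  obtain c where c: "\<And>x. \<bar>f x\<bar> \<le> c"
    using assms unfolding M_b_def by (auto simp: bounded_iff)
  have "0 \<le> c" using c[of 0] by linarith
  then show ?thesis using c by blast
qed

lemma M_b_measurable: "f \<in> M_b \<Longrightarrow> f \<in> borel_measurable borel"
  unfolding M_b_def by auto

lemma M_b_lincomb:
  assumes "f \<in> M_b" "g \<in> M_b" shows "(\<lambda>x. a * f x + b * g x) \<in> M_b"
proof -
  obtain c where c: "\<And>x. \<bar>f x\<bar> \<le> c" using M_b_bounded[OF assms(1)] by blast
  obtain d where d: "\<And>x. \<bar>g x\<bar> \<le> d" using M_b_bounded[OF assms(2)] by blast
  have "\<bar>a * f x + b * g x\<bar> \<le> \<bar>a\<bar> * c + \<bar>b\<bar> * d" for x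
  proof -
    have "\<bar>a * f x + b * g x\<bar> \<le> \<bar>a\<bar> * \<bar>f x\<bar> + \<bar>b\<bar> * \<bar>g x\<bar>"
      by (metis abs_mult abs_triangle_ineq)
    also have "\<dots> \<le> \<bar>a\<bar> * c + \<bar>b\<bar> * d" by (intro add_mono mult_left_mono c d) auto
    finally show ?thesis .
  qed
  moreover have "(\<lambda>x. a * f x + b * g x) \<in> borel_measurable borel"
    using assms[THEN M_b_measurable] by (intro borel_measurable_add borel_measurable_times) auto
  ultimately show ?thesis by (intro M_bI)
qed

lemma M_b_add: "f \<in> M_b \<Longrightarrow> g \<in> M_b \<Longrightarrow> (\<lambda>x. f x + g x) \<in> M_b"
  using M_b_lincomb[of f g 1 1] by simp

lemma M_b_diff: "f \<in> M_b \<Longrightarrow> g \<in> M_b \<Longrightarrow> (\<lambda>x. f x - g x) \<in> M_b"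
  using M_b_lincomb[of f g 1 "-1"] by simp

lemma M_b_zero: "(\<lambda>x. 0) \<in> M_b"
  by (rule M_bI[of _ 0]) auto

lemma M_b_sum: "(\<And>i. i \<in> S \<Longrightarrow> F i \<in> M_b) \<Longrightarrow> (\<lambda>x. \<Sum>i\<in>S. F i x) \<in> M_b"
  by (induction S rule: infinite_finite_induct) (auto intro: M_b_zero M_b_add)

lemma M_b_indicator: "B \<in> sets borel \<Longrightarrow> (\<lambda>x. indicator B x) \<in> M_b"
  by (rule M_bI[of _ 1]) (auto simp: indicator_def)

text \<open>The operators \<open>f \<mapsto> (\<lambda>x. \<integral>f d\<mu>(x, \<cdot>))\<close> of bounded positive kernels \<open>\<mu>\<close>. The description by sequential
  continuity makes closure under composition immediate, with no composition of kernels of measures; the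
  measures are recovered in \<open>positive_kernel_represented\<close>.\<close>
definition positive_kernel :: "'n::finite oper \<Rightarrow> bool" where
  "positive_kernel A \<longleftrightarrow>
     (\<forall>f\<in>M_b. A f \<in> M_b) \<and>
     (\<forall>f\<in>M_b. \<forall>g\<in>M_b. \<forall>a b. A (\<lambda>x. a * f x + b * g x) = (\<lambda>x. a * A f x + b * A g x)) \<and>
     (\<forall>f\<in>M_b. (\<forall>x. 0 \<le> f x) \<longrightarrow> (\<forall>x. 0 \<le> A f x)) \<and>
     (\<forall>F f c x. (\<forall>j::nat. F j \<in> M_b) \<longrightarrow> (\<forall>j y. \<bar>F j y\<bar> \<le> c) \<longrightarrow>
        (\<forall>y. (\<lambda>j. F j y) \<longlonglongrightarrow> f y) \<longrightarrow> (\<lambda>j. A (F j) x) \<longlonglongrightarrow> A f x)"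

lemma positive_kernelD:
  assumes "positive_kernel A"
  shows "f \<in> M_b \<Longrightarrow> A f \<in> M_b"
    and "f \<in> M_b \<Longrightarrow> g \<in> M_b \<Longrightarrow> A (\<lambda>x. a * f x + b * g x) = (\<lambda>x. a * A f x + b * A g x)"
    and "f \<in> M_b \<Longrightarrow> (\<And>x. 0 \<le> f x) \<Longrightarrow> 0 \<le> A f x"
    and "(\<And>j::nat. F j \<in> M_b) \<Longrightarrow> (\<And>j y. \<bar>F j y\<bar> \<le> c) \<Longrightarrow>
        (\<And>y. (\<lambda>j. F j y) \<longlonglongrightarrow> h y) \<Longrightarrow> (\<lambda>j. A (F j) x) \<longlonglongrightarrow> A h x"
  using assms unfolding positive_kernel_def by blast+

lemma positive_kernelI:
  assumes "\<And>f. f \<in> M_b \<Longrightarrow> A f \<in> M_b"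
    and "\<And>f g a b. f \<in> M_b \<Longrightarrow> g \<in> M_b \<Longrightarrow>
        A (\<lambda>x. a * f x + b * g x) = (\<lambda>x. a * A f x + b * A g x)"
    and "\<And>f x. f \<in> M_b \<Longrightarrow> (\<And>x. 0 \<le> f x) \<Longrightarrow> 0 \<le> A f x"
    and "\<And>F c h x. (\<And>j::nat. F j \<in> M_b) \<Longrightarrow> (\<And>j y. \<bar>F j y\<bar> \<le> c) \<Longrightarrow>
        (\<And>y. (\<lambda>j. F j y) \<longlonglongrightarrow> h y) \<Longrightarrow> (\<lambda>j. A (F j) x) \<longlonglongrightarrow> A h x"
  shows "positive_kernel A"
  unfolding positive_kernel_def
proof (intro conjI ballI allI impI)
  fix F :: "nat \<Rightarrow> real ^ 'a \<Rightarrow> real" and f c x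
  assume "\<forall>j. F j \<in> M_b" "\<forall>j y. \<bar>F j y\<bar> \<le> c" "\<forall>y. (\<lambda>j. F j y) \<longlonglongrightarrow> f y"
  then show "(\<lambda>j. A (F j) x) \<longlonglongrightarrow> A f x" by (intro assms(4)) auto
qed (use assms(1-3) in auto)

lemma positive_kernel_mono:
  assumes "positive_kernel A" "f \<in> M_b" "g \<in> M_b" "\<And>x. f x \<le> g x"
  shows "A f x \<le> A g x"
proof -
  have "0 \<le> A (\<lambda>x. 1 * g x + (-1) * f x) x"
    by (rule positive_kernelD(3)[OF assms(1) M_b_lincomb]) (use assms in auto)
  then show ?thesis using positive_kernelD(2)[OF assms(1,3,2), of 1 "-1"] by simp
qed

lemma positive_kernel_bound:
  assumes "positive_kernel A"
  obtains d where "0 \<le> d" "\<And>f c x. f \<in> M_b \<Longrightarrow> (\<And>x. \<bar>f x\<bar> \<le> c) \<Longrightarrow> \<bar>A f x\<bar> \<le> c * d"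
proof -
  have one: "(\<lambda>x. 1) \<in> M_b" by (rule M_bI[of _ 1]) auto
  obtain d where d: "0 \<le> d" "\<And>x. \<bar>A (\<lambda>x. 1) x\<bar> \<le> d"
    using M_b_bounded[OF positive_kernelD(1)[OF assms one]] by blast
  have "\<bar>A f x\<bar> \<le> c * d" if f: "f \<in> M_b" and c: "\<And>x. \<bar>f x\<bar> \<le> c" for f c x
  proof -
    have c0: "0 \<le> c" using c[of 0] by linarith
    have m: "(\<lambda>x. a) \<in> M_b" for a by (rule M_bI[of _ "\<bar>a\<bar>"]) auto
    have eq: "A (\<lambda>x. a) x = a * A (\<lambda>x. 1) x" for a
      using positive_kernelD(2)[OF assms one one, of a 0] by (simp add: fun_eq_iff)
    have "A f x \<le> A (\<lambda>x. c) x" using c by (intro positive_kernel_mono[OF assms f m]) (simp add: abs_le_iff)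
    moreover have "A (\<lambda>x. - c) x \<le> A f x"
    proof (rule positive_kernel_mono[OF assms m f])
      show "- c \<le> f x" for x using c[of x] by linarith
    qed
    moreover have "c * A (\<lambda>x. 1) x \<le> c * d" using d(2)[of x] c0 by (intro mult_left_mono) auto
    ultimately show ?thesis using eq[of c] eq[of "-c"] by (simp add: abs_le_iff)
  qed
  then show ?thesis using that d(1) by blast
qed

lemma positive_kernel_comp:
  assumes A: "positive_kernel A" and B: "positive_kernel B"
  shows "positive_kernel (\<lambda>f. A (B f))"
proof -
  obtain d where d: "\<And>f c x. f \<in> M_b \<Longrightarrow> (\<And>x. \<bar>f x\<bar> \<le> c) \<Longrightarrow> \<bar>B f x\<bar> \<le> c * d"
    using positive_kernel_bound[OF B] by blast
  show ?thesis
  proof (rule positive_kernelI)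
    fix F :: "nat \<Rightarrow> real ^ 'a \<Rightarrow> real" and c h x
    assume F: "\<And>j. F j \<in> M_b" "\<And>j y. \<bar>F j y\<bar> \<le> c" "\<And>y. (\<lambda>j. F j y) \<longlonglongrightarrow> h y"
    show "(\<lambda>j. A (B (F j)) x) \<longlonglongrightarrow> A (B h) x"
    proof (rule positive_kernelD(4)[OF A, where F = "\<lambda>j. B (F j)" and c = "c * d"])
      show "B (F j) \<in> M_b" for j by (rule positive_kernelD(1)[OF B F(1)])
      show "\<bar>B (F j) y\<bar> \<le> c * d" for j y by (rule d) (use F in auto)
      show "(\<lambda>j. B (F j) y) \<longlonglongrightarrow> B h y" for y
        by (rule positive_kernelD(4)[OF B, where F = F and c = c]) (rule F)+
    qed
  qed (simp_all add: positive_kernelD(1-3)[OF A] positive_kernelD(1-3)[OF B])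
qed

lemma positive_kernel_add:
  assumes A: "positive_kernel A" and B: "positive_kernel B"
  shows "positive_kernel (\<lambda>f x. A f x + B f x)"
proof (rule positive_kernelI)
  fix F :: "nat \<Rightarrow> real ^ 'a \<Rightarrow> real" and c h x
  assume F: "\<And>j. F j \<in> M_b" "\<And>j y. \<bar>F j y\<bar> \<le> c" "\<And>y. (\<lambda>j. F j y) \<longlonglongrightarrow> h y"
  show "(\<lambda>j. A (F j) x + B (F j) x) \<longlonglongrightarrow> A h x + B h x"
  proof (rule tendsto_add)
    show "(\<lambda>j. A (F j) x) \<longlonglongrightarrow> A h x"
      by (rule positive_kernelD(4)[OF A, where F = F and c = c]) (rule F)+
    show "(\<lambda>j. B (F j) x) \<longlonglongrightarrow> B h x"
      by (rule positive_kernelD(4)[OF B, where F = F and c = c]) (rule F)+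
  qed
next
  fix f g :: "real ^ 'a \<Rightarrow> real" and a b
  assume "f \<in> M_b" "g \<in> M_b"
  then show "(\<lambda>x. A (\<lambda>x. a * f x + b * g x) x + B (\<lambda>x. a * f x + b * g x) x)
      = (\<lambda>x. a * (A f x + B f x) + b * (A g x + B g x))"
    by (simp add: positive_kernelD(2)[OF A] positive_kernelD(2)[OF B] algebra_simps)
qed (simp_all add: positive_kernelD(1,3)[OF A] positive_kernelD(1,3)[OF B] M_b_add)

lemma positive_kernel_id: "positive_kernel (\<lambda>f. f)"
  unfolding positive_kernel_def by auto

lemma positive_kernel_zero: "positive_kernel (\<lambda>f x. 0)"
  unfolding positive_kernel_def by (auto intro: M_b_zero)

lemma M_b_integrable:
  assumes "f \<in> M_b" "finite_measure \<mu>" "sets \<mu> = sets borel"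
  shows "integrable \<mu> f"
proof -
  obtain c where c: "\<And>x. \<bar>f x\<bar> \<le> c" using M_b_bounded[OF assms(1)] by blast
  have "f \<in> borel_measurable \<mu>"
    using M_b_measurable[OF assms(1)] assms(3) by (simp cong: measurable_cong_sets)
  then show ?thesis using c
    by (intro finite_measure.integrable_const_bound[OF assms(2), where B = c]) auto
qed

lemma positive_kernel_transition:
  fixes \<mu> :: "real ^ 'n::finite \<Rightarrow> (real ^ 'n) measure"
  assumes fin: "\<And>x. finite_measure (\<mu> x)" and sets: "\<And>x. sets (\<mu> x) = sets borel"
    and meas: "\<And>B. B \<in> sets borel \<Longrightarrow> (\<lambda>x. emeasure (\<mu> x) B) \<in> borel_measurable borel"
    and mass: "\<And>x. emeasure (\<mu> x) UNIV \<le> ennreal m"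
  shows "positive_kernel (\<lambda>f x. \<integral>y. f y \<partial>\<mu> x)"
proof -
  have sp: "space (\<mu> x) = UNIV" for x using sets_eq_imp_space_eq[OF sets[of x]] by simp
  have ms: "f \<in> borel_measurable (\<mu> x)" if "f \<in> borel_measurable borel" for f :: "real^'n \<Rightarrow> ennreal" and x
    using that sets by (simp cong: measurable_cong_sets)
  have nn: "(\<lambda>x. \<integral>\<^sup>+y. u y \<partial>\<mu> x) \<in> borel_measurable borel"
    if "u \<in> borel_measurable borel" for u :: "real ^ 'n \<Rightarrow> ennreal"
    using that
  proof (induction u rule: borel_measurable_induct)
    case (cong f g)
    then show ?case by (simp add: fun_eq_iff)
  next
    case (set B)
    then show ?case using meas sets by simp
  next
    case (mult u c)
    have "(\<integral>\<^sup>+y. c * u y \<partial>\<mu> x) = c * (\<integral>\<^sup>+y. u y \<partial>\<mu> x)" for x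
      by (rule nn_integral_cmult[OF ms[OF mult(2)]])
    then show ?case using mult(4) by simp
  next
    case (add u v)
    have "(\<integral>\<^sup>+y. v y + u y \<partial>\<mu> x) = (\<integral>\<^sup>+y. v y \<partial>\<mu> x) + (\<integral>\<^sup>+y. u y \<partial>\<mu> x)" for x
      by (intro nn_integral_add ms add)
    then show ?case using add by simp
  next
    case (seq U)
    have "(\<integral>\<^sup>+y. (SUP i. U i) y \<partial>\<mu> x) = (SUP i. \<integral>\<^sup>+y. U i y \<partial>\<mu> x)" for x
      unfolding SUP_apply by (rule nn_integral_monotone_convergence_SUP[OF seq(3) ms[OF seq(1)]])
    moreover have "(\<lambda>x. SUP i. \<integral>\<^sup>+y. U i y \<partial>\<mu> x) \<in> borel_measurable borel"
      by (intro borel_measurable_SUP seq) auto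
    ultimately show ?case by simp
  qed
  have int: "integrable (\<mu> x) f" if "f \<in> M_b" for f x
    using M_b_integrable[OF that fin sets] .
  have Mb: "(\<lambda>x. \<integral>y. f y \<partial>\<mu> x) \<in> M_b" if f: "f \<in> M_b" for f
  proof -
    obtain c where c: "0 \<le> c" "\<And>x. \<bar>f x\<bar> \<le> c" using M_b_bounded[OF f] by blast
    have eq: "(\<lambda>x. \<integral>y. f y \<partial>\<mu> x)
        = (\<lambda>x. enn2real (\<integral>\<^sup>+y. ennreal (f y) \<partial>\<mu> x) - enn2real (\<integral>\<^sup>+y. ennreal (- f y) \<partial>\<mu> x))"
      using int[OF f] by (simp add: real_lebesgue_integral_def)
    have "(\<lambda>x. \<integral>y. f y \<partial>\<mu> x) \<in> borel_measurable borel"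
      unfolding eq using M_b_measurable[OF f] by (intro borel_measurable_diff measurable_compose[OF nn] ) auto
    moreover have "\<bar>\<integral>y. f y \<partial>\<mu> x\<bar> \<le> c * max 0 m" for x
    proof -
      have "\<bar>\<integral>y. f y \<partial>\<mu> x\<bar> \<le> (\<integral>y. \<bar>f y\<bar> \<partial>\<mu> x)" by (rule integral_abs_bound)
      also have "\<dots> \<le> (\<integral>y. c \<partial>\<mu> x)"
        using int[OF f] c fin[of x]
        by (intro integral_mono) (auto intro: finite_measure.integrable_const)
      also have "\<dots> = c * measure (\<mu> x) UNIV" by (simp add: sp)
      also have "\<dots> \<le> c * max 0 m"
        using mass[of x] c(1) by (intro mult_left_mono) (auto simp: measure_def enn2real_leI max_def ennreal_neg)
      finally show ?thesis .
    qed
    ultimately show ?thesis by (rule M_bI)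
  qed
  have lim: "(\<lambda>j. \<integral>y. F j y \<partial>\<mu> x) \<longlonglongrightarrow> (\<integral>y. h y \<partial>\<mu> x)"
    if F: "\<And>j::nat. F j \<in> M_b" "\<And>j y. \<bar>F j y\<bar> \<le> c" "\<And>y. (\<lambda>j. F j y) \<longlonglongrightarrow> h y" for F c h x
  proof (rule integral_dominated_convergence[where w = "\<lambda>_. c"])
    show Fm: "F j \<in> borel_measurable (\<mu> x)" for j
      using M_b_measurable[OF F(1)] sets by (simp cong: measurable_cong_sets)
    show "h \<in> borel_measurable (\<mu> x)"
      by (rule borel_measurable_LIMSEQ_real[where u = F]) (use F Fm in auto)
  qed (use F fin[of x] in \<open>auto intro: finite_measure.integrable_const\<close>)
  show ?thesis
  proof (rule positive_kernelI)
    show "(\<lambda>j. \<integral>y. F j y \<partial>\<mu> x) \<longlonglongrightarrow> (\<integral>y. h y \<partial>\<mu> x)"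
      if "\<And>j::nat. F j \<in> M_b" "\<And>j y. \<bar>F j y\<bar> \<le> c" "\<And>y. (\<lambda>j. F j y) \<longlonglongrightarrow> h y" for F c h x
      by (rule lim[of F c]) (rule that)+
  qed (use Mb int in \<open>auto intro: Bochner_Integration.integral_nonneg\<close>)
qed

text \<open>The measure of a set is the value on its indicator; countable additivity is the continuity of
  \<open>A\<close> along the increasing bounded sequence of partial unions.\<close>
lemma positive_kernel_represented:
  fixes A :: "'n::finite oper"
  assumes A: "positive_kernel A"
  obtains \<mu> where "finite_measure \<mu>" "sets \<mu> = sets borel" "\<And>f. f \<in> M_b \<Longrightarrow> A f x = (\<integral>y. f y \<partial>\<mu>)"
proof -
  define m where "m B = ennreal (A (\<lambda>y. indicator B y) x)" for B
  define \<mu> where "\<mu> = measure_of UNIV (sets borel) m"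
  note lin = positive_kernelD(2)[OF A]
  have zero: "A (\<lambda>_. 0) = (\<lambda>_. 0)" using lin[OF M_b_zero M_b_zero, of 0 0] by simp
  have ind0: "(\<lambda>y::real ^ 'n. indicator {} y) = (\<lambda>y. 0::real)" by (simp add: fun_eq_iff)
  have nonneg: "0 \<le> A (\<lambda>y. indicator B y) x" if "B \<in> sets borel" for B
    by (rule positive_kernelD(3)[OF A M_b_indicator[OF that]]) simp
  have add: "A (\<lambda>x. f x + g x) x = A f x + A g x" if "f \<in> M_b" "g \<in> M_b" for f g
    using lin[OF that, of 1 1] by simp
  have fsum: "A (\<lambda>y. \<Sum>i\<in>S. F i y) x = (\<Sum>i\<in>S. A (F i) x)"
    if "finite S" "\<And>i. i \<in> S \<Longrightarrow> F i \<in> M_b" for F and S :: "nat set"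
    using that by (induction S) (auto simp: zero add M_b_sum)
  have em: "emeasure \<mu> B = m B" if "B \<in> sets borel" for B
    unfolding \<mu>_def
  proof (rule emeasure_measure_of_sigma)
    show "sigma_algebra UNIV (sets borel)" using sets.sigma_algebra_axioms[of borel] by simp
    show "positive (sets borel) m" unfolding positive_def m_def ind0 zero by simp
    show "countably_additive (sets borel) m"
      unfolding countably_additive_def
    proof (intro allI impI)
      fix B :: "nat \<Rightarrow> (real ^ 'n) set"
      assume B: "range B \<subseteq> sets borel" "disjoint_family B" "(\<Union>i. B i) \<in> sets borel"
      have Bm: "(\<lambda>y. indicator (B i) y) \<in> M_b" for i using B by (intro M_b_indicator) auto
      have ind: "(\<Sum>i<N. indicator (B i) y) = (indicator (\<Union>i<N. B i) y :: real)" for N y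
        using B(2) by (intro indicator_UN_disjoint[symmetric]) (auto simp: disjoint_family_on_def)
      have "(\<lambda>N. A (\<lambda>y. \<Sum>i<N. indicator (B i) y) x) \<longlonglongrightarrow> A (\<lambda>y. indicator (\<Union>i. B i) y) x"
      proof (rule positive_kernelD(4)[OF A, where c = 1])
        show "(\<lambda>y. \<Sum>i<N. indicator (B i) y) \<in> M_b" for N by (intro M_b_sum Bm)
        show "\<bar>\<Sum>i<N. indicator (B i) y\<bar> \<le> (1::real)" for N y unfolding ind by (simp add: indicator_def)
        show "(\<lambda>N. \<Sum>i<N. indicator (B i) y) \<longlonglongrightarrow> (indicator (\<Union>i. B i) y :: real)" for y
          unfolding ind by (rule LIMSEQ_indicator_UN)
      qed
      then have "(\<lambda>i. A (\<lambda>y. indicator (B i) y) x) sums A (\<lambda>y. indicator (\<Union>i. B i) y) x"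
        unfolding sums_def by (subst (asm) fsum) (use Bm in auto)
      then show "(\<Sum>i. m (B i)) = m (\<Union>i. B i)"
        unfolding m_def using nonneg B(1) by (intro suminf_ennreal_eq) auto
    qed
  qed (use that in auto)
  have sets: "sets \<mu> = sets borel" unfolding \<mu>_def
    by (metis UNIV_I sets.sigma_sets_eq sets_measure_of space_borel subset_UNIV sets.space_closed)
  have sp: "space \<mu> = UNIV" using sets_eq_imp_space_eq[OF sets] by simp
  have fin: "finite_measure \<mu>"
    by (rule finite_measureI) (use em[of UNIV] in \<open>auto simp: sp m_def\<close>)
  have rep0: "(\<exists>c. \<forall>y. f y \<le> c) \<longrightarrow> A f x = (\<integral>y. f y \<partial>\<mu>)"
    if "f \<in> borel_measurable borel" "\<And>y. 0 \<le> f y" for f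
    using that
  proof (induction f rule: borel_measurable_induct_real)
    case (set B)
    have "measure \<mu> B = A (\<lambda>y. indicator B y) x"
      using em[OF set] nonneg[OF set] by (simp add: measure_def m_def)
    then show ?case using set sp by simp
  next
    case (mult u c)
    show ?case
    proof (intro impI)
      assume "\<exists>b. \<forall>y. c * u y \<le> b"
      show "A (\<lambda>x. c * u x) x = (\<integral>y. c * u y \<partial>\<mu>)"
      proof (cases "c = 0")
        case True
        then show ?thesis using zero by simp
      next
        case False
        obtain b where b: "\<And>y. c * u y \<le> b" using \<open>\<exists>b. \<forall>y. c * u y \<le> b\<close> by blast
        have b': "u y \<le> b / c" for y using b[of y] False mult(1) by (simp add: field_simps)
        then have u: "u \<in> M_b" using mult by (intro M_bI[of _ "b / c"]) auto
        show ?thesis using lin[OF u u, of c 0] mult.IH b' by auto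
      qed
    qed
  next
    case (add u v)
    show ?case
    proof (intro impI)
      assume "\<exists>b. \<forall>y. v y + u y \<le> b"
      then obtain b where b: "\<And>y. v y + u y \<le> b" by blast
      have bu: "u y \<le> b" "v y \<le> b" for y using b[of y] add.hyps(2)[of y] add.hyps(4)[of y] by linarith+
      have uv: "u \<in> M_b" "v \<in> M_b" using add bu by (intro M_bI[of _ b]; auto)+
      show "A (\<lambda>x. v x + u x) x = (\<integral>y. v y + u y \<partial>\<mu>)"
        using lin[OF uv(2,1), of 1 1] add.IH bu M_b_integrable[OF uv(1) fin sets] M_b_integrable[OF uv(2) fin sets]
        by auto
    qed
  next
    case (seq U)
    show ?case
    proof (intro impI)
      assume "\<exists>b. \<forall>y. f y \<le> b"
      then obtain b where b: "\<And>y. f y \<le> b" by blast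
      have Uu: "U i y \<le> f y" for i y
      proof (rule incseq_le)
        show "incseq (\<lambda>i. U i y)" using seq.hyps(3) by (auto simp: mono_def le_fun_def)
        show "(\<lambda>i. U i y) \<longlonglongrightarrow> f y" using seq.hyps(4)[of y] by auto
      qed
      then have Ub: "U i y \<le> b" for i y using b order_trans by blast
      have U0: "0 \<le> U i y" for i y using seq.hyps by auto
      have Um: "U i \<in> M_b" for i using seq.hyps Ub U0 by (intro M_bI[of _ b]) (auto)
      have "(\<lambda>i. A (U i) x) \<longlonglongrightarrow> A f x"
        by (rule positive_kernelD(4)[OF A Um]) (use Ub U0 seq.hyps(4) in auto)
      moreover have "(\<lambda>i. \<integral>y. U i y \<partial>\<mu>) \<longlonglongrightarrow> (\<integral>y. f y \<partial>\<mu>)"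
      proof (rule integral_dominated_convergence[where w = "\<lambda>_. b"])
        show m: "U i \<in> borel_measurable \<mu>" for i
          using M_b_measurable[OF Um] sets by (simp cong: measurable_cong_sets)
        show "f \<in> borel_measurable \<mu>"
          by (rule borel_measurable_LIMSEQ_real[where u = U]) (use seq.hyps m in auto)
      qed (use seq.hyps(4) Ub U0 finite_measure.integrable_const[OF fin] in auto)
      moreover have "A (U i) x = (\<integral>y. U i y \<partial>\<mu>)" for i using seq.IH Ub by blast
      ultimately show "A f x = (\<integral>y. f y \<partial>\<mu>)" by (simp add: LIMSEQ_unique)
    qed
  qed
  have rep: "A f x = (\<integral>y. f y \<partial>\<mu>)" if f: "f \<in> M_b" for f
  proof -
    obtain c where c: "0 \<le> c" "\<And>x. \<bar>f x\<bar> \<le> c" using M_b_bounded[OF f] by blast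
    have p: "(\<lambda>y. max 0 (f y)) \<in> M_b" "(\<lambda>y. max 0 (- f y)) \<in> M_b"
      using c M_b_measurable[OF f] by (intro M_bI[of _ c]; auto simp: max_def abs_le_iff)+
    have p2: "A (\<lambda>y. max 0 (f y)) x = (\<integral>y. max 0 (f y) \<partial>\<mu>)"
      by (rule rep0[THEN mp]) (use c M_b_measurable[OF f] in \<open>auto intro!: exI[of _ c] simp: abs_le_iff\<close>)
    have p3: "A (\<lambda>y. max 0 (- f y)) x = (\<integral>y. max 0 (- f y) \<partial>\<mu>)"
      by (rule rep0[THEN mp]) (use c M_b_measurable[OF f] in \<open>auto intro!: exI[of _ c] simp: abs_le_iff minus_le_iff\<close>)
    have feq: "f = (\<lambda>y. 1 * max 0 (f y) + (-1) * max 0 (- f y))" by (auto simp: max_def)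
    have "A f x = A (\<lambda>y. max 0 (f y)) x - A (\<lambda>y. max 0 (- f y)) x"
      by (subst feq, subst lin[OF p]) simp
    also have "\<dots> = (\<integral>y. max 0 (f y) - max 0 (- f y) \<partial>\<mu>)"
      using p2 p3 p fin sets by (simp add: M_b_integrable)
    also have "(\<lambda>y. max 0 (f y) - max 0 (- f y)) = f" by (auto simp: max_def)
    finally show ?thesis .
  qed
  show ?thesis using that[OF fin sets rep] .
qed

definition signed_kernel :: "'n::finite oper \<Rightarrow> bool" where
  "signed_kernel A \<longleftrightarrow> (\<exists>A1 A2. positive_kernel A1 \<and> positive_kernel A2 \<and>
     (\<forall>f\<in>M_b. A f = (\<lambda>x. A1 f x - A2 f x)))"

lemma positive_imp_signed_kernel: "positive_kernel A \<Longrightarrow> signed_kernel A"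
  unfolding signed_kernel_def using positive_kernel_zero by fastforce

lemma signed_kernel_M_b: "signed_kernel A \<Longrightarrow> f \<in> M_b \<Longrightarrow> A f \<in> M_b"
  unfolding signed_kernel_def by (auto intro!: M_b_diff dest: positive_kernelD(1))

lemma signed_kernel_lincomb:
  assumes "signed_kernel A" "f \<in> M_b" "g \<in> M_b"
  shows "A (\<lambda>x. a * f x + b * g x) = (\<lambda>x. a * A f x + b * A g x)"
proof -
  obtain A1 A2 where *: "positive_kernel A1" "positive_kernel A2"
    "\<And>f. f \<in> M_b \<Longrightarrow> A f = (\<lambda>x. A1 f x - A2 f x)" using assms(1) unfolding signed_kernel_def by blast
  show ?thesis
    using *(3)[OF M_b_lincomb[OF assms(2,3)]] *(3)[OF assms(2)] *(3)[OF assms(3)]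
      positive_kernelD(2)[OF *(1) assms(2,3)] positive_kernelD(2)[OF *(2) assms(2,3)]
    by (simp add: algebra_simps)
qed

lemma signed_kernel_add:
  "signed_kernel A \<Longrightarrow> f \<in> M_b \<Longrightarrow> g \<in> M_b \<Longrightarrow> A (\<lambda>x. f x + g x) = (\<lambda>x. A f x + A g x)"
  using signed_kernel_lincomb[of A f g 1 1] by simp

lemma signed_kernel_diff:
  "signed_kernel A \<Longrightarrow> f \<in> M_b \<Longrightarrow> g \<in> M_b \<Longrightarrow> A (\<lambda>x. f x - g x) = (\<lambda>x. A f x - A g x)"
  using signed_kernel_lincomb[of A f g 1 "-1"] by simp

lemma signed_kernel_zero: "signed_kernel A \<Longrightarrow> A (\<lambda>x. 0) = (\<lambda>x. 0)"
  using signed_kernel_lincomb[of A "\<lambda>x. 0" "\<lambda>x. 0" 0 0] M_b_zero by simp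

lemma signed_kernel_sum:
  assumes "signed_kernel A" "\<And>i. i \<in> S \<Longrightarrow> F i \<in> M_b"
  shows "A (\<lambda>x. \<Sum>i\<in>S. F i x) = (\<lambda>x. \<Sum>i\<in>S. A (F i) x)"
  using assms(2)
  by (induction S rule: infinite_finite_induct)
     (auto simp: signed_kernel_zero[OF assms(1)] signed_kernel_add[OF assms(1)] M_b_sum)

lemma signed_kernel_cong:
  assumes "signed_kernel A" "\<And>f. f \<in> M_b \<Longrightarrow> B f = A f"
  shows "signed_kernel B"
  using assms unfolding signed_kernel_def by fastforce

lemma signed_kernel_op_diff:
  assumes "signed_kernel A" "signed_kernel B"
  shows "signed_kernel (\<lambda>f x. A f x - B f x)"
proof -
  obtain A1 A2 where A: "positive_kernel A1" "positive_kernel A2"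
    "\<And>f. f \<in> M_b \<Longrightarrow> A f = (\<lambda>x. A1 f x - A2 f x)" using assms(1) unfolding signed_kernel_def by blast
  obtain B1 B2 where B: "positive_kernel B1" "positive_kernel B2"
    "\<And>f. f \<in> M_b \<Longrightarrow> B f = (\<lambda>x. B1 f x - B2 f x)" using assms(2) unfolding signed_kernel_def by blast
  show ?thesis
    unfolding signed_kernel_def
    by (rule exI[of _ "\<lambda>f x. A1 f x + B2 f x"], rule exI[of _ "\<lambda>f x. A2 f x + B1 f x"])
       (use A B in \<open>auto intro!: positive_kernel_add\<close>)
qed

lemma signed_kernel_op_add:
  assumes "signed_kernel A" "signed_kernel B"
  shows "signed_kernel (\<lambda>f x. A f x + B f x)"
proof -
  have "signed_kernel (\<lambda>f x. 0 - B f x)"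
    by (rule signed_kernel_op_diff[OF positive_imp_signed_kernel[OF positive_kernel_zero] assms(2)])
  from signed_kernel_op_diff[OF assms(1) this] show ?thesis by simp
qed

lemma signed_kernel_comp:
  assumes "signed_kernel A" "signed_kernel B"
  shows "signed_kernel (\<lambda>f. A (B f))"
proof -
  obtain A1 A2 where A: "positive_kernel A1" "positive_kernel A2"
    "\<And>f. f \<in> M_b \<Longrightarrow> A f = (\<lambda>x. A1 f x - A2 f x)" using assms(1) unfolding signed_kernel_def by blast
  obtain B1 B2 where B: "positive_kernel B1" "positive_kernel B2"
    "\<And>f. f \<in> M_b \<Longrightarrow> B f = (\<lambda>x. B1 f x - B2 f x)" using assms(2) unfolding signed_kernel_def by blast
  have "A (B f) = (\<lambda>x. (A1 (B1 f) x + A2 (B2 f) x) - (A2 (B1 f) x + A1 (B2 f) x))" if f: "f \<in> M_b" for f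
  proof -
    have m: "B1 f \<in> M_b" "B2 f \<in> M_b" using B f positive_kernelD(1) by blast+
    show ?thesis
      unfolding B(3)[OF f] A(3)[OF M_b_diff[OF m]]
      using signed_kernel_diff[OF positive_imp_signed_kernel[OF A(1)] m]
        signed_kernel_diff[OF positive_imp_signed_kernel[OF A(2)] m] by (simp add: fun_eq_iff)
  qed
  note eq = this
  have p: "positive_kernel (\<lambda>f x. A1 (B1 f) x + A2 (B2 f) x)"
    "positive_kernel (\<lambda>f x. A2 (B1 f) x + A1 (B2 f) x)"
    by (rule positive_kernel_add[OF positive_kernel_comp[OF A(1) B(1)] positive_kernel_comp[OF A(2) B(2)]],
        rule positive_kernel_add[OF positive_kernel_comp[OF A(2) B(1)] positive_kernel_comp[OF A(1) B(2)]])
  show ?thesis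
    unfolding signed_kernel_def
    by (rule exI[of _ "\<lambda>f x. A1 (B1 f) x + A2 (B2 f) x"],
        rule exI[of _ "\<lambda>f x. A2 (B1 f) x + A1 (B2 f) x"]) (use p eq in blast)
qed

section \<open>Derivatives and norms\<close>
lemma C_class_Suc: "C_class (Suc q) f \<Longrightarrow> C_class q f"
proof (induction q arbitrary: f)
  case 0
  then show ?case by simp
next
  case (Suc q)
  then show ?case by (metis C_class.simps(2))
qed

lemma C_class_mono: "C_class q f \<Longrightarrow> p \<le> q \<Longrightarrow> C_class p f"
proof (induction q)
  case 0
  then show ?case by simp
next
  case (Suc q)
  then show ?case by (metis C_class_Suc le_Suc_eq)
qed

lemma partial_lincomb:
  assumes "C_class (Suc q) f" "C_class (Suc q) g"
  shows "partial i (\<lambda>x. a * f x + b * g x) = (\<lambda>x. a * partial i f x + b * partial i g x)"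
proof
  fix x :: "real ^ 'a"
  have f: "((\<lambda>h. f (x + h *\<^sub>R axis i 1)) has_real_derivative partial i f x) (at 0)"
    using assms(1) unfolding partial_def by (auto simp: DERIV_deriv_iff_real_differentiable)
  have g: "((\<lambda>h. g (x + h *\<^sub>R axis i 1)) has_real_derivative partial i g x) (at 0)"
    using assms(2) unfolding partial_def by (auto simp: DERIV_deriv_iff_real_differentiable)
  show "partial i (\<lambda>x. a * f x + b * g x) x = a * partial i f x + b * partial i g x"
    unfolding partial_def[of i "\<lambda>x. a * f x + b * g x"]
    by (rule DERIV_imp_deriv) (intro DERIV_add DERIV_cmult f g)
qed

lemma C_class_lincomb:
  "C_class q f \<Longrightarrow> C_class q g \<Longrightarrow> C_class q (\<lambda>x. a * f x + b * g x)"
proof (induction q arbitrary: f g)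
  case 0
  then show ?case by (auto intro!: continuous_intros)
next
  case (Suc q)
  have "(\<lambda>h. a * f (x + h *\<^sub>R axis i 1) + b * g (x + h *\<^sub>R axis i 1)) differentiable at 0" for i x
    using Suc.prems by (intro differentiable_add differentiable_mult differentiable_const) auto
  moreover have "C_class q (partial i (\<lambda>x. a * f x + b * g x))" for i
    unfolding partial_lincomb[OF Suc.prems] by (rule Suc.IH) (use Suc.prems in auto)
  moreover have "continuous_on UNIV (\<lambda>x. a * f x + b * g x)"
    using Suc.prems by (auto intro!: continuous_intros)
  ultimately show ?case by simp
qed

lemma C_class_funpow_partial: "C_class (k + q) f \<Longrightarrow> C_class q ((partial i ^^ k) f)"
proof (induction k arbitrary: q)
  case (Suc k)
  have "C_class (Suc q) ((partial i ^^ k) f)"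
    by (rule Suc.IH) (use Suc.prems in \<open>simp only: add_Suc add_Suc_right\<close>)
  then show ?case by simp
qed simp

lemma funpow_partial_lincomb:
  "C_class (k + q) f \<Longrightarrow> C_class (k + q) g \<Longrightarrow>
    (partial i ^^ k) (\<lambda>x. a * f x + b * g x) = (\<lambda>x. a * (partial i ^^ k) f x + b * (partial i ^^ k) g x)"
proof (induction k arbitrary: q)
  case (Suc k)
  have fg: "C_class (k + Suc q) f" "C_class (k + Suc q) g"
    using Suc.prems by (simp_all only: add_Suc add_Suc_right)
  show ?case
    using Suc.IH[OF fg] partial_lincomb[OF fg[THEN C_class_funpow_partial]] by simp
qed simp

lemma C_class_foldr_partial:
  "C_class (sum_list (map \<gamma> is) + q) f \<Longrightarrow> C_class q (foldr (\<lambda>i. partial i ^^ \<gamma> i) is f)"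
proof (induction "is" arbitrary: q)
  case (Cons i "is")
  then have "C_class (\<gamma> i + q) (foldr (\<lambda>i. partial i ^^ \<gamma> i) is f)"
    by (simp add: add_ac)
  then show ?case by (simp add: C_class_funpow_partial)
qed simp

lemma foldr_partial_lincomb:
  "C_class (sum_list (map \<gamma> is) + q) f \<Longrightarrow> C_class (sum_list (map \<gamma> is) + q) g \<Longrightarrow>
    foldr (\<lambda>i. partial i ^^ \<gamma> i) is (\<lambda>x. a * f x + b * g x)
      = (\<lambda>x. a * foldr (\<lambda>i. partial i ^^ \<gamma> i) is f x + b * foldr (\<lambda>i. partial i ^^ \<gamma> i) is g x)"
proof (induction "is" arbitrary: q)
  case (Cons i "is")
  have "C_class (\<gamma> i + q) (foldr (\<lambda>i. partial i ^^ \<gamma> i) is f)"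
    "C_class (\<gamma> i + q) (foldr (\<lambda>i. partial i ^^ \<gamma> i) is g)"
    using Cons.prems by (auto intro!: C_class_foldr_partial simp: add_ac)
  then show ?case using Cons.IH[of "\<gamma> i + q"] Cons.prems
    by (simp add: funpow_partial_lincomb add_ac)
qed simp

lemma sum_list_coords: "sum_list (map \<gamma> coords) = multi_size (\<gamma> :: 'n::finite \<Rightarrow> nat)"
proof -
  have "\<exists>is. distinct is \<and> set is = (UNIV :: 'n set)"
    using finite_distinct_list[of "UNIV :: 'n set"] by auto
  then have "distinct (coords :: 'n list) \<and> set (coords :: 'n list) = UNIV"
    unfolding coords_def by (rule someI_ex)
  then show ?thesis unfolding multi_size_def by (simp add: sum_list_distinct_conv_sum_set)
qed

lemma C_class_mderiv: "C_class (multi_size \<gamma> + q) f \<Longrightarrow> C_class q (mderiv \<gamma> f)"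
  unfolding mderiv_def by (rule C_class_foldr_partial) (simp add: sum_list_coords)

lemma mderiv_lincomb:
  assumes "C_class q f" "C_class q g" "multi_size \<gamma> \<le> q"
  shows "mderiv \<gamma> (\<lambda>x. a * f x + b * g x) = (\<lambda>x. a * mderiv \<gamma> f x + b * mderiv \<gamma> g x)"
  unfolding mderiv_def
  by (rule foldr_partial_lincomb[where q = 0])
     (use assms in \<open>auto simp: sum_list_coords intro: C_class_mono\<close>)

lemma mderiv_measurable:
  assumes "C_class q f" "multi_size \<gamma> \<le> q"
  shows "mderiv \<gamma> f \<in> borel_measurable borel"
proof -
  have "C_class (multi_size \<gamma> + 0) f" using assms by (auto intro: C_class_mono)
  then have "C_class 0 (mderiv \<gamma> f)" by (rule C_class_mderiv)
  then show ?thesis by (auto intro: borel_measurable_continuous_onI)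
qed

lemma finite_multi_size: "finite {\<gamma> :: 'n::finite \<Rightarrow> nat. multi_size \<gamma> \<le> r}"
proof (rule finite_subset)
  show "{\<gamma> :: 'n \<Rightarrow> nat. multi_size \<gamma> \<le> r} \<subseteq> {\<gamma>. \<forall>i. (i \<in> UNIV \<longrightarrow> \<gamma> i \<in> {..r}) \<and> (i \<notin> UNIV \<longrightarrow> \<gamma> i = 0)}"
  proof (clarsimp)
    fix \<gamma> :: "'n \<Rightarrow> nat" and i
    assume "multi_size \<gamma> \<le> r"
    moreover have "\<gamma> i \<le> multi_size \<gamma>" unfolding multi_size_def by (rule member_le_sum) auto
    ultimately show "\<gamma> i \<le> r" by simp
  qed
  show "finite {\<gamma> :: 'n \<Rightarrow> nat. \<forall>i. (i \<in> UNIV \<longrightarrow> \<gamma> i \<in> {..r}) \<and> (i \<notin> UNIV \<longrightarrow> \<gamma> i = 0)}"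
    by (rule finite_set_of_finite_funs) auto
qed

lemma multi_size_le_0: "{\<gamma> :: 'n::finite \<Rightarrow> nat. multi_size \<gamma> \<le> 0} = {\<lambda>_. 0}"
  unfolding multi_size_def by (auto simp: fun_eq_iff)

lemma mderiv_0: "mderiv (\<lambda>_. 0) f = f"
proof -
  have "foldr (\<lambda>i. partial i ^^ 0) is f = f" for "is" :: "'a list" by (induction "is") auto
  then show ?thesis unfolding mderiv_def by simp
qed

lemma C_b_norm_0: "C_b_norm 0 f = sup_norm f"
  unfolding C_b_norm_def multi_size_le_0 by (simp add: mderiv_0)

lemma C_1_norm_0: "C_1_norm 0 f = L1_norm f"
  unfolding C_1_norm_def multi_size_le_0 by (simp add: mderiv_0)

lemma C_b_mono: "f \<in> C_b q \<Longrightarrow> p \<le> q \<Longrightarrow> f \<in> C_b p"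
  unfolding C_b_def by (auto intro: C_class_mono)

lemma C_1_mono: "f \<in> C_1 q \<Longrightarrow> p \<le> q \<Longrightarrow> f \<in> C_1 p"
  unfolding C_1_def by (auto intro: C_class_mono)

lemma C_b_norm_mono: "p \<le> q \<Longrightarrow> C_b_norm p f \<le> C_b_norm q f"
  unfolding C_b_norm_def by (rule sum_mono2) (auto intro: finite_multi_size)

lemma C_1_norm_mono: "p \<le> q \<Longrightarrow> C_1_norm p f \<le> C_1_norm q f"
  unfolding C_1_norm_def by (rule sum_mono2) (auto intro: finite_multi_size)

lemma C_b_0_imp_M_b: "f \<in> C_b 0 \<Longrightarrow> f \<in> M_b"
  unfolding C_b_def M_b_def
  by (auto simp: mderiv_0 intro: borel_measurable_continuous_onI
      dest: spec[of _ "\<lambda>_. 0"] simp: multi_size_def)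

lemma C_b_imp_M_b: "f \<in> C_b q \<Longrightarrow> f \<in> M_b"
  using C_b_mono[of f q 0] C_b_0_imp_M_b by auto

lemma C_1_integrable: "f \<in> C_1 q \<Longrightarrow> integrable lborel f"
  unfolding C_1_def by (auto simp: mderiv_0 multi_size_def dest: spec[of _ "\<lambda>_. 0"])

lemma C_b_lincomb:
  assumes "f \<in> C_b q" "g \<in> C_b q" shows "(\<lambda>x. a * f x + b * g x) \<in> C_b q"
proof -
  have "bounded (range (mderiv \<gamma> (\<lambda>x. a * f x + b * g x)))" if "multi_size \<gamma> \<le> q" for \<gamma>
  proof -
    have "mderiv \<gamma> f \<in> M_b" "mderiv \<gamma> g \<in> M_b"
      using assms that unfolding M_b_def C_b_def by (auto intro: mderiv_measurable)
    then have "(\<lambda>x. a * mderiv \<gamma> f x + b * mderiv \<gamma> g x) \<in> M_b" by (rule M_b_lincomb)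
    then show ?thesis using mderiv_lincomb[of q f g \<gamma> a b] assms that
      unfolding M_b_def C_b_def by auto
  qed
  then show ?thesis using assms unfolding C_b_def by (auto intro: C_class_lincomb)
qed

lemma C_1_lincomb:
  assumes "f \<in> C_1 q" "g \<in> C_1 q" shows "(\<lambda>x. a * f x + b * g x) \<in> C_1 q"
proof -
  have "integrable lborel (mderiv \<gamma> (\<lambda>x. a * f x + b * g x))" if "multi_size \<gamma> \<le> q" for \<gamma>
    using assms that mderiv_lincomb[of q f g \<gamma> a b] unfolding C_1_def by auto
  then show ?thesis using assms unfolding C_1_def by (auto intro: C_class_lincomb)
qed

lemma C_b_diff: "f \<in> C_b q \<Longrightarrow> g \<in> C_b q \<Longrightarrow> (\<lambda>x. f x - g x) \<in> C_b q"
  using C_b_lincomb[of f q g 1 "-1"] by simp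

lemma C_b_add: "f \<in> C_b q \<Longrightarrow> g \<in> C_b q \<Longrightarrow> (\<lambda>x. f x + g x) \<in> C_b q"
  using C_b_lincomb[of f q g 1 1] by simp

lemma C_1_diff: "f \<in> C_1 q \<Longrightarrow> g \<in> C_1 q \<Longrightarrow> (\<lambda>x. f x - g x) \<in> C_1 q"
  using C_1_lincomb[of f q g 1 "-1"] by simp

lemma sup_norm_upper: "ennreal \<bar>f x\<bar> \<le> sup_norm f"
  unfolding sup_norm_def by (rule SUP_upper) simp

lemma sup_norm_leI: "(\<And>x. ennreal \<bar>f x\<bar> \<le> c) \<Longrightarrow> sup_norm f \<le> c"
  unfolding sup_norm_def by (rule SUP_least) simp

lemma sup_norm_add: "sup_norm (\<lambda>x. f x + g x) \<le> sup_norm f + sup_norm g"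
proof (rule sup_norm_leI)
  fix x
  have "ennreal \<bar>f x + g x\<bar> \<le> ennreal (\<bar>f x\<bar> + \<bar>g x\<bar>)" by (intro ennreal_leI) linarith
  also have "\<dots> = ennreal \<bar>f x\<bar> + ennreal \<bar>g x\<bar>" by simp
  also have "\<dots> \<le> sup_norm f + sup_norm g" by (intro add_mono sup_norm_upper)
  finally show "ennreal \<bar>f x + g x\<bar> \<le> sup_norm f + sup_norm g" .
qed

lemma sup_norm_minus: "sup_norm (\<lambda>x. - f x) = sup_norm f"
  unfolding sup_norm_def by simp

lemma sup_norm_finite: "f \<in> M_b \<Longrightarrow> sup_norm f < \<infinity>"
proof -
  assume "f \<in> M_b"
  then obtain c where "\<forall>x. \<bar>f x\<bar> \<le> c" using M_b_bounded by blast
  then have "sup_norm f \<le> ennreal c" by (intro sup_norm_leI ennreal_leI) auto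
  also have "\<dots> < \<infinity>" by simp
  finally show ?thesis .
qed

lemma L1_norm_add:
  assumes "f \<in> borel_measurable borel" "g \<in> borel_measurable borel"
  shows "L1_norm (\<lambda>x. f x + g x) \<le> L1_norm f + L1_norm g"
proof -
  have "L1_norm (\<lambda>x. f x + g x) \<le> (\<integral>\<^sup>+x. ennreal \<bar>f x\<bar> + ennreal \<bar>g x\<bar> \<partial>lborel)"
    unfolding L1_norm_def by (rule nn_integral_mono) (simp add: ennreal_plus[symmetric] del: ennreal_plus)
  also have "\<dots> = L1_norm f + L1_norm g"
    unfolding L1_norm_def using assms by (intro nn_integral_add) auto
  finally show ?thesis .
qed

lemma C_b_norm_add:
  assumes "C_class q f" "C_class q g"
  shows "C_b_norm q (\<lambda>x. f x + g x) \<le> C_b_norm q f + C_b_norm q g"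
proof -
  have "C_b_norm q (\<lambda>x. f x + g x) \<le> (\<Sum>\<gamma> | multi_size \<gamma> \<le> q. sup_norm (mderiv \<gamma> f) + sup_norm (mderiv \<gamma> g))"
    unfolding C_b_norm_def
  proof (rule sum_mono)
    fix \<gamma> :: "'a \<Rightarrow> nat" assume "\<gamma> \<in> {\<gamma>. multi_size \<gamma> \<le> q}"
    then have "mderiv \<gamma> (\<lambda>x. f x + g x) = (\<lambda>x. mderiv \<gamma> f x + mderiv \<gamma> g x)"
      using mderiv_lincomb[OF assms, of \<gamma> 1 1] by simp
    then show "sup_norm (mderiv \<gamma> (\<lambda>x. f x + g x)) \<le> sup_norm (mderiv \<gamma> f) + sup_norm (mderiv \<gamma> g)"
      by (simp add: sup_norm_add)
  qed
  then show ?thesis unfolding C_b_norm_def by (simp add: sum.distrib)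
qed

lemma C_1_norm_add:
  assumes "C_class q f" "C_class q g"
  shows "C_1_norm q (\<lambda>x. f x + g x) \<le> C_1_norm q f + C_1_norm q g"
proof -
  have "C_1_norm q (\<lambda>x. f x + g x) \<le> (\<Sum>\<gamma> | multi_size \<gamma> \<le> q. L1_norm (mderiv \<gamma> f) + L1_norm (mderiv \<gamma> g))"
    unfolding C_1_norm_def
  proof (rule sum_mono)
    fix \<gamma> :: "'a \<Rightarrow> nat" assume "\<gamma> \<in> {\<gamma>. multi_size \<gamma> \<le> q}"
    then have g: "multi_size \<gamma> \<le> q" by simp
    have "mderiv \<gamma> (\<lambda>x. f x + g x) = (\<lambda>x. mderiv \<gamma> f x + mderiv \<gamma> g x)"
      using mderiv_lincomb[OF assms g, of 1 1] by simp
    then show "L1_norm (mderiv \<gamma> (\<lambda>x. f x + g x)) \<le> L1_norm (mderiv \<gamma> f) + L1_norm (mderiv \<gamma> g)"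
      by (simp add: L1_norm_add mderiv_measurable[OF assms(1) g] mderiv_measurable[OF assms(2) g])
  qed
  then show ?thesis unfolding C_1_norm_def by (simp add: sum.distrib)
qed

lemma mderiv_minus:
  assumes "C_class q f" "multi_size \<gamma> \<le> q"
  shows "mderiv \<gamma> (\<lambda>x. - f x) = (\<lambda>x. - mderiv \<gamma> f x)"
  using mderiv_lincomb[OF assms(1,1,2), of "-1" 0] by simp

lemma C_class_minus: "C_class q f \<Longrightarrow> C_class q (\<lambda>x. - f x)"
  using C_class_lincomb[of q f f "-1" 0] by simp

lemma C_b_norm_minus: "C_class q f \<Longrightarrow> C_b_norm q (\<lambda>x. - f x) = C_b_norm q f"
  unfolding C_b_norm_def by (rule sum.cong) (auto simp: mderiv_minus sup_norm_minus)

lemma C_1_norm_minus: "C_class q f \<Longrightarrow> C_1_norm q (\<lambda>x. - f x) = C_1_norm q f"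
  unfolding C_1_norm_def by (rule sum.cong) (auto simp: mderiv_minus L1_norm_def)

lemma C_b_norm_diff:
  assumes "C_class q f" "C_class q g"
  shows "C_b_norm q (\<lambda>x. f x - g x) \<le> C_b_norm q f + C_b_norm q g"
  using C_b_norm_add[OF assms(1) C_class_minus[OF assms(2)]] C_b_norm_minus[OF assms(2)] by simp

lemma C_1_norm_diff:
  assumes "C_class q f" "C_class q g"
  shows "C_1_norm q (\<lambda>x. f x - g x) \<le> C_1_norm q f + C_1_norm q g"
  using C_1_norm_add[OF assms(1) C_class_minus[OF assms(2)]] C_1_norm_minus[OF assms(2)] by simp

lemma C_b_0_iff: "f \<in> C_b 0 \<longleftrightarrow> continuous_on UNIV f \<and> bounded (range f)"
proof
  assume "f \<in> C_b 0"
  then show "continuous_on UNIV f \<and> bounded (range f)"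
    using C_b_0_imp_M_b[of f] unfolding C_b_def M_b_def by simp
next
  assume f: "continuous_on UNIV f \<and> bounded (range f)"
  have "bounded (range (mderiv \<gamma> f))" if "multi_size \<gamma> \<le> 0" for \<gamma>
  proof -
    have "\<gamma> = (\<lambda>_. 0)" using that multi_size_le_0 by blast
    then show ?thesis using f by (simp only: mderiv_0)
  qed
  then show "f \<in> C_b 0" using f unfolding C_b_def by simp
qed

section \<open>Mollifiers\<close>
text \<open>The classical flat function \<open>exp (- 1 / u)\<close>, multiplied by a polynomial in \<open>1 / u\<close> so that the family
  contains its own derivatives.\<close>
definition flat_exp :: "real poly \<Rightarrow> real \<Rightarrow> real" where
  "flat_exp p u = (if 0 < u then poly p (1 / u) * exp (- (1 / u)) else 0)"

lemma flat_exp_tendsto_0: "(flat_exp p \<longlongrightarrow> 0) (at 0)"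
proof -
  have "((\<lambda>v. poly p v * exp (- v)) \<longlongrightarrow> (\<Sum>i\<le>degree p. coeff p i * 0)) at_top"
    unfolding poly_altdef sum_distrib_right
  proof (intro tendsto_sum)
    fix i
    have "((\<lambda>v. coeff p i * (v ^ i / exp v)) \<longlongrightarrow> coeff p i * 0) at_top"
      by (intro tendsto_mult tendsto_const tendsto_power_div_exp_0)
    then show "((\<lambda>v. coeff p i * v ^ i * exp (- v)) \<longlongrightarrow> coeff p i * 0) at_top"
      by (simp add: exp_minus field_simps)
  qed
  then have "((\<lambda>v. poly p v * exp (- v)) \<longlongrightarrow> 0) at_top" by simp
  then have "((\<lambda>u. poly p (inverse u) * exp (- inverse u)) \<longlongrightarrow> 0) (at_right 0)"
    using filterlim_compose[OF _ filterlim_inverse_at_top_right] by blast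
  moreover have "eventually (\<lambda>u. poly p (inverse u) * exp (- inverse u) = flat_exp p u) (at_right 0)"
    unfolding eventually_at_right_field by (auto simp: flat_exp_def inverse_eq_divide intro!: exI[of _ 1])
  ultimately have r: "(flat_exp p \<longlongrightarrow> 0) (at_right 0)" by (rule Lim_transform_eventually)
  have "eventually (\<lambda>u. 0 = flat_exp p u) (at_left 0)"
    unfolding eventually_at_left_field by (auto simp: flat_exp_def intro!: exI[of _ "-1"])
  then have "(flat_exp p \<longlongrightarrow> 0) (at_left 0)"
    by (rule Lim_transform_eventually[OF tendsto_const])
  then show ?thesis using r by (simp add: filterlim_split_at)
qed

lemma flat_exp_DERIV:
  "(flat_exp p has_real_derivative flat_exp ([:0, 0, 1:] * (p - pderiv p)) u) (at u)"
proof -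
  consider "u < 0" | "u = 0" | "0 < u" by linarith
  then show ?thesis
  proof cases
    case 1
    have "((\<lambda>_. 0) has_real_derivative 0) (at u)" by simp
    then have "(flat_exp p has_real_derivative 0) (at u)"
      by (rule has_field_derivative_transform_within_open[where S = "{..<0}"])
         (use 1 in \<open>auto simp: flat_exp_def\<close>)
    then show ?thesis using 1 by (simp add: flat_exp_def)
  next
    case 2
    have "(\<lambda>h. (flat_exp p (0 + h) - flat_exp p 0) / h) = flat_exp ([:0, 1:] * p)"
      by (auto simp: flat_exp_def fun_eq_iff)
    then have "(flat_exp p has_real_derivative 0) (at 0)"
      unfolding DERIV_def by (simp add: flat_exp_tendsto_0 del: mult_pCons_left)
    then show ?thesis using 2 by (simp add: flat_exp_def)
  next
    case 3
    have "((\<lambda>u. poly p (1 / u) * exp (- (1 / u))) has_real_derivative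
        flat_exp ([:0, 0, 1:] * (p - pderiv p)) u) (at u)"
      using 3 by (auto intro!: derivative_eq_intros DERIV_chain2[OF poly_DERIV]
          simp: flat_exp_def power2_eq_square algebra_simps divide_inverse)
    then show ?thesis
      by (rule has_field_derivative_transform_within_open[where S = "{0<..}"])
         (use 3 in \<open>auto simp: flat_exp_def\<close>)
  qed
qed

text \<open>A class of functions that contains the bump \<open>exp (- 1 / u) * exp (- 1 / (w - u))\<close> and is closed under
  differentiation, so that derivatives of all orders exist without a formula for them.\<close>
inductive elementary_smooth :: "(real \<Rightarrow> real) \<Rightarrow> bool" where
  const: "elementary_smooth (\<lambda>u. c)"
| flat: "elementary_smooth (\<lambda>u. flat_exp p (a * u + b))"
| add: "elementary_smooth f \<Longrightarrow> elementary_smooth g \<Longrightarrow> elementary_smooth (\<lambda>u. f u + g u)"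
| mult: "elementary_smooth f \<Longrightarrow> elementary_smooth g \<Longrightarrow> elementary_smooth (\<lambda>u. f u * g u)"

lemma elementary_smooth_DERIV:
  "elementary_smooth f \<Longrightarrow> \<exists>f'. elementary_smooth f' \<and> (\<forall>u. (f has_real_derivative f' u) (at u))"
proof (induction rule: elementary_smooth.induct)
  case (const c)
  then show ?case by (intro exI[of _ "\<lambda>_. 0"]) (auto intro: elementary_smooth.const)
next
  case (flat p a b)
  let ?q = "[:0, 0, 1:] * (p - pderiv p)"
  have "((\<lambda>u. flat_exp p (a * u + b)) has_real_derivative flat_exp ?q (a * u + b) * a) (at u)" for u
    by (rule DERIV_chain2[OF flat_exp_DERIV]) (auto intro!: derivative_eq_intros)
  then show ?case
    by (intro exI[of _ "\<lambda>u. flat_exp ?q (a * u + b) * a"])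
       (auto intro!: elementary_smooth.intros simp del: mult_pCons_left)
next
  case (add f g)
  then obtain f' g' where "elementary_smooth f'" "elementary_smooth g'"
    "\<forall>u. (f has_real_derivative f' u) (at u)" "\<forall>u. (g has_real_derivative g' u) (at u)" by blast
  then show ?case
    by (intro exI[of _ "\<lambda>u. f' u + g' u"]) (auto intro: elementary_smooth.intros DERIV_add)
next
  case (mult f g)
  then obtain f' g' where *: "elementary_smooth f'" "elementary_smooth g'"
    "\<forall>u. (f has_real_derivative f' u) (at u)" "\<forall>u. (g has_real_derivative g' u) (at u)" by blast
  have "elementary_smooth (\<lambda>u. f' u * g u + g' u * f u)"
    by (intro elementary_smooth.add elementary_smooth.mult * mult.hyps)
  then show ?case
    using * by (intro exI[of _ "\<lambda>u. f' u * g u + g' u * f u"]) (auto intro: DERIV_mult)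
qed

lemma elementary_smooth_derivatives:
  assumes "elementary_smooth b"
  shows "\<exists>bs. bs (0::nat) = b \<and> (\<forall>m u. (bs m has_real_derivative bs (Suc m) u) (at u))"
proof -
  obtain d where d: "\<And>f. elementary_smooth f \<Longrightarrow>
      elementary_smooth (d f) \<and> (\<forall>u. (f has_real_derivative d f u) (at u))"
    using elementary_smooth_DERIV by metis
  have "elementary_smooth ((d ^^ m) b)" for m
    by (induction m) (use assms d in auto)
  then show ?thesis using d by (intro exI[of _ "\<lambda>m. (d ^^ m) b"]) auto
qed

text \<open>A test function \<open>\<phi> 0\<close> together with all its partial derivatives \<open>\<phi> k\<close>, indexed by the multi-index \<open>k\<close>. With the
  derivatives given as data, differentiation of a convolution is a change of the index, and their
  supports in a common ball need no separate argument.\<close>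
definition test_family :: "real \<Rightarrow> (('n::finite \<Rightarrow> nat) \<Rightarrow> real ^ 'n \<Rightarrow> real) \<Rightarrow> bool" where
  "test_family r \<phi> \<longleftrightarrow>
     (\<forall>k i x. ((\<lambda>h. \<phi> k (x + h *\<^sub>R axis i 1)) has_real_derivative \<phi> (k(i := Suc (k i))) x) (at 0)) \<and>
     (\<forall>k. continuous_on UNIV (\<phi> k)) \<and> (\<forall>k x. \<phi> k x \<noteq> 0 \<longrightarrow> norm x \<le> r)"

lemma test_family_bounded:
  assumes "test_family r \<phi>"
  shows "\<exists>c\<ge>0. \<forall>x. \<bar>\<phi> k x\<bar> \<le> c"
proof -
  have "compact (\<phi> k ` cball 0 r)"
    using assms unfolding test_family_def
    by (intro compact_continuous_image) (auto intro: continuous_on_subset)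
  then obtain c where c: "0 < c" "\<forall>x\<in>cball 0 r. \<bar>\<phi> k x\<bar> \<le> c"
    by (auto dest!: compact_imp_bounded simp: bounded_pos)
  have "\<bar>\<phi> k x\<bar> \<le> c" for x
  proof (cases "\<phi> k x = 0")
    case False
    then have "norm x \<le> r" using assms unfolding test_family_def by blast
    then show ?thesis using c by auto
  qed (use c in auto)
  then show ?thesis using c(1) by (intro exI[of _ c]) simp
qed

lemma test_family_measurable: "test_family r \<phi> \<Longrightarrow> \<phi> k \<in> borel_measurable borel"
  unfolding test_family_def by (auto intro: borel_measurable_continuous_onI)

lemma test_family_integrable:
  assumes "test_family r \<phi>" shows "integrable lborel (\<phi> k)"
proof -
  have "integrable lborel (\<lambda>x. if x \<in> cball 0 r then \<phi> k x else 0)"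
  proof -
    have "integrable lborel (\<lambda>x. indicator (cball 0 r) x *\<^sub>R \<phi> k x)"
      using assms unfolding test_family_def
      by (intro borel_integrable_compact) (auto intro: continuous_on_subset)
    moreover have "(\<lambda>x. indicator (cball 0 r) x *\<^sub>R \<phi> k x) = (\<lambda>x. if x \<in> cball 0 r then \<phi> k x else 0)"
      by (auto simp: fun_eq_iff)
    ultimately show ?thesis by simp
  qed
  moreover have "(\<lambda>x. if x \<in> cball 0 r then \<phi> k x else 0) = \<phi> k"
    using assms unfolding test_family_def by (auto simp: fun_eq_iff)
  ultimately show ?thesis by simp
qed

lemma test_family_DERIV:
  assumes "test_family r \<phi>"
  shows "((\<lambda>h. \<phi> k (v + (a * h) *\<^sub>R axis i 1)) has_real_derivative
      a * \<phi> (k(i := Suc (k i))) (v + (a * h) *\<^sub>R axis i 1)) (at h)"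
proof -
  let ?x = "v + (a * h) *\<^sub>R axis i 1"
  have D: "((\<lambda>t. \<phi> k (?x + t *\<^sub>R axis i 1)) has_real_derivative \<phi> (k(i := Suc (k i))) ?x) (at (a * (h - h)))"
    using assms unfolding test_family_def by simp
  have "((\<lambda>s. a * (s - h)) has_real_derivative a) (at h)"
    by (auto intro!: derivative_eq_intros)
  from DERIV_chain2[OF D this]
  have "((\<lambda>s. \<phi> k (?x + (a * (s - h)) *\<^sub>R axis i 1)) has_real_derivative \<phi> (k(i := Suc (k i))) ?x * a) (at h)" .
  moreover have "?x + (a * (s - h)) *\<^sub>R axis i 1 = v + (a * s) *\<^sub>R axis i 1" for s
    by (simp add: algebra_simps)
  ultimately show ?thesis by (simp add: mult.commute)
qed

text \<open>A product over the coordinates of one-dimensional bumps supported in \<open>[0, w]\<close>, divided by its integral. The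
  width \<open>w = r / d\<close> places the support in the ball of radius \<open>r\<close> because the norm is at most the sum
  of the coordinates.\<close>
lemma mollifier_exists:
  assumes "0 < r"
  obtains \<phi> :: "('n::finite \<Rightarrow> nat) \<Rightarrow> real ^ 'n \<Rightarrow> real"
  where "test_family r \<phi>" "\<And>x. 0 \<le> \<phi> (\<lambda>_. 0) x" "(\<integral>x. \<phi> (\<lambda>_. 0) x \<partial>lborel) = 1"
proof -
  define w where "w = r / real CARD('n)"
  have w: "0 < w" using assms by (simp add: w_def)
  define b where "b = (\<lambda>u. flat_exp 1 (1 * u + 0) * flat_exp 1 ((-1) * u + w))"
  have "elementary_smooth b" unfolding b_def by (intro elementary_smooth.intros)
  then obtain bs where bs0: "bs 0 = b" and bsD: "\<And>m u. (bs m has_real_derivative bs (Suc m) u) (at u)"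
    using elementary_smooth_derivatives by blast
  have bsupp: "bs m u = 0" if "u \<in> {..<0} \<union> {w<..}" for m u
    using that
  proof (induction m arbitrary: u)
    case 0
    then show ?case by (auto simp: bs0 b_def flat_exp_def)
  next
    case (Suc m)
    have "((\<lambda>_. 0) has_real_derivative 0) (at u)" by simp
    then have "(bs m has_real_derivative 0) (at u)"
      by (rule has_field_derivative_transform_within_open[where S = "{..<0} \<union> {w<..}"])
         (use Suc in auto)
    then show ?case using bsD DERIV_unique by blast
  qed
  define \<psi> :: "('n \<Rightarrow> nat) \<Rightarrow> real ^ 'n \<Rightarrow> real" where "\<psi> k x = (\<Prod>j\<in>UNIV. bs (k j) (x $ j))" for k x
  have D: "((\<lambda>h. \<psi> k (x + h *\<^sub>R axis i 1)) has_real_derivative \<psi> (k(i := Suc (k i))) x) (at 0)" for k i x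
  proof -
    define R where "R = (\<Prod>j\<in>UNIV - {i}. bs (k j) (x $ j))"
    have 1: "\<psi> k (x + h *\<^sub>R axis i 1) = bs (k i) (x $ i + h) * R" for h
    proof -
      have "\<psi> k (x + h *\<^sub>R axis i 1) = bs (k i) ((x + h *\<^sub>R axis i 1) $ i) *
          (\<Prod>j\<in>UNIV - {i}. bs (k j) ((x + h *\<^sub>R axis i 1) $ j))"
        unfolding \<psi>_def by (rule prod.remove) auto
      also have "(\<Prod>j\<in>UNIV - {i}. bs (k j) ((x + h *\<^sub>R axis i 1) $ j)) = R"
        unfolding R_def by (rule prod.cong) (auto simp: axis_def)
      finally show ?thesis by (simp add: axis_def)
    qed
    have 2: "\<psi> (k(i := Suc (k i))) x = bs (Suc (k i)) (x $ i) * R"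
    proof -
      have "\<psi> (k(i := Suc (k i))) x = bs ((k(i := Suc (k i))) i) (x $ i) *
          (\<Prod>j\<in>UNIV - {i}. bs ((k(i := Suc (k i))) j) (x $ j))"
        unfolding \<psi>_def by (rule prod.remove) auto
      also have "(\<Prod>j\<in>UNIV - {i}. bs ((k(i := Suc (k i))) j) (x $ j)) = R"
        unfolding R_def by (rule prod.cong) auto
      finally show ?thesis by (simp only: fun_upd_same)
    qed
    have "((\<lambda>h. bs (k i) (x $ i + h)) has_real_derivative bs (Suc (k i)) (x $ i) * 1) (at 0)"
      by (rule DERIV_chain2) (use bsD in \<open>auto intro!: derivative_eq_intros\<close>)
    then show ?thesis unfolding 1 2 by (intro DERIV_cmult_right) simp
  qed
  have cont: "continuous_on UNIV (\<psi> k)" for k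
  proof -
    have "continuous_on UNIV (bs m)" for m
      using bsD by (meson DERIV_isCont continuous_at_imp_continuous_on)
    then have "continuous_on UNIV (\<lambda>x::real ^ 'n. bs m (x $ j))" for m j
      by (rule continuous_on_compose2) (auto intro: continuous_intros)
    then show ?thesis unfolding \<psi>_def by (intro continuous_on_prod) auto
  qed
  have supp: "norm x \<le> r" if "\<psi> k x \<noteq> 0" for k x
  proof -
    have "\<bar>x $ j\<bar> \<le> w" for j
    proof (rule ccontr)
      assume "\<not> \<bar>x $ j\<bar> \<le> w"
      then have "bs (k j) (x $ j) = 0" using w by (intro bsupp) auto
      then show False using that unfolding \<psi>_def by auto
    qed
    then have "(\<Sum>j\<in>UNIV. \<bar>x $ j\<bar>) \<le> (\<Sum>j\<in>(UNIV::'n set). w)" by (intro sum_mono) auto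
    then show ?thesis using norm_le_l1_cart[of x] by (simp add: w_def)
  qed
  have tf: "test_family r \<psi>" unfolding test_family_def using D cont supp by blast
  have nn: "0 \<le> \<psi> (\<lambda>_. 0) x" for x
    unfolding \<psi>_def bs0 b_def flat_exp_def by (intro prod_nonneg) auto
  define c where "c = (\<integral>x. \<psi> (\<lambda>_. 0) x \<partial>lborel)"
  \<comment> \<open>A continuous nonnegative function that is positive at the centre of the cube has positive integral.\<close>
  have "c \<noteq> 0"
  proof
    assume "c = 0"
    then have "AE x in lborel. \<psi> (\<lambda>_. 0) x = 0"
      using integral_nonneg_eq_0_iff_AE[OF test_family_integrable[OF tf]] nn by (simp add: c_def)
    then have "AE x in lebesgue. \<psi> (\<lambda>_. 0) x = 0" by (rule AE_completion)
    then have "negligible {x. \<psi> (\<lambda>_. 0) x \<noteq> 0}"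
      by (simp add: negligible_iff_null_sets AE_iff_null_sets[symmetric] completion.complete2 eventually_ae_filter)
        (metis (mono_tags, lifting) completion.complete2)
    moreover have "open {x. \<psi> (\<lambda>_. 0) x \<noteq> 0}"
      by (intro open_Collect_neq cont) auto
    moreover have "(\<chi> j. w / 2) \<in> {x. \<psi> (\<lambda>_. 0) x \<noteq> 0}"
      using w by (simp add: \<psi>_def bs0 b_def flat_exp_def)
    ultimately show False using open_not_negligible by blast
  qed
  moreover have "0 \<le> c" unfolding c_def by (rule Bochner_Integration.integral_nonneg) (rule nn)
  ultimately have c: "0 < c" by simp
  show ?thesis
  proof (rule that[of "\<lambda>k x. \<psi> k x / c"])
    show "test_family r (\<lambda>k x. \<psi> k x / c)"
      unfolding test_family_def using D cont supp c
      by (auto intro!: DERIV_cdivide continuous_on_divide)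
  qed (use nn c in \<open>auto simp: c_def\<close>)
qed

section \<open>Convolution\<close>
text \<open>Two instances matter. For \<open>\<sigma> = 1\<close> and \<open>\<mu> = lborel\<close> this is the convolution of \<open>w\<close> with \<open>\<psi>\<close>. For \<open>\<sigma> = -1\<close>
  and \<open>w = 1\<close> it is the density of \<open>\<mu>\<close> convolved with the reflection of \<open>\<psi>\<close>.\<close>
definition convolve :: "real \<Rightarrow> (real ^ 'n::finite) measure \<Rightarrow> (real ^ 'n \<Rightarrow> real) \<Rightarrow>
    (real ^ 'n \<Rightarrow> real) \<Rightarrow> real ^ 'n \<Rightarrow> real" where
  "convolve \<sigma> \<mu> w \<psi> z = (\<integral>y. w y * \<psi> (\<sigma> *\<^sub>R (z - y)) \<partial>\<mu>)"

text \<open>The sum of the multi-indices \<open>\<gamma>\<close> and \<open>k\<close>, written as the same fold over the coordinates as \<open>mderiv\<close> so that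
  \<open>mderiv_convolve\<close> is an induction along that fold.\<close>
definition shift_index :: "('n::finite \<Rightarrow> nat) \<Rightarrow> ('n \<Rightarrow> nat) \<Rightarrow> 'n \<Rightarrow> nat" where
  "shift_index \<gamma> k = foldr (\<lambda>i k. k(i := k i + \<gamma> i)) coords k"

context
  fixes \<sigma> r :: real and \<mu> :: "(real ^ 'n::finite) measure" and w :: "real ^ 'n \<Rightarrow> real"
    and \<phi> :: "('n \<Rightarrow> nat) \<Rightarrow> real ^ 'n \<Rightarrow> real"
  assumes sets_mu: "sets \<mu> = sets borel" and w: "integrable \<mu> w" and tf: "test_family r \<phi>"
begin

lemma convolve_integrable: "integrable \<mu> (\<lambda>y. w y * \<phi> k (\<sigma> *\<^sub>R (z - y)))"
proof -
  obtain c where c: "0 \<le> c" "\<And>x. \<bar>\<phi> k x\<bar> \<le> c" using test_family_bounded[OF tf] by blast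
  have m: "(\<lambda>y. \<phi> k (\<sigma> *\<^sub>R (z - y))) \<in> borel_measurable \<mu>"
    unfolding measurable_cong_sets[OF sets_mu refl]
    by (rule measurable_compose[OF _ test_family_measurable[OF tf]]) measurable
  show ?thesis
  proof (rule Bochner_Integration.integrable_bound)
    show "integrable \<mu> (\<lambda>y. c * w y)" using w by simp
    show "(\<lambda>y. w y * \<phi> k (\<sigma> *\<^sub>R (z - y))) \<in> borel_measurable \<mu>" using w m by auto
    have "\<bar>w y * \<phi> k (\<sigma> *\<^sub>R (z - y))\<bar> \<le> \<bar>c * w y\<bar>" for y
      using mult_left_mono[OF c(2)[of "\<sigma> *\<^sub>R (z - y)"], of "\<bar>w y\<bar>"] c(1) by (simp add: abs_mult mult.commute)
    then show "AE y in \<mu>. norm (w y * \<phi> k (\<sigma> *\<^sub>R (z - y))) \<le> norm (c * w y)" by simp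
  qed
qed

lemma convolve_continuous: "continuous_on UNIV (convolve \<sigma> \<mu> w (\<phi> k))"
proof (rule continuous_at_imp_continuous_on, intro ballI)
  fix z
  obtain c where c: "0 \<le> c" "\<And>x. \<bar>\<phi> k x\<bar> \<le> c" using test_family_bounded[OF tf] by blast
  show "isCont (convolve \<sigma> \<mu> w (\<phi> k)) z"
    unfolding continuous_at_sequentially comp_def convolve_def
  proof (intro allI impI)
    fix x assume x: "x \<longlonglongrightarrow> z"
    show "(\<lambda>n. \<integral>y. w y * \<phi> k (\<sigma> *\<^sub>R (x n - y)) \<partial>\<mu>) \<longlonglongrightarrow> (\<integral>y. w y * \<phi> k (\<sigma> *\<^sub>R (z - y)) \<partial>\<mu>)"
    proof (rule integral_dominated_convergence[where w = "\<lambda>y. c * \<bar>w y\<bar>"])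
      show "integrable \<mu> (\<lambda>y. c * \<bar>w y\<bar>)" using w by simp
      have "isCont (\<phi> k) v" for v
        using tf unfolding test_family_def by (simp add: continuous_on_eq_continuous_at)
      then have "(\<lambda>n. w y * \<phi> k (\<sigma> *\<^sub>R (x n - y))) \<longlonglongrightarrow> w y * \<phi> k (\<sigma> *\<^sub>R (z - y))" for y
        using x by (intro tendsto_mult tendsto_const isCont_tendsto_compose[where g = "\<phi> k"] tendsto_intros)
      then show "AE y in \<mu>. (\<lambda>n. w y * \<phi> k (\<sigma> *\<^sub>R (x n - y))) \<longlonglongrightarrow> w y * \<phi> k (\<sigma> *\<^sub>R (z - y))" by simp
      show "AE y in \<mu>. norm (w y * \<phi> k (\<sigma> *\<^sub>R (x n - y))) \<le> c * \<bar>w y\<bar>" for n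
      proof (intro AE_I2)
        fix y
        show "norm (w y * \<phi> k (\<sigma> *\<^sub>R (x n - y))) \<le> c * \<bar>w y\<bar>"
          using mult_right_mono[OF c(2), of "\<bar>w y\<bar>" "\<sigma> *\<^sub>R (x n - y)"] by (simp add: abs_mult mult.commute)
      qed
    qed (use convolve_integrable in auto)
  qed
qed

lemma convolve_DERIV:
  "((\<lambda>h. convolve \<sigma> \<mu> w (\<phi> k) (z + h *\<^sub>R axis i 1)) has_real_derivative
     \<sigma> * convolve \<sigma> \<mu> w (\<phi> (k(i := Suc (k i)))) z) (at 0)"
proof -
  let ?k = "k(i := Suc (k i))"
  obtain c where c: "0 \<le> c" "\<And>x. \<bar>\<phi> ?k x\<bar> \<le> c" using test_family_bounded[OF tf] by blast
  define g where "g y h = \<phi> k (\<sigma> *\<^sub>R (z - y) + (\<sigma> * h) *\<^sub>R axis i 1)" for y h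
  have gD: "(g y has_real_derivative \<sigma> * \<phi> ?k (\<sigma> *\<^sub>R (z - y) + (\<sigma> * h) *\<^sub>R axis i 1)) (at h)" for y h
    unfolding g_def by (rule test_family_DERIV[OF tf])
  have gL: "\<bar>g y h - g y 0\<bar> \<le> (\<bar>\<sigma>\<bar> * c) * \<bar>h\<bar>" for y h
  proof -
    have "norm (g y h - g y 0) \<le> (\<bar>\<sigma>\<bar> * c) * norm (h - 0)"
    proof (rule field_differentiable_bound[of UNIV])
      show "(g y has_field_derivative \<sigma> * \<phi> ?k (\<sigma> *\<^sub>R (z - y) + (\<sigma> * h) *\<^sub>R axis i 1)) (at h)" for h
        by (rule gD)
    qed (use c in \<open>auto simp: abs_mult intro: mult_left_mono\<close>)
    then show ?thesis by simp
  qed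
  have geq: "\<phi> k (\<sigma> *\<^sub>R (z + h *\<^sub>R axis i 1 - y)) = g y h" for y h
    unfolding g_def by (simp add: algebra_simps)
  have gint: "integrable \<mu> (\<lambda>y. w y * g y h)" for h
    using convolve_integrable[of k "z + h *\<^sub>R axis i 1"] unfolding geq .
  have "(\<lambda>h. (convolve \<sigma> \<mu> w (\<phi> k) (z + h *\<^sub>R axis i 1) - convolve \<sigma> \<mu> w (\<phi> k) (z + 0 *\<^sub>R axis i 1)) / h)
      \<midarrow>0\<rightarrow> \<sigma> * convolve \<sigma> \<mu> w (\<phi> ?k) z"
    unfolding tendsto_at_iff_sequentially comp_def
  proof (intro allI impI)
    fix X :: "nat \<Rightarrow> real" assume X0: "\<forall>n. X n \<in> UNIV - {0}" and X: "X \<longlonglongrightarrow> 0"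
    have 1: "(convolve \<sigma> \<mu> w (\<phi> k) (z + X n *\<^sub>R axis i 1) - convolve \<sigma> \<mu> w (\<phi> k) (z + 0 *\<^sub>R axis i 1)) / X n
        = (\<integral>y. w y * ((g y (X n) - g y 0) / X n) \<partial>\<mu>)" for n
      unfolding convolve_def geq using gint by (simp add: right_diff_distrib diff_divide_distrib)
    have 2: "\<sigma> * convolve \<sigma> \<mu> w (\<phi> ?k) z = (\<integral>y. w y * (\<sigma> * \<phi> ?k (\<sigma> *\<^sub>R (z - y))) \<partial>\<mu>)"
      unfolding convolve_def by (simp add: mult.left_commute)
    show "(\<lambda>n. (convolve \<sigma> \<mu> w (\<phi> k) (z + X n *\<^sub>R axis i 1) - convolve \<sigma> \<mu> w (\<phi> k) (z + 0 *\<^sub>R axis i 1)) / X n)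
        \<longlonglongrightarrow> \<sigma> * convolve \<sigma> \<mu> w (\<phi> ?k) z"
      unfolding 1 2
    proof (rule integral_dominated_convergence[where w = "\<lambda>y. (\<bar>\<sigma>\<bar> * c) * \<bar>w y\<bar>"])
      show "integrable \<mu> (\<lambda>y. \<bar>\<sigma>\<bar> * c * \<bar>w y\<bar>)" using w by simp
      have "(\<lambda>n. (g y (X n) - g y 0) / X n) \<longlonglongrightarrow> \<sigma> * \<phi> ?k (\<sigma> *\<^sub>R (z - y))" for y
      proof -
        have "(\<lambda>h. (g y (0 + h) - g y 0) / h) \<midarrow>0\<rightarrow> \<sigma> * \<phi> ?k (\<sigma> *\<^sub>R (z - y))"
          using gD[of y 0] unfolding DERIV_def by simp
        then show ?thesis using X0 X unfolding tendsto_at_iff_sequentially comp_def by auto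
      qed
      then show "AE y in \<mu>. (\<lambda>n. w y * ((g y (X n) - g y 0) / X n)) \<longlonglongrightarrow> w y * (\<sigma> * \<phi> ?k (\<sigma> *\<^sub>R (z - y)))"
        by (intro AE_I2 tendsto_mult tendsto_const)
      show "AE y in \<mu>. norm (w y * ((g y (X n) - g y 0) / X n)) \<le> \<bar>\<sigma>\<bar> * c * \<bar>w y\<bar>" for n
      proof (intro AE_I2)
        fix y
        have "\<bar>(g y (X n) - g y 0) / X n\<bar> \<le> \<bar>\<sigma>\<bar> * c"
          using gL[of y "X n"] X0 by (simp add: abs_divide divide_le_eq)
        from mult_right_mono[OF this, of "\<bar>w y\<bar>"]
        show "norm (w y * ((g y (X n) - g y 0) / X n)) \<le> \<bar>\<sigma>\<bar> * c * \<bar>w y\<bar>"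
          by (simp only: real_norm_def abs_mult mult.commute[of "\<bar>w y\<bar>"] abs_ge_zero)
      qed
      show "(\<lambda>y. w y * ((g y (X n) - g y 0) / X n)) \<in> borel_measurable \<mu>" for n
      proof -
        have "(\<lambda>y. (w y * g y (X n) - w y * g y 0) / X n) \<in> borel_measurable \<mu>"
          using gint by (intro borel_measurable_divide borel_measurable_diff) auto
        then show ?thesis by (simp add: right_diff_distrib diff_divide_distrib)
      qed
      show "(\<lambda>y. w y * (\<sigma> * \<phi> ?k (\<sigma> *\<^sub>R (z - y)))) \<in> borel_measurable \<mu>"
        using borel_measurable_integrable[OF convolve_integrable[of ?k z]]
        by (simp add: mult.left_commute borel_measurable_times)
    qed
  qed
  then show ?thesis unfolding DERIV_def by simp
qed

lemma convolve_cmult_DERIV: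
  "((\<lambda>h. a * convolve \<sigma> \<mu> w (\<phi> k) (z + h *\<^sub>R axis i 1)) has_real_derivative
     (a * \<sigma>) * convolve \<sigma> \<mu> w (\<phi> (k(i := Suc (k i)))) z) (at 0)"
  using DERIV_cmult[OF convolve_DERIV[of k z i], of a] by (simp add: mult.assoc)

lemma partial_convolve:
  "partial i (\<lambda>z. a * convolve \<sigma> \<mu> w (\<phi> k) z)
    = (\<lambda>z. (a * \<sigma>) * convolve \<sigma> \<mu> w (\<phi> (k(i := Suc (k i)))) z)"
  unfolding partial_def fun_eq_iff using convolve_cmult_DERIV by (auto intro: DERIV_imp_deriv)

lemma C_class_convolve: "C_class q (\<lambda>z. a * convolve \<sigma> \<mu> w (\<phi> k) z)"
proof (induction q arbitrary: a k)
  case 0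
  then show ?case by (auto intro!: continuous_intros convolve_continuous)
next
  case (Suc q)
  have "(\<lambda>h. a * convolve \<sigma> \<mu> w (\<phi> k) (x + h *\<^sub>R axis i 1)) differentiable at 0" for i x
    using convolve_cmult_DERIV[of a k x i] real_differentiable_def by blast
  then show ?case using Suc by (auto simp: partial_convolve intro!: continuous_intros convolve_continuous)
qed

lemma funpow_partial_convolve:
  "(partial i ^^ m) (\<lambda>z. a * convolve \<sigma> \<mu> w (\<phi> k) z)
    = (\<lambda>z. (a * \<sigma> ^ m) * convolve \<sigma> \<mu> w (\<phi> (k(i := k i + m))) z)"
proof (induction m)
  case (Suc m)
  show ?case unfolding funpow.simps comp_apply Suc.IH partial_convolve by (simp add: mult_ac fun_upd_def cong: if_cong)
qed simp

lemma mderiv_convolve: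
  "mderiv \<gamma> (convolve \<sigma> \<mu> w (\<phi> k))
    = (\<lambda>z. \<sigma> ^ multi_size \<gamma> * convolve \<sigma> \<mu> w (\<phi> (shift_index \<gamma> k)) z)"
proof -
  have "foldr (\<lambda>i. partial i ^^ \<gamma> i) is (\<lambda>z. 1 * convolve \<sigma> \<mu> w (\<phi> k) z)
    = (\<lambda>z. \<sigma> ^ sum_list (map \<gamma> is) *
        convolve \<sigma> \<mu> w (\<phi> (foldr (\<lambda>i k. k(i := k i + \<gamma> i)) is k)) z)" for "is"
    by (induction "is") (auto simp: funpow_partial_convolve power_add mult_ac simp del: fun_upd_apply)
  from this[of coords] show ?thesis
    unfolding mderiv_def shift_index_def sum_list_coords by simp
qed

end

lemma lborel_reflect_nn_integral:
  fixes f :: "real ^ 'n::finite \<Rightarrow> ennreal"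
  assumes "f \<in> borel_measurable borel"
  shows "(\<integral>\<^sup>+y. f (z - y) \<partial>lborel) = (\<integral>\<^sup>+y. f y \<partial>lborel)"
proof -
  have l: "lborel = density (distr lborel borel (\<lambda>x::real ^ 'n. z + (-1) *\<^sub>R x)) (\<lambda>_. ennreal (\<bar>-1\<bar> ^ DIM(real ^ 'n)))"
    by (rule lborel_affine) simp
  have "(\<integral>\<^sup>+y. f y \<partial>lborel) = (\<integral>\<^sup>+y. f y \<partial>distr lborel borel (\<lambda>x::real ^ 'n. z + (-1) *\<^sub>R x))"
    by (subst l) (simp add: density_1)
  also have "\<dots> = (\<integral>\<^sup>+y. f (z - y) \<partial>lborel)"
    using assms by (subst nn_integral_distr) auto
  finally show ?thesis by simp
qed

lemma lborel_reflect_integral: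
  fixes f :: "real ^ 'n::finite \<Rightarrow> real"
  assumes "f \<in> borel_measurable borel"
  shows "(\<integral>y. f (z - y) \<partial>lborel) = (\<integral>y. f y \<partial>lborel)"
proof -
  have l: "lborel = density (distr lborel borel (\<lambda>x::real ^ 'n. z + (-1) *\<^sub>R x)) (\<lambda>_. ennreal (\<bar>-1\<bar> ^ DIM(real ^ 'n)))"
    by (rule lborel_affine) simp
  have "(\<integral>y. f y \<partial>lborel) = (\<integral>y. f y \<partial>distr lborel borel (\<lambda>x::real ^ 'n. z + (-1) *\<^sub>R x))"
    by (subst l) (simp add: density_1)
  also have "\<dots> = (\<integral>y. f (z - y) \<partial>lborel)"
    using assms by (subst integral_distr) auto
  finally show ?thesis by simp
qed

lemma test_family_translate_integrable:
  assumes "test_family r \<phi>" "G \<in> M_b"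
  shows "integrable lborel (\<lambda>y. G y * \<phi> k (z - y))"
proof -
  obtain c where c: "0 \<le> c" "\<And>x. \<bar>G x\<bar> \<le> c" using M_b_bounded[OF assms(2)] by blast
  have mG: "G \<in> borel_measurable borel" using M_b_measurable[OF assms(2)] .
  have m: "\<phi> k \<in> borel_measurable borel" by (rule test_family_measurable[OF assms(1)])
  have m': "(\<lambda>y. \<phi> k (z - y)) \<in> borel_measurable borel"
    by (rule measurable_compose[OF _ m]) measurable
  have "(\<integral>\<^sup>+y. ennreal (norm (G y * \<phi> k (z - y))) \<partial>lborel) \<le> (\<integral>\<^sup>+y. ennreal c * ennreal \<bar>\<phi> k (z - y)\<bar> \<partial>lborel)"
    using c by (intro nn_integral_mono) (auto simp: abs_mult ennreal_mult'[symmetric] intro!: ennreal_leI mult_right_mono)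
  also have "\<dots> = ennreal c * (\<integral>\<^sup>+y. ennreal \<bar>\<phi> k y\<bar> \<partial>lborel)"
    using lborel_reflect_nn_integral[of "\<lambda>y. ennreal \<bar>\<phi> k y\<bar>" z] m m' by (simp add: nn_integral_cmult)
  also have "\<dots> < \<infinity>"
    using test_family_integrable[OF assms(1), of k]
    by (simp add: integrable_iff_bounded ennreal_mult_less_top)
  finally show ?thesis
    using mG m' by (intro integrableI_bounded) auto
qed

lemma test_family_Fubini:
  fixes \<mu> :: "(real ^ 'n::finite) measure"
  assumes tf: "test_family r \<phi>" and G: "G \<in> M_b" and fin: "finite_measure \<mu>" and sets: "sets \<mu> = sets borel"
  shows "integrable lborel (\<lambda>y. G y * (\<integral>z. \<phi> k (z - y) \<partial>\<mu>))"
    and "(\<integral>y. G y * (\<integral>z. \<phi> k (z - y) \<partial>\<mu>) \<partial>lborel) = (\<integral>z. (\<integral>y. G y * \<phi> k (z - y) \<partial>lborel) \<partial>\<mu>)"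
proof -
  interpret \<mu>: finite_measure \<mu> by (rule fin)
  interpret pair_sigma_finite \<mu> "lborel :: (real ^ 'n) measure" ..
  obtain c where c: "0 \<le> c" "\<And>x. \<bar>G x\<bar> \<le> c" using M_b_bounded[OF G] by blast
  have m: "\<phi> k \<in> borel_measurable borel" by (rule test_family_measurable[OF tf])
  have ss: "sets (\<mu> \<Otimes>\<^sub>M (lborel :: (real ^ 'n) measure)) = sets borel"
  proof -
    have "sets (\<mu> \<Otimes>\<^sub>M (lborel :: (real ^ 'n) measure)) = sets (borel \<Otimes>\<^sub>M borel)"
      using sets by (intro sets_pair_measure_cong) auto
    then show ?thesis by (simp only: borel_prod)
  qed
  have meas: "(\<lambda>(z, y). G y * \<phi> k (z - y)) \<in> borel_measurable (\<mu> \<Otimes>\<^sub>M (lborel :: (real ^ 'n) measure))"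
    unfolding measurable_cong_sets[OF ss refl] split_beta
    by (intro borel_measurable_times measurable_compose[OF _ m] measurable_compose[OF _ M_b_measurable[OF G]]
        borel_measurable_continuous_onI continuous_intros)
  define A where "A = (\<integral>\<^sup>+y. ennreal \<bar>\<phi> k y\<bar> \<partial>(lborel :: (real ^ 'n) measure))"
  have A: "A < \<infinity>" using test_family_integrable[OF tf, of k] by (simp add: integrable_iff_bounded A_def)
  have "(\<integral>\<^sup>+p. ennreal (norm (case p of (z, y) \<Rightarrow> G y * \<phi> k (z - y))) \<partial>(\<mu> \<Otimes>\<^sub>M (lborel :: (real ^ 'n) measure)))
      = (\<integral>\<^sup>+z. (\<integral>\<^sup>+y. ennreal (norm (G y * \<phi> k (z - y))) \<partial>(lborel :: (real ^ 'n) measure)) \<partial>\<mu>)"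
    using meas by (subst lborel.nn_integral_fst[symmetric]) (auto simp: split_beta)
  also have "\<dots> \<le> (\<integral>\<^sup>+z. ennreal c * A \<partial>\<mu>)"
  proof (rule nn_integral_mono)
    fix z
    have m': "(\<lambda>y. \<phi> k (z - y)) \<in> borel_measurable borel"
      by (rule measurable_compose[OF _ m]) measurable
    have "(\<integral>\<^sup>+y. ennreal (norm (G y * \<phi> k (z - y))) \<partial>lborel) \<le> (\<integral>\<^sup>+y. ennreal c * ennreal \<bar>\<phi> k (z - y)\<bar> \<partial>lborel)"
      using c by (intro nn_integral_mono) (auto simp: abs_mult ennreal_mult'[symmetric] intro!: ennreal_leI mult_right_mono)
    also have "\<dots> = ennreal c * A"
      using lborel_reflect_nn_integral[of "\<lambda>y. ennreal \<bar>\<phi> k y\<bar>" z] m m' by (simp add: nn_integral_cmult A_def)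
    finally show "(\<integral>\<^sup>+y. ennreal (norm (G y * \<phi> k (z - y))) \<partial>lborel) \<le> ennreal c * A" .
  qed
  also have "\<dots> < \<infinity>"
    using A less_top[THEN iffD1, OF \<mu>.emeasure_finite[unfolded infinity_ennreal_def], of "space \<mu>"]
    by (simp add: ennreal_mult_less_top)
  finally have int: "integrable (\<mu> \<Otimes>\<^sub>M (lborel :: (real ^ 'n) measure)) (\<lambda>(z, y). G y * \<phi> k (z - y))"
    by (intro integrableI_bounded meas)
  have eq: "(\<integral>z. G y * \<phi> k (z - y) \<partial>\<mu>) = G y * (\<integral>z. \<phi> k (z - y) \<partial>\<mu>)" for y by simp
  show "integrable lborel (\<lambda>y. G y * (\<integral>z. \<phi> k (z - y) \<partial>\<mu>))"
    using integrable_snd[OF int] by simp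
  show "(\<integral>y. G y * (\<integral>z. \<phi> k (z - y) \<partial>\<mu>) \<partial>lborel) = (\<integral>z. (\<integral>y. G y * \<phi> k (z - y) \<partial>lborel) \<partial>\<mu>)"
    using Fubini_integral[OF int] by simp
qed

section \<open>Densities dual to a smoothing functional\<close>
text \<open>Mollification at scale \<open>r\<close> averages over the ball of radius \<open>r\<close>, so it cannot leave an interval that contains the
  values there.\<close>
lemma test_family_integral_bound:
  assumes tf: "test_family r \<phi>" and nn: "\<And>x. 0 \<le> \<phi> (\<lambda>_. 0) x" and one: "(\<integral>x. \<phi> (\<lambda>_. 0) x \<partial>lborel) = 1"
    and G: "G \<in> M_b" and b: "\<And>y. norm (z - y) \<le> r \<Longrightarrow> \<bar>G y - g\<bar> \<le> e"
  shows "\<bar>(\<integral>y. G y * \<phi> (\<lambda>_. 0) (z - y) \<partial>lborel) - g\<bar> \<le> e"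
proof -
  have one': "(\<integral>y. \<phi> (\<lambda>_. 0) (z - y) \<partial>lborel) = 1"
    using lborel_reflect_integral[OF test_family_measurable[OF tf]] one by simp
  have M1: "(\<lambda>_. 1) \<in> M_b" by (rule M_bI[of _ 1]) auto
  have i1: "integrable lborel (\<lambda>y. \<phi> (\<lambda>_. 0) (z - y))"
    using test_family_translate_integrable[OF tf M1] by simp
  note iG = test_family_translate_integrable[OF tf G]
  have "(\<integral>y. G y * \<phi> (\<lambda>_. 0) (z - y) \<partial>lborel) - g
      = (\<integral>y. G y * \<phi> (\<lambda>_. 0) (z - y) - g * \<phi> (\<lambda>_. 0) (z - y) \<partial>lborel)"
    using i1 iG one' by simp
  also have "\<bar>\<dots>\<bar> \<le> (\<integral>y. \<bar>G y * \<phi> (\<lambda>_. 0) (z - y) - g * \<phi> (\<lambda>_. 0) (z - y)\<bar> \<partial>lborel)"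
    by (rule integral_abs_bound)
  also have "\<dots> \<le> (\<integral>y. e * \<phi> (\<lambda>_. 0) (z - y) \<partial>lborel)"
  proof (rule integral_mono)
    fix y
    show "\<bar>G y * \<phi> (\<lambda>_. 0) (z - y) - g * \<phi> (\<lambda>_. 0) (z - y)\<bar> \<le> e * \<phi> (\<lambda>_. 0) (z - y)"
    proof (cases "\<phi> (\<lambda>_. 0) (z - y) = 0")
      case False
      then have "norm (z - y) \<le> r" using tf unfolding test_family_def by blast
      then have "\<bar>G y - g\<bar> * \<phi> (\<lambda>_. 0) (z - y) \<le> e * \<phi> (\<lambda>_. 0) (z - y)"
        using b nn by (intro mult_right_mono) auto
      then show ?thesis using nn[of "z - y"] by (simp add: left_diff_distrib[symmetric] abs_mult)
    qed simp
  qed (use i1 iG in auto)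
  also have "\<dots> = e" using one' by simp
  finally show ?thesis .
qed

text \<open>The hypothesis says that the distributional derivatives up to order \<open>k\<close> of the signed measure
  \<open>\<lambda> = \<rho>1 - \<rho>2\<close> are measures of total mass at most \<open>c\<close>. Mollifying can only decrease these masses: the \<open>L\<^sup>1\<close> norm
  of a derivative of the mollified density \<open>p\<close> is its integral against its own sign \<open>s\<close>, and Fubini's theorem
  moves the mollifier from \<open>\<lambda>\<close> to \<open>s\<close>, where it produces a test function bounded by 1.\<close>
lemma mollified_dual:
  fixes \<rho>1 \<rho>2 :: "(real ^ 'n::finite) measure" and \<phi> :: "('n \<Rightarrow> nat) \<Rightarrow> real ^ 'n \<Rightarrow> real"
  assumes fin: "finite_measure \<rho>1" "finite_measure \<rho>2"
    and sets: "sets \<rho>1 = sets borel" "sets \<rho>2 = sets borel"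
    and H: "\<And>\<gamma> h. multi_size \<gamma> \<le> k \<Longrightarrow> h \<in> C_c_infty \<Longrightarrow> mderiv \<gamma> h \<in> M_b \<Longrightarrow> (\<And>x. \<bar>h x\<bar> \<le> 1) \<Longrightarrow>
        \<bar>(\<integral>z. mderiv \<gamma> h z \<partial>\<rho>1) - (\<integral>z. mderiv \<gamma> h z \<partial>\<rho>2)\<bar> \<le> c"
    and tf: "test_family r \<phi>" and nn: "\<And>x. 0 \<le> \<phi> (\<lambda>_. 0) x" and one: "(\<integral>x. \<phi> (\<lambda>_. 0) x \<partial>lborel) = 1"
  defines "p \<equiv> \<lambda>y. (\<integral>z. \<phi> (\<lambda>_. 0) (z - y) \<partial>\<rho>1) - (\<integral>z. \<phi> (\<lambda>_. 0) (z - y) \<partial>\<rho>2)"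
  shows "p \<in> C_1 k"
    and "C_1_norm k p \<le> ennreal (real (card {\<gamma> :: 'n \<Rightarrow> nat. multi_size \<gamma> \<le> k}) * c)"
    and "G \<in> M_b \<Longrightarrow> (\<integral>y. G y * p y \<partial>lborel)
      = (\<integral>z. (\<integral>y. G y * \<phi> (\<lambda>_. 0) (z - y) \<partial>lborel) \<partial>\<rho>1) - (\<integral>z. (\<integral>y. G y * \<phi> (\<lambda>_. 0) (z - y) \<partial>lborel) \<partial>\<rho>2)"
proof -
  define D where "D \<kappa> y = (\<integral>z. \<phi> \<kappa> (z - y) \<partial>\<rho>1) - (\<integral>z. \<phi> \<kappa> (z - y) \<partial>\<rho>2)" for \<kappa> y
  have one_int: "integrable \<rho>1 (\<lambda>_. 1::real)" "integrable \<rho>2 (\<lambda>_. 1::real)"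
    using fin finite_measure.integrable_const by blast+
  have conv: "convolve (-1) \<mu> (\<lambda>_. 1) (\<phi> \<kappa>) = (\<lambda>y. \<integral>z. \<phi> \<kappa> (z - y) \<partial>\<mu>)" for \<mu> \<kappa>
    unfolding convolve_def by (simp add: fun_eq_iff)
  have CD: "C_class q (\<lambda>y. \<integral>z. \<phi> \<kappa> (z - y) \<partial>\<rho>1)" "C_class q (\<lambda>y. \<integral>z. \<phi> \<kappa> (z - y) \<partial>\<rho>2)" for q \<kappa>
    using C_class_convolve[OF sets(1) one_int(1) tf, of q 1 "-1" \<kappa>]
      C_class_convolve[OF sets(2) one_int(2) tf, of q 1 "-1" \<kappa>] unfolding conv by simp_all
  have Cp: "C_class q p" for q
    using C_class_lincomb[OF CD(1)[of q "\<lambda>_. 0"] CD(2)[of q "\<lambda>_. 0"], of 1 "-1"] unfolding p_def by simp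
  have mp: "mderiv \<gamma> p = (\<lambda>y. (-1) ^ multi_size \<gamma> * D (shift_index \<gamma> (\<lambda>_. 0)) y)" for \<gamma>
    using mderiv_lincomb[OF CD(1)[of "multi_size \<gamma>" "\<lambda>_. 0"] CD(2)[of "multi_size \<gamma>" "\<lambda>_. 0"], of \<gamma> 1 "-1"]
      mderiv_convolve[OF sets(1) one_int(1) tf, of \<gamma> "-1" "\<lambda>_. 0"]
      mderiv_convolve[OF sets(2) one_int(2) tf, of \<gamma> "-1" "\<lambda>_. 0"]
    unfolding conv p_def D_def by (simp add: right_diff_distrib)
  have Fub: "integrable lborel (\<lambda>y. G y * D \<kappa> y)"
    "(\<integral>y. G y * D \<kappa> y \<partial>lborel)
      = (\<integral>z. (\<integral>y. G y * \<phi> \<kappa> (z - y) \<partial>lborel) \<partial>\<rho>1) - (\<integral>z. (\<integral>y. G y * \<phi> \<kappa> (z - y) \<partial>lborel) \<partial>\<rho>2)"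
    if G: "G \<in> M_b" for G \<kappa>
    using test_family_Fubini[OF tf G fin(1) sets(1), of \<kappa>] test_family_Fubini[OF tf G fin(2) sets(2), of \<kappa>]
    unfolding D_def by (simp_all add: right_diff_distrib)
  have M1: "(\<lambda>_. 1) \<in> M_b" by (rule M_bI[of _ 1]) auto
  have Dint: "integrable lborel (D \<kappa>)" for \<kappa> using Fub(1)[OF M1] by simp
  show "p \<in> C_1 k"
    unfolding C_1_def using Cp Dint by (auto simp: mp)
  have bound: "(\<integral>y. indicator (ball 0 R) y * \<bar>D (shift_index \<gamma> (\<lambda>_. 0)) y\<bar> \<partial>lborel) \<le> c"
    if \<gamma>: "multi_size \<gamma> \<le> k" for R \<gamma>
  proof -
    let ?\<kappa> = "shift_index \<gamma> (\<lambda>_. 0)"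
    \<comment> \<open>The restriction to a ball gives the mollification of s compact support; it is removed by letting R grow.\<close>
    define s where "s y = indicator (ball 0 R) y * sgn (D ?\<kappa> y)" for y
    have sb: "\<bar>s y\<bar> \<le> indicator (ball 0 R) y" for y
      unfolding s_def by (auto simp: indicator_def abs_sgn_eq)
    have s1: "\<bar>s y\<bar> \<le> 1" for y
      unfolding s_def by (auto simp: indicator_def abs_sgn_eq)
    have sm: "s \<in> borel_measurable borel"
      unfolding s_def using borel_measurable_integrable[OF Dint[of ?\<kappa>]]
      by (intro borel_measurable_times borel_measurable_sgn borel_measurable_indicator) simp_all
    have sM: "s \<in> M_b" by (rule M_bI[OF sm s1])
    have ball: "integrable lborel (indicator (ball 0 R) :: real ^ 'n \<Rightarrow> real)"
      by (rule integrable_real_indicator) (simp, rule emeasure_bounded_finite, simp)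
    have sint: "integrable lborel s"
      by (rule Bochner_Integration.integrable_bound[OF ball]) (use sm sb in auto)
    define h where "h = convolve 1 lborel s (\<phi> (\<lambda>_. 0))"
    have heq: "h z = (\<integral>y. s y * \<phi> (\<lambda>_. 0) (z - y) \<partial>lborel)" for z unfolding h_def convolve_def by simp
    have mh: "mderiv \<gamma> h = (\<lambda>z. \<integral>y. s y * \<phi> ?\<kappa> (z - y) \<partial>lborel)"
      unfolding h_def mderiv_convolve[OF sets_lborel sint tf] by (simp add: convolve_def)
    have hC: "C_class q h" for q
      using C_class_convolve[OF sets_lborel sint tf, of q 1 1] unfolding h_def by simp
    have h1: "\<bar>h z\<bar> \<le> 1" for z
    proof -
      have "\<bar>h z - 0\<bar> \<le> 1"
        unfolding heq by (rule test_family_integral_bound[OF tf nn one sM]) (use s1 in simp)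
      then show ?thesis by simp
    qed
    have "h \<in> C_c_infty"
    proof -
      have "{z. h z \<noteq> 0} \<subseteq> cball 0 (R + r)"
      proof
        fix z assume "z \<in> {z. h z \<noteq> 0}"
        have "\<exists>y. s y * \<phi> (\<lambda>_. 0) (z - y) \<noteq> 0"
        proof (rule ccontr)
          assume "\<not> ?thesis"
          then have "(\<lambda>y. s y * \<phi> (\<lambda>_. 0) (z - y)) = (\<lambda>y. 0)" by blast
          then have "h z = 0" unfolding heq by simp
          then show False using \<open>z \<in> {z. h z \<noteq> 0}\<close> by simp
        qed
        then obtain y where y: "s y \<noteq> 0" "\<phi> (\<lambda>_. 0) (z - y) \<noteq> 0" by auto
        have "norm y < R" using y(1) unfolding s_def by (auto simp: indicator_def split: if_splits)
        moreover have "norm (z - y) \<le> r" using tf y(2) unfolding test_family_def by blast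
        ultimately have "norm z \<le> R + r" using norm_triangle_ineq[of y "z - y"] by simp
        then show "z \<in> cball 0 (R + r)" by simp
      qed
      then have "bounded {z. h z \<noteq> 0}" using bounded_cball bounded_subset by blast
      then have "compact (closure {z. h z \<noteq> 0})" by (simp add: compact_closure)
      then show ?thesis unfolding C_c_infty_def using hC by simp
    qed
    moreover have "mderiv \<gamma> h \<in> M_b"
    proof -
      obtain a where a: "0 \<le> a" "\<And>x. \<bar>\<phi> ?\<kappa> x\<bar> \<le> a" using test_family_bounded[OF tf] by blast
      have "\<bar>mderiv \<gamma> h z\<bar> \<le> (\<integral>y. a * indicator (ball 0 R) y \<partial>(lborel :: (real ^ 'n) measure))" for z
      proof -
        have "\<bar>mderiv \<gamma> h z\<bar> \<le> (\<integral>y. \<bar>s y * \<phi> ?\<kappa> (z - y)\<bar> \<partial>lborel)"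
          unfolding mh by (rule integral_abs_bound)
        also have "\<dots> \<le> (\<integral>y. a * indicator (ball 0 R) y \<partial>(lborel :: (real ^ 'n) measure))"
        proof (rule integral_mono)
          show "integrable lborel (\<lambda>y. \<bar>s y * \<phi> ?\<kappa> (z - y)\<bar>)"
            using test_family_translate_integrable[OF tf sM] by simp
          show "integrable lborel (\<lambda>y::real ^ 'n. a * indicator (ball 0 R) y)"
            using ball by simp
          show "\<bar>s y * \<phi> ?\<kappa> (z - y)\<bar> \<le> a * indicator (ball 0 R) y" for y
            using mult_mono[OF sb[of y] a(2)[of "z - y"]] by (simp add: abs_mult mult.commute)
        qed
        finally show ?thesis .
      qed
      moreover have "mderiv \<gamma> h \<in> borel_measurable borel" by (rule mderiv_measurable[OF hC order_refl])
      ultimately show ?thesis by (intro M_bI)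
    qed
    ultimately have "\<bar>(\<integral>z. mderiv \<gamma> h z \<partial>\<rho>1) - (\<integral>z. mderiv \<gamma> h z \<partial>\<rho>2)\<bar> \<le> c"
      using h1 by (intro H[OF \<gamma>])
    then have "(\<integral>y. s y * D ?\<kappa> y \<partial>lborel) \<le> c"
      unfolding Fub(2)[OF sM] mh by simp
    moreover have "s y * D ?\<kappa> y = indicator (ball 0 R) y * \<bar>D ?\<kappa> y\<bar>" for y
      unfolding s_def by (simp add: abs_sgn mult.assoc mult.commute)
    ultimately show ?thesis by simp
  qed
  have L1: "L1_norm (D (shift_index \<gamma> (\<lambda>_. 0))) \<le> ennreal c" if \<gamma>: "multi_size \<gamma> \<le> k" for \<gamma>
  proof -
    let ?D = "D (shift_index \<gamma> (\<lambda>_. 0))"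
    have Dm: "?D \<in> borel_measurable borel"
      using borel_measurable_integrable[OF Dint[of "shift_index \<gamma> (\<lambda>_. 0)"]] by simp
    have "(\<lambda>N. \<integral>y. indicator (ball 0 (real N)) y * \<bar>?D y\<bar> \<partial>lborel) \<longlonglongrightarrow> (\<integral>y. \<bar>?D y\<bar> \<partial>lborel)"
    proof (rule integral_dominated_convergence[where w = "\<lambda>y. \<bar>?D y\<bar>"])
      show "AE y in lborel. (\<lambda>N. indicator (ball 0 (real N)) y * \<bar>?D y\<bar>) \<longlonglongrightarrow> \<bar>?D y\<bar>"
      proof (intro AE_I2)
        fix y :: "real ^ 'n"
        obtain N0 where "norm y < real N0" using reals_Archimedean2 by blast
        then have "eventually (\<lambda>N. indicator (ball 0 (real N)) y * \<bar>?D y\<bar> = \<bar>?D y\<bar>) sequentially"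
          by (intro eventually_sequentiallyI[of N0]) (auto simp: indicator_def)
        then show "(\<lambda>N. indicator (ball 0 (real N)) y * \<bar>?D y\<bar>) \<longlonglongrightarrow> \<bar>?D y\<bar>"
          by (rule tendsto_eventually)
      qed
      show "(\<lambda>y. indicator (ball 0 (real N)) y * \<bar>?D y\<bar>) \<in> borel_measurable lborel" for N
        using Dm by (intro borel_measurable_times borel_measurable_abs borel_measurable_indicator) simp_all
      show "AE y in lborel. norm (indicator (ball 0 (real N)) y * \<bar>?D y\<bar>) \<le> \<bar>?D y\<bar>" for N
        by (auto simp: indicator_def)
    qed (use Dint Dm in auto)
    then have "(\<integral>y. \<bar>?D y\<bar> \<partial>lborel) \<le> c"
      by (rule LIMSEQ_le_const2) (use bound[OF \<gamma>] in auto)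
    then show ?thesis
      unfolding L1_norm_def using Dint by (subst nn_integral_eq_integral) (auto intro: ennreal_leI)
  qed
  have sgn: "L1_norm (\<lambda>y. (-1) ^ m * g y) = L1_norm g" for m :: nat and g :: "real ^ 'n \<Rightarrow> real"
    unfolding L1_norm_def by (simp add: abs_mult power_abs)
  have "C_1_norm k p \<le> (\<Sum>\<gamma> | multi_size (\<gamma> :: 'n \<Rightarrow> nat) \<le> k. ennreal c)"
    unfolding C_1_norm_def mp sgn by (intro sum_mono) (use L1 in auto)
  also have "\<dots> = ennreal (real (card {\<gamma> :: 'n \<Rightarrow> nat. multi_size \<gamma> \<le> k}) * c)"
    by (simp add: ennreal_mult' ennreal_of_nat_eq_real_of_nat)
  finally show "C_1_norm k p \<le> ennreal (real (card {\<gamma> :: 'n \<Rightarrow> nat. multi_size \<gamma> \<le> k}) * c)" .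
  show "(\<integral>y. G y * p y \<partial>lborel)
      = (\<integral>z. (\<integral>y. G y * \<phi> (\<lambda>_. 0) (z - y) \<partial>lborel) \<partial>\<rho>1) - (\<integral>z. (\<integral>y. G y * \<phi> (\<lambda>_. 0) (z - y) \<partial>lborel) \<partial>\<rho>2)"
    if "G \<in> M_b"
    using Fub(2)[OF that, of "\<lambda>_. 0"] unfolding D_def p_def .
qed

text \<open>A functional with bounded distributional derivatives is a limit of densities bounded in \<open>C_1 k\<close>. These
  densities are what a dual operator can be applied to.\<close>
lemma smooth_dual_densities:
  fixes \<rho>1 \<rho>2 :: "(real ^ 'n::finite) measure"
  assumes fin: "finite_measure \<rho>1" "finite_measure \<rho>2"
    and sets: "sets \<rho>1 = sets borel" "sets \<rho>2 = sets borel"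
    and H: "\<And>\<gamma> h. multi_size \<gamma> \<le> k \<Longrightarrow> h \<in> C_c_infty \<Longrightarrow> mderiv \<gamma> h \<in> M_b \<Longrightarrow> (\<And>x. \<bar>h x\<bar> \<le> 1) \<Longrightarrow>
        \<bar>(\<integral>z. mderiv \<gamma> h z \<partial>\<rho>1) - (\<integral>z. mderiv \<gamma> h z \<partial>\<rho>2)\<bar> \<le> c"
  shows "\<exists>p :: nat \<Rightarrow> real ^ 'n \<Rightarrow> real.
      (\<forall>N. p N \<in> C_1 k \<and> C_1_norm k (p N) \<le> ennreal (real (card {\<gamma> :: 'n \<Rightarrow> nat. multi_size \<gamma> \<le> k}) * c)) \<and>
      (\<forall>G\<in>C_b 0. (\<lambda>N. \<integral>y. G y * p N y \<partial>lborel) \<longlonglongrightarrow> (\<integral>z. G z \<partial>\<rho>1) - (\<integral>z. G z \<partial>\<rho>2))"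
proof -
  define r where "r N = 1 / real (Suc N)" for N
  have r: "0 < r N" for N by (simp add: r_def)
  have "\<exists>\<phi> :: ('n \<Rightarrow> nat) \<Rightarrow> real ^ 'n \<Rightarrow> real. test_family (r N) \<phi> \<and> (\<forall>x. 0 \<le> \<phi> (\<lambda>_. 0) x) \<and>
      (\<integral>x. \<phi> (\<lambda>_. 0) x \<partial>lborel) = 1" for N
    using mollifier_exists[OF r[of N]] by metis
  then obtain \<phi> :: "nat \<Rightarrow> ('n \<Rightarrow> nat) \<Rightarrow> real ^ 'n \<Rightarrow> real" where
    tf: "\<And>N. test_family (r N) (\<phi> N)" and nn: "\<And>N x. 0 \<le> \<phi> N (\<lambda>_. 0) x" and
    one: "\<And>N. (\<integral>x. \<phi> N (\<lambda>_. 0) x \<partial>lborel) = 1" by metis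
  define p where "p N y = (\<integral>z. \<phi> N (\<lambda>_. 0) (z - y) \<partial>\<rho>1) - (\<integral>z. \<phi> N (\<lambda>_. 0) (z - y) \<partial>\<rho>2)" for N y
  have pd: "p N = (\<lambda>y. (\<integral>z. \<phi> N (\<lambda>_. 0) (z - y) \<partial>\<rho>1) - (\<integral>z. \<phi> N (\<lambda>_. 0) (z - y) \<partial>\<rho>2))" for N
    unfolding p_def by simp
  have dual1: "p N \<in> C_1 k" for N
    unfolding pd by (rule mollified_dual(1)[OF fin sets H tf nn one])
  have dual2: "C_1_norm k (p N) \<le> ennreal (real (card {\<gamma> :: 'n \<Rightarrow> nat. multi_size \<gamma> \<le> k}) * c)" for N
    unfolding pd by (rule mollified_dual(2)[OF fin sets H tf nn one])
  have "(\<lambda>N. \<integral>y. G y * p N y \<partial>lborel) \<longlonglongrightarrow> (\<integral>z. G z \<partial>\<rho>1) - (\<integral>z. G z \<partial>\<rho>2)" if G: "G \<in> C_b 0" for G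
  proof -
    have GM: "G \<in> M_b" by (rule C_b_0_imp_M_b[OF G])
    obtain a where a: "0 \<le> a" "\<And>x. \<bar>G x\<bar> \<le> a" using M_b_bounded[OF GM] by blast
    define g where "g N z = (\<integral>y. G y * \<phi> N (\<lambda>_. 0) (z - y) \<partial>lborel)" for N z
    have ga: "\<bar>g N z\<bar> \<le> a" for N z
      using test_family_integral_bound[OF tf nn one GM, where g = 0 and e = a] a unfolding g_def by simp
    have glim: "(\<lambda>N. g N z) \<longlonglongrightarrow> G z" for z
    proof (rule LIMSEQ_I)
      fix e :: real assume e: "0 < e"
      have "isCont G z" using G unfolding C_b_0_iff by (simp add: continuous_on_eq_continuous_at)
      then obtain d where d: "0 < d" "\<And>y. dist y z < d \<Longrightarrow> dist (G y) (G z) < e / 2"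
        using e unfolding continuous_at_eps_delta by (meson half_gt_zero)
      obtain N0 where N0: "inverse (real (Suc N0)) < d" using reals_Archimedean d(1) by blast
      have "norm (g N z - G z) < e" if "N0 \<le> N" for N
      proof -
        have "r N \<le> inverse (real (Suc N0))"
          unfolding r_def inverse_eq_divide using that by (intro divide_left_mono) auto
        then have rd: "r N < d" using N0 by simp
        have "\<bar>g N z - G z\<bar> \<le> e / 2"
          unfolding g_def
        proof (rule test_family_integral_bound[OF tf nn one GM])
          fix y assume "norm (z - y) \<le> r N"
          then have "dist y z < d" using rd by (simp add: dist_norm norm_minus_commute)
          then show "\<bar>G y - G z\<bar> \<le> e / 2" using d(2)[of y] by (simp add: dist_real_def)
        qed
        then show ?thesis using e by simp
      qed
      then show "\<exists>N0. \<forall>N\<ge>N0. norm (g N z - G z) < e" by blast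
    qed
    have gm: "g N \<in> borel_measurable borel" for N
    proof -
      have "(\<lambda>(z, y). G y * \<phi> N (\<lambda>_. 0) (z - y)) \<in> borel_measurable (borel \<Otimes>\<^sub>M lborel)"
      proof -
        have "sets ((borel :: (real ^ 'n) measure) \<Otimes>\<^sub>M (lborel :: (real ^ 'n) measure)) = sets ((borel :: (real ^ 'n) measure) \<Otimes>\<^sub>M (borel :: (real ^ 'n) measure))"
          by (intro sets_pair_measure_cong) auto
        then have ss: "sets ((borel :: (real ^ 'n) measure) \<Otimes>\<^sub>M (lborel :: (real ^ 'n) measure)) = sets (borel :: ((real ^ 'n) \<times> (real ^ 'n)) measure)"
          by (simp only: borel_prod)
        show ?thesis
          unfolding measurable_cong_sets[OF ss refl] split_beta
          by (intro borel_measurable_times measurable_compose[OF _ test_family_measurable[OF tf]]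
              measurable_compose[OF _ M_b_measurable[OF GM]] borel_measurable_continuous_onI continuous_intros)
      qed
      then show ?thesis unfolding g_def by (rule lborel.borel_measurable_lebesgue_integral)
    qed
    have lim: "(\<lambda>N. \<integral>z. g N z \<partial>\<mu>) \<longlonglongrightarrow> (\<integral>z. G z \<partial>\<mu>)"
      if "finite_measure \<mu>" "sets \<mu> = sets borel" for \<mu>
    proof (rule integral_dominated_convergence[where w = "\<lambda>_. a"])
      show "integrable \<mu> (\<lambda>_. a)" using that(1) by (rule finite_measure.integrable_const)
      show "G \<in> borel_measurable \<mu>" "g N \<in> borel_measurable \<mu>" for N
        unfolding measurable_cong_sets[OF that(2) refl] using gm M_b_measurable[OF GM] by auto
    qed (use glim ga in auto)
    have "(\<integral>y. G y * p N y \<partial>lborel) = (\<integral>z. g N z \<partial>\<rho>1) - (\<integral>z. g N z \<partial>\<rho>2)" for N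
      unfolding pd g_def by (rule mollified_dual(3)[OF fin sets H tf nn one GM])
    then show ?thesis using lim[OF fin(1) sets(1)] lim[OF fin(2) sets(2)] by (simp add: tendsto_diff)
  qed
  then show ?thesis using dual1 dual2 by blast
qed

section \<open>Operators of finite order\<close>
lemma M_b_times_integrable:
  assumes "g \<in> M_b" "integrable lborel f" shows "integrable lborel (\<lambda>x. g x * f x)"
proof -
  obtain c where c: "0 \<le> c" "\<And>x. \<bar>g x\<bar> \<le> c" using M_b_bounded[OF assms(1)] by blast
  show ?thesis
  proof (rule Bochner_Integration.integrable_bound)
    show "integrable lborel (\<lambda>x. c * f x)" using assms(2) by simp
    show "(\<lambda>x. g x * f x) \<in> borel_measurable lborel"
      using M_b_measurable[OF assms(1)] assms(2) by auto
    have "\<bar>g x * f x\<bar> \<le> \<bar>c * f x\<bar>" for x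
      using mult_right_mono[OF c(2)[of x], of "\<bar>f x\<bar>"] c(1) by (simp add: abs_mult)
    then show "AE x in lborel. norm (g x * f x) \<le> norm (c * f x)" by simp
  qed
qed

lemma is_dual_comp:
  assumes "is_dual A f h" "is_dual B h k" "signed_kernel B"
  shows "is_dual (\<lambda>g. A (B g)) f k"
  using assms signed_kernel_M_b[OF assms(3)] unfolding is_dual_def by auto

lemma is_dual_diff:
  assumes "is_dual A f h" "is_dual B f k" "signed_kernel A" "signed_kernel B" "integrable lborel f"
  shows "is_dual (\<lambda>g x. A g x - B g x) f (\<lambda>x. h x - k x)"
proof -
  have i: "integrable lborel h" "integrable lborel k" using assms unfolding is_dual_def by auto
  have "(\<integral>x. (A g x - B g x) * f x \<partial>lborel) = (\<integral>x. g x * (h x - k x) \<partial>lborel)" if g: "g \<in> M_b" for g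
  proof -
    have "(\<integral>x. (A g x - B g x) * f x \<partial>lborel) = (\<integral>x. A g x * f x \<partial>lborel) - (\<integral>x. B g x * f x \<partial>lborel)"
      using M_b_times_integrable[OF signed_kernel_M_b[OF assms(3) g] assms(5)]
        M_b_times_integrable[OF signed_kernel_M_b[OF assms(4) g] assms(5)] by (simp add: left_diff_distrib)
    also have "\<dots> = (\<integral>x. g x * h x \<partial>lborel) - (\<integral>x. g x * k x \<partial>lborel)"
      using assms(1,2) g unfolding is_dual_def by simp
    also have "\<dots> = (\<integral>x. g x * (h x - k x) \<partial>lborel)"
      using M_b_times_integrable[OF g i(1)] M_b_times_integrable[OF g i(2)] by (simp add: right_diff_distrib)
    finally show ?thesis .
  qed
  then show ?thesis unfolding is_dual_def using i by auto
qed

lemma is_dual_cong: "is_dual A f h \<Longrightarrow> (\<And>g. g \<in> M_b \<Longrightarrow> B g = A g) \<Longrightarrow> is_dual B f h"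
  unfolding is_dual_def by simp

lemma C_b_norm_zero: "C_class q (f :: real ^ 'n::finite \<Rightarrow> real) \<Longrightarrow> C_b_norm q (\<lambda>x::real ^ 'n. 0) = 0"
  unfolding C_b_norm_def
  by (rule sum.neutral) (use mderiv_lincomb[of q f f _ 0 0] in \<open>auto simp: sup_norm_def\<close>)

lemma C_1_norm_zero: "C_class q (f :: real ^ 'n::finite \<Rightarrow> real) \<Longrightarrow> C_1_norm q (\<lambda>x::real ^ 'n. 0) = 0"
  unfolding C_1_norm_def
  by (rule sum.neutral) (use mderiv_lincomb[of q f f _ 0 0] in \<open>auto simp: L1_norm_def\<close>)

text \<open>The relation \<open>R\<close> loses \<open>k\<close> derivatives on the scale of spaces \<open>C\<close> with norms \<open>N\<close>. A relation is used rather than a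
  function because the dual of an operator is only determined up to null sets; \<open>R\<close> will be \<open>h = A f\<close> on \<open>C_b\<close>
  and \<open>is_dual A f h\<close> on \<open>C_1\<close>. The constant separates the size \<open>e\<close>, which carries the powers of \<open>n\<close>,
  from \<open>M (k + r) ^ a\<close>, which collects \<open>a\<close> constants of the hypotheses. When \<open>M\<close> is increasing and at least 1,
  composition adds \<open>k\<close> and \<open>a\<close> and multiplies \<open>e\<close>.\<close>
definition bounded_relation :: "(nat \<Rightarrow> (real ^ 'n::finite \<Rightarrow> real) set) \<Rightarrow>
    (nat \<Rightarrow> (real ^ 'n \<Rightarrow> real) \<Rightarrow> ennreal) \<Rightarrow> ((real ^ 'n \<Rightarrow> real) \<Rightarrow> (real ^ 'n \<Rightarrow> real) \<Rightarrow> bool) \<Rightarrow>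
    (nat \<Rightarrow> real) \<Rightarrow> nat \<Rightarrow> nat \<Rightarrow> real \<Rightarrow> bool" where
  "bounded_relation C N R M k a e \<longleftrightarrow>
     (\<forall>r. \<forall>f\<in>C (k + r). \<exists>h\<in>C r. R f h \<and> N r h \<le> ennreal (e * M (k + r) ^ a) * N (k + r) f)"

lemma bounded_relationI:
  assumes "\<And>r f. f \<in> C (k + r) \<Longrightarrow> \<exists>h\<in>C r. R f h \<and> N r h \<le> ennreal (e * M (k + r) ^ a) * N (k + r) f"
  shows "bounded_relation C N R M k a e"
  using assms unfolding bounded_relation_def by blast

lemma bounded_relationE:
  assumes "bounded_relation C N R M k a e" "f \<in> C (k + r)"
  obtains h where "h \<in> C r" "R f h" "N r h \<le> ennreal (e * M (k + r) ^ a) * N (k + r) f"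
  using assms unfolding bounded_relation_def by blast

lemma bounded_relation_weaken:
  assumes "bounded_relation C N R M k a e" "\<And>f h r. f \<in> C (k + r) \<Longrightarrow> R f h \<Longrightarrow> S f h"
  shows "bounded_relation C N S M k a e"
  using assms unfolding bounded_relation_def by meson

lemma pow_mono_weight:
  assumes M: "\<And>r. 1 \<le> M r" "mono M" and le: "r \<le> s" "a \<le> b"
  shows "(M r :: real) ^ a \<le> M s ^ b"
  using M(1)[of r] M(1)[of s] monoD[OF M(2) le(1)] power_mono[of "M r" "M s" a]
    power_increasing[of a b "M s"] le(2) by linarith

text \<open>What the sup norms on \<open>C_b\<close> and the \<open>L\<^sup>1\<close> norms on \<open>C_1\<close> have in common, so that each estimate for
  operators is proved once for the operator and its dual.\<close>
locale graded_space =
  fixes C :: "nat \<Rightarrow> (real ^ 'n::finite \<Rightarrow> real) set" and N :: "nat \<Rightarrow> (real ^ 'n \<Rightarrow> real) \<Rightarrow> ennreal"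
  assumes C_mono: "f \<in> C q \<Longrightarrow> p \<le> q \<Longrightarrow> f \<in> C p"
    and N_mono: "p \<le> q \<Longrightarrow> N p f \<le> N q f"
    and C_diff: "f \<in> C q \<Longrightarrow> g \<in> C q \<Longrightarrow> (\<lambda>x. f x - g x) \<in> C q"
    and N_diff: "f \<in> C q \<Longrightarrow> g \<in> C q \<Longrightarrow> N q (\<lambda>x. f x - g x) \<le> N q f + N q g"
    and N_zero: "f \<in> C q \<Longrightarrow> N q (\<lambda>x. 0) = 0"
begin

lemma bounded_relation_diff:
  assumes R: "bounded_relation C N R M k a e" and S: "bounded_relation C N S M k a e'"
    and nn: "0 \<le> e" "0 \<le> e'" "\<And>r. 0 \<le> M r"
    and RS: "\<And>f h h' r. f \<in> C (k + r) \<Longrightarrow> R f h \<Longrightarrow> S f h' \<Longrightarrow> U f (\<lambda>x. h x - h' x)"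
  shows "bounded_relation C N U M k a (e + e')"
proof (rule bounded_relationI)
  fix r f assume f: "f \<in> C (k + r)"
  obtain h where h: "h \<in> C r" "R f h" "N r h \<le> ennreal (e * M (k + r) ^ a) * N (k + r) f"
    using bounded_relationE[OF R f] .
  obtain h' where h': "h' \<in> C r" "S f h'" "N r h' \<le> ennreal (e' * M (k + r) ^ a) * N (k + r) f"
    using bounded_relationE[OF S f] .
  have c: "ennreal ((e + e') * M (k + r) ^ a) = ennreal (e * M (k + r) ^ a) + ennreal (e' * M (k + r) ^ a)"
    using nn by (simp add: distrib_right ennreal_plus[symmetric] del: ennreal_plus)
  note N_diff[OF h(1) h'(1)]
  also have "N r h + N r h' \<le> ennreal (e * M (k + r) ^ a) * N (k + r) f + ennreal (e' * M (k + r) ^ a) * N (k + r) f"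
    by (rule add_mono[OF h(3) h'(3)])
  also have "\<dots> = ennreal ((e + e') * M (k + r) ^ a) * N (k + r) f"
    unfolding c by (rule distrib_right[symmetric])
  finally have "N r (\<lambda>x. h x - h' x) \<le> ennreal ((e + e') * M (k + r) ^ a) * N (k + r) f" .
  then show "\<exists>h\<in>C r. U f h \<and> N r h \<le> ennreal ((e + e') * M (k + r) ^ a) * N (k + r) f"
    using C_diff[OF h(1) h'(1)] RS[OF f h(2) h'(2)] by blast
qed

lemma bounded_relation_zero:
  assumes "\<And>f. R f (\<lambda>x. 0)"
  shows "bounded_relation C N R M k a 0"
proof (rule bounded_relationI)
  fix r f assume "f \<in> C (k + r)"
  then have f: "f \<in> C r" by (rule C_mono) simp
  have "(\<lambda>x. 0) \<in> C r" using C_diff[OF f f] by simp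
  then show "\<exists>h\<in>C r. R f h \<and> N r h \<le> ennreal (0 * M (k + r) ^ a) * N (k + r) f"
    using assms N_zero[OF f] by (intro bexI[of _ "\<lambda>x. 0"]) auto
qed

context
  fixes M :: "nat \<Rightarrow> real"
  assumes M: "\<And>r. 1 \<le> M r" "mono M"
begin

lemma M_nonneg: "0 \<le> M r" using M(1)[of r] by linarith

lemma bounded_relation_mono:
  assumes R: "bounded_relation C N R M k a e" and le: "k \<le> k'" "a \<le> a'" "e \<le> e'" and e: "0 \<le> e"
  shows "bounded_relation C N R M k' a' e'"
proof (rule bounded_relationI)
  fix r f assume f: "f \<in> C (k' + r)"
  have kr: "k + r \<le> k' + r" using le by simp
  obtain h where h: "h \<in> C r" "R f h" "N r h \<le> ennreal (e * M (k + r) ^ a) * N (k + r) f"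
    using bounded_relationE[OF R C_mono[OF f kr]] .
  note h(3)
  also have "ennreal (e * M (k + r) ^ a) * N (k + r) f \<le> ennreal (e' * M (k' + r) ^ a') * N (k' + r) f"
    using le e M_nonneg by (intro mult_mono ennreal_leI N_mono kr pow_mono_weight[OF M]) auto
  finally show "\<exists>h\<in>C r. R f h \<and> N r h \<le> ennreal (e' * M (k' + r) ^ a') * N (k' + r) f"
    using h(1,2) by blast
qed

lemma bounded_relation_trans:
  assumes R: "bounded_relation C N R M k a e" and S: "bounded_relation C N S M k' a' e'"
    and e: "0 \<le> e" "0 \<le> e'"
    and RS: "\<And>f g h r. f \<in> C (k + k' + r) \<Longrightarrow> R f g \<Longrightarrow> S g h \<Longrightarrow> U f h"
  shows "bounded_relation C N U M (k + k') (a + a') (e * e')"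
proof (rule bounded_relationI)
  fix r f assume f: "f \<in> C (k + k' + r)"
  have "f \<in> C (k + (k' + r))" using f by (simp add: add.assoc)
  then obtain g where g: "g \<in> C (k' + r)" "R f g"
      "N (k' + r) g \<le> ennreal (e * M (k + (k' + r)) ^ a) * N (k + (k' + r)) f"
    by (rule bounded_relationE[OF R])
  obtain h where h: "h \<in> C r" "S g h" "N r h \<le> ennreal (e' * M (k' + r) ^ a') * N (k' + r) g"
    using bounded_relationE[OF S g(1)] .
  let ?M = "M (k + k' + r)"
  note h(3)
  also have "ennreal (e' * M (k' + r) ^ a') * N (k' + r) g
      \<le> ennreal (e' * ?M ^ a') * (ennreal (e * ?M ^ a) * N (k + k' + r) f)"
    using e g(3) by (intro mult_mono ennreal_leI mult_left_mono pow_mono_weight[OF M]) (auto simp: add.assoc)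
  also have "\<dots> = ennreal (e * e' * ?M ^ (a + a')) * N (k + k' + r) f"
  proof -
    have "ennreal (e * e' * ?M ^ (a + a')) = ennreal (e' * ?M ^ a') * ennreal (e * ?M ^ a)"
      using e M_nonneg by (subst ennreal_mult[symmetric]) (simp_all add: power_add mult_ac)
    then show ?thesis by (simp only: mult.assoc)
  qed
  finally show "\<exists>h\<in>C r. U f h \<and> N r h \<le> ennreal (e * e' * ?M ^ (a + a')) * N (k + k' + r) f"
    using h(1) RS[OF f g(2) h(2)] by blast
qed

end

end

interpretation Cb: graded_space C_b C_b_norm
proof
  show "C_b_norm q (\<lambda>x. f x - g x) \<le> C_b_norm q f + C_b_norm q g"
    if "f \<in> C_b q" "g \<in> C_b q" for f g :: "real ^ 'n \<Rightarrow> real" and q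
    using that unfolding C_b_def by (intro C_b_norm_diff) auto
  show "C_b_norm q (\<lambda>x::real ^ 'n. 0) = 0" if "f \<in> C_b q" for f :: "real ^ 'n \<Rightarrow> real" and q
    by (rule C_b_norm_zero[of q f]) (use that in \<open>auto simp: C_b_def\<close>)
qed (auto intro: C_b_mono C_b_norm_mono C_b_diff)

interpretation C1: graded_space C_1 C_1_norm
proof
  show "C_1_norm q (\<lambda>x. f x - g x) \<le> C_1_norm q f + C_1_norm q g"
    if "f \<in> C_1 q" "g \<in> C_1 q" for f g :: "real ^ 'n \<Rightarrow> real" and q
    using that unfolding C_1_def by (intro C_1_norm_diff) auto
  show "C_1_norm q (\<lambda>x::real ^ 'n. 0) = 0" if "f \<in> C_1 q" for f :: "real ^ 'n \<Rightarrow> real" and q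
    by (rule C_1_norm_zero[of q f]) (use that in \<open>auto simp: C_1_def\<close>)
qed (auto intro: C_1_mono C_1_norm_mono C_1_diff)

text \<open>An operator that loses \<open>k\<close> derivatives, together with its dual. The condition on \<open>C_b 0\<close> does not follow
  from the others when \<open>k > 0\<close>; it is what allows \<open>A f\<close> to be integrated against a weakly convergent sequence of
  densities in \<open>smoothing_bound_regularizing\<close>.\<close>
definition order_bound :: "(nat \<Rightarrow> real) \<Rightarrow> nat \<Rightarrow> nat \<Rightarrow> real \<Rightarrow> 'n::finite oper \<Rightarrow> bool" where
  "order_bound M k a e A \<longleftrightarrow>
     signed_kernel A \<and> (\<forall>f\<in>C_b 0. A f \<in> C_b 0) \<and>
     bounded_relation C_b C_b_norm (\<lambda>f h. h = A f) M k a e \<and>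
     bounded_relation C_1 C_1_norm (is_dual A) M k a e"

lemma order_boundD:
  assumes "order_bound M k a e A"
  shows "signed_kernel A" and "f \<in> C_b 0 \<Longrightarrow> A f \<in> C_b 0"
    and "f \<in> C_b (k + r) \<Longrightarrow> A f \<in> C_b r"
    and "f \<in> C_b (k + r) \<Longrightarrow> C_b_norm r (A f) \<le> ennreal (e * M (k + r) ^ a) * C_b_norm (k + r) f"
    and "f \<in> C_1 (k + r) \<Longrightarrow> \<exists>h\<in>C_1 r. is_dual A f h \<and>
        C_1_norm r h \<le> ennreal (e * M (k + r) ^ a) * C_1_norm (k + r) f"
    and "bounded_relation C_b C_b_norm (\<lambda>f h. h = A f) M k a e"
    and "bounded_relation C_1 C_1_norm (is_dual A) M k a e"
  using assms unfolding order_bound_def bounded_relation_def by blast+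

lemma order_boundI:
  assumes "signed_kernel A" "\<And>f. f \<in> C_b 0 \<Longrightarrow> A f \<in> C_b 0"
    and "\<And>r f. f \<in> C_b (k + r) \<Longrightarrow> A f \<in> C_b r"
    and "\<And>r f. f \<in> C_b (k + r) \<Longrightarrow> C_b_norm r (A f) \<le> ennreal (e * M (k + r) ^ a) * C_b_norm (k + r) f"
    and "\<And>r f. f \<in> C_1 (k + r) \<Longrightarrow> \<exists>h\<in>C_1 r. is_dual A f h \<and>
        C_1_norm r h \<le> ennreal (e * M (k + r) ^ a) * C_1_norm (k + r) f"
  shows "order_bound M k a e A"
  using assms unfolding order_bound_def bounded_relation_def by blast

lemma order_bound_cong:
  assumes A: "order_bound M k a e A" and eq: "\<And>f. f \<in> M_b \<Longrightarrow> B f = A f"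
  shows "order_bound M k a e B"
  unfolding order_bound_def
proof (intro conjI ballI)
  show "signed_kernel B" by (rule signed_kernel_cong[OF order_boundD(1)[OF A] eq])
  show "B f \<in> C_b 0" if "f \<in> C_b 0" for f
    using order_boundD(2)[OF A that] eq[OF C_b_imp_M_b[OF that]] by simp
  show "bounded_relation C_b C_b_norm (\<lambda>f h. h = B f) M k a e"
    by (rule bounded_relation_weaken[OF order_boundD(6)[OF A]]) (simp add: eq[OF C_b_imp_M_b])
  show "bounded_relation C_1 C_1_norm (is_dual B) M k a e"
    by (rule bounded_relation_weaken[OF order_boundD(7)[OF A]]) (rule is_dual_cong[OF _ eq])
qed

lemma order_bound_diff:
  assumes A: "order_bound M k a e A" and B: "order_bound M k a e' B"
    and nn: "0 \<le> e" "0 \<le> e'" "\<And>r. 0 \<le> M r"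
  shows "order_bound M k a (e + e') (\<lambda>f x. A f x - B f x)"
  unfolding order_bound_def
proof (intro conjI ballI)
  show "signed_kernel (\<lambda>f x. A f x - B f x)"
    by (rule signed_kernel_op_diff[OF order_boundD(1)[OF A] order_boundD(1)[OF B]])
  show "(\<lambda>x. A f x - B f x) \<in> C_b 0" if "f \<in> C_b 0" for f
    by (rule C_b_diff[OF order_boundD(2)[OF A that] order_boundD(2)[OF B that]])
  show "bounded_relation C_b C_b_norm (\<lambda>f h. h = (\<lambda>x. A f x - B f x)) M k a (e + e')"
    by (rule Cb.bounded_relation_diff[OF order_boundD(6)[OF A] order_boundD(6)[OF B] nn]) simp
  show "bounded_relation C_1 C_1_norm (is_dual (\<lambda>f x. A f x - B f x)) M k a (e + e')"
    by (rule C1.bounded_relation_diff[OF order_boundD(7)[OF A] order_boundD(7)[OF B] nn])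
       (rule is_dual_diff[OF _ _ order_boundD(1)[OF A] order_boundD(1)[OF B] C_1_integrable])
qed

lemma order_bound_zero: "order_bound M k a 0 ((\<lambda>f x. 0) :: 'n::finite oper)"
  unfolding order_bound_def
proof (intro conjI ballI)
  show "signed_kernel ((\<lambda>f x. 0) :: 'n oper)" by (rule positive_imp_signed_kernel[OF positive_kernel_zero])
  show "(\<lambda>x::real ^ 'n. 0) \<in> C_b 0" by (simp add: C_b_0_iff)
  show "bounded_relation C_b C_b_norm (\<lambda>f h. h = (\<lambda>x::real ^ 'n. 0)) M k a 0"
    by (rule Cb.bounded_relation_zero) simp
  show "bounded_relation C_1 C_1_norm (is_dual ((\<lambda>f x. 0) :: 'n oper)) M k a 0"
    by (rule C1.bounded_relation_zero) (simp add: is_dual_def)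
qed

lemma order_bound_add:
  assumes A: "order_bound M k a e A" and B: "order_bound M k a e' B"
    and nn: "0 \<le> e" "0 \<le> e'" "\<And>r. 0 \<le> M r"
  shows "order_bound M k a (e + e') (\<lambda>f x. A f x + B f x)"
  using order_bound_diff[OF A order_bound_diff[OF order_bound_zero B]] nn by simp

lemma order_bound_id: "order_bound M 0 0 1 ((\<lambda>f. f) :: 'n::finite oper)"
proof (rule order_boundI)
  show "signed_kernel ((\<lambda>f. f) :: 'n oper)" by (rule positive_imp_signed_kernel[OF positive_kernel_id])
  show "\<exists>h\<in>C_1 r. is_dual ((\<lambda>f. f) :: 'n oper) f h \<and> C_1_norm r h \<le> ennreal (1 * M (0 + r) ^ 0) * C_1_norm (0 + r) f"
    if "f \<in> C_1 (0 + r)" for f :: "real ^ 'n \<Rightarrow> real" and r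
    using that C_1_integrable[OF that] by (intro bexI[of _ f]) (auto simp: is_dual_def mult.commute)
qed auto

section \<open>Smoothing operators\<close>
text \<open>\<open>A\<close> has lost \<open>k\<close> derivatives out of a supply of \<open>q\<close>, and the remaining ones are available to every operator \<open>C\<close>
  applied on its left. Testing against such \<open>C\<close>, rather than bounding derivatives of \<open>A f\<close>, keeps all functionals
  in the argument signed measures.\<close>
definition smoothing_bound :: "(nat \<Rightarrow> real) \<Rightarrow> nat \<Rightarrow> nat \<Rightarrow> nat \<Rightarrow> real \<Rightarrow> 'n::finite oper \<Rightarrow> bool" where
  "smoothing_bound M q k a e A \<longleftrightarrow> signed_kernel A \<and>
     (\<forall>C k1 c1. signed_kernel C \<longrightarrow> k1 + k \<le> q \<longrightarrow> 0 \<le> c1 \<longrightarrow>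
        (\<forall>f\<in>C_b k1. sup_norm (C f) \<le> ennreal c1 * C_b_norm k1 f) \<longrightarrow>
        (\<forall>f\<in>C_b 0. sup_norm (C (A f)) \<le> ennreal (c1 * (e * M q ^ a)) * sup_norm f))"

lemma smoothing_boundD:
  assumes "smoothing_bound M q k a e A"
  shows "signed_kernel A"
    and "signed_kernel C \<Longrightarrow> k1 + k \<le> q \<Longrightarrow> 0 \<le> c1 \<Longrightarrow>
        (\<And>f. f \<in> C_b k1 \<Longrightarrow> sup_norm (C f) \<le> ennreal c1 * C_b_norm k1 f) \<Longrightarrow>
        f \<in> C_b 0 \<Longrightarrow> sup_norm (C (A f)) \<le> ennreal (c1 * (e * M q ^ a)) * sup_norm f"
  using assms unfolding smoothing_bound_def by blast+

lemma smoothing_boundI: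
  assumes "signed_kernel A"
    and "\<And>C k1 c1 f. signed_kernel C \<Longrightarrow> k1 + k \<le> q \<Longrightarrow> 0 \<le> c1 \<Longrightarrow>
        (\<And>f. f \<in> C_b k1 \<Longrightarrow> sup_norm (C f) \<le> ennreal c1 * C_b_norm k1 f) \<Longrightarrow>
        f \<in> C_b 0 \<Longrightarrow> sup_norm (C (A f)) \<le> ennreal (c1 * (e * M q ^ a)) * sup_norm f"
  shows "smoothing_bound M q k a e A"
  using assms unfolding smoothing_bound_def by blast

text \<open>The regularization property of a single operator, with the singular factor in time frozen to \<open>\<rho>\<close>.\<close>
definition regularizing :: "nat \<Rightarrow> real \<Rightarrow> 'n::finite oper \<Rightarrow> bool" where
  "regularizing q \<rho> R \<longleftrightarrow> signed_kernel R \<and> (\<forall>f\<in>M_b. R f \<in> C_b_infty) \<and>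
     (\<forall>r \<gamma>. multi_size \<gamma> + r \<le> q \<longrightarrow>
        (\<forall>f\<in>C_c_infty. C_b_norm r (R (mderiv \<gamma> f)) \<le> ennreal \<rho> * sup_norm f))"

context
  fixes M :: "nat \<Rightarrow> real"
  assumes M_ge_1: "\<And>r. 1 \<le> M r" and mono_M: "mono M"
begin

lemma M_nonneg: "0 \<le> M r" using M_ge_1[of r] by linarith

lemmas M_pow_mono = pow_mono_weight[OF M_ge_1 mono_M]

lemma order_bound_mono:
  assumes A: "order_bound M k a e A" and le: "k \<le> k'" "a \<le> a'" "e \<le> e'" and e: "0 \<le> e"
  shows "order_bound M k' a' e' A"
  using order_boundD(1,2)[OF A] Cb.bounded_relation_mono[OF M_ge_1 mono_M order_boundD(6)[OF A] le e]
    C1.bounded_relation_mono[OF M_ge_1 mono_M order_boundD(7)[OF A] le e]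
  unfolding order_bound_def by blast

text \<open>On \<open>C_b\<close> the inner operator acts first, on \<open>C_1\<close> the dual of the outer one; the orders add either way.\<close>
lemma order_bound_comp:
  assumes A: "order_bound M k a e A" and B: "order_bound M k' a' e' B" and e: "0 \<le> e" "0 \<le> e'"
  shows "order_bound M (k + k') (a + a') (e * e') (\<lambda>f. A (B f))"
  unfolding order_bound_def
proof (intro conjI ballI)
  show "signed_kernel (\<lambda>f. A (B f))"
    by (rule signed_kernel_comp[OF order_boundD(1)[OF A] order_boundD(1)[OF B]])
  show "A (B f) \<in> C_b 0" if "f \<in> C_b 0" for f
    by (rule order_boundD(2)[OF A order_boundD(2)[OF B that]])
  have "bounded_relation C_b C_b_norm (\<lambda>f h. h = A (B f)) M (k' + k) (a' + a) (e' * e)"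
    by (rule Cb.bounded_relation_trans[OF M_ge_1 mono_M order_boundD(6)[OF B] order_boundD(6)[OF A] e(2,1)]) simp
  then show "bounded_relation C_b C_b_norm (\<lambda>f h. h = A (B f)) M (k + k') (a + a') (e * e')"
    by (simp add: add.commute mult.commute)
  show "bounded_relation C_1 C_1_norm (is_dual (\<lambda>f. A (B f))) M (k + k') (a + a') (e * e')"
    by (rule C1.bounded_relation_trans[OF M_ge_1 mono_M order_boundD(7)[OF A] order_boundD(7)[OF B] e])
       (rule is_dual_comp[OF _ _ order_boundD(1)[OF B]])
qed

lemma smoothing_bound_mono:
  fixes A :: "'n::finite oper"
  assumes A: "smoothing_bound M q k a e A" and le: "k \<le> k'" "a \<le> a'" "e \<le> e'" and e: "0 \<le> e"
  shows "smoothing_bound M q k' a' e' A"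
proof (rule smoothing_boundI)
  show "signed_kernel A" by (rule smoothing_boundD(1)[OF A])
  fix C :: "'n oper" and k1 c1 and f :: "real ^ 'n \<Rightarrow> real"
  assume C: "signed_kernel C" "k1 + k' \<le> q" "0 \<le> c1"
    "\<And>f. f \<in> C_b k1 \<Longrightarrow> sup_norm (C f) \<le> ennreal c1 * C_b_norm k1 f" "f \<in> C_b 0"
  have "sup_norm (C (A f)) \<le> ennreal (c1 * (e * M q ^ a)) * sup_norm f"
    by (rule smoothing_boundD(2)[OF A C(1) _ C(3-5)]) (use C(2) le in auto)
  also have "\<dots> \<le> ennreal (c1 * (e' * M q ^ a')) * sup_norm f"
    using C(3) le e M_nonneg by (intro mult_right_mono ennreal_leI mult_left_mono mult_mono M_pow_mono) auto
  finally show "sup_norm (C (A f)) \<le> ennreal (c1 * (e' * M q ^ a')) * sup_norm f" .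
qed

lemma smoothing_bound_add:
  fixes A B :: "'n::finite oper"
  assumes A: "smoothing_bound M q k a e A" and B: "smoothing_bound M q k a e' B" and e: "0 \<le> e" "0 \<le> e'"
  shows "smoothing_bound M q k a (e + e') (\<lambda>f x. A f x + B f x)"
proof (rule smoothing_boundI)
  show "signed_kernel (\<lambda>f x. A f x + B f x)"
    by (rule signed_kernel_op_add[OF smoothing_boundD(1)[OF A] smoothing_boundD(1)[OF B]])
  fix C :: "'n oper" and k1 c1 and f :: "real ^ 'n \<Rightarrow> real"
  assume C: "signed_kernel C" "k1 + k \<le> q" "0 \<le> c1"
    "\<And>f. f \<in> C_b k1 \<Longrightarrow> sup_norm (C f) \<le> ennreal c1 * C_b_norm k1 f" "f \<in> C_b 0"
  have f: "f \<in> M_b" by (rule C_b_imp_M_b[OF C(5)])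
  have "C (\<lambda>x. A f x + B f x) = (\<lambda>x. C (A f) x + C (B f) x)"
    by (rule signed_kernel_add[OF C(1) signed_kernel_M_b[OF smoothing_boundD(1)[OF A] f]
          signed_kernel_M_b[OF smoothing_boundD(1)[OF B] f]])
  then have "sup_norm (C (\<lambda>x. A f x + B f x)) \<le> sup_norm (C (A f)) + sup_norm (C (B f))"
    by (simp add: sup_norm_add)
  also have "\<dots> \<le> ennreal (c1 * (e * M q ^ a)) * sup_norm f + ennreal (c1 * (e' * M q ^ a)) * sup_norm f"
    by (intro add_mono smoothing_boundD(2)[OF A C] smoothing_boundD(2)[OF B C])
  also have "\<dots> = ennreal (c1 * ((e + e') * M q ^ a)) * sup_norm f"
    using C(3) e M_nonneg
    by (simp add: distrib_right[symmetric] ennreal_plus[symmetric] distrib_left[symmetric] del: ennreal_plus)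
  finally show "sup_norm (C (\<lambda>x. A f x + B f x)) \<le> ennreal (c1 * ((e + e') * M q ^ a)) * sup_norm f" .
qed

lemma smoothing_bound_zero: "smoothing_bound M q k a 0 (\<lambda>f x. 0)"
proof (rule smoothing_boundI)
  show "signed_kernel (\<lambda>f x. 0)" by (rule positive_imp_signed_kernel[OF positive_kernel_zero])
qed (auto simp: signed_kernel_zero sup_norm_def)

lemma smoothing_bound_cong:
  fixes A B :: "'n::finite oper"
  assumes A: "smoothing_bound M q k a e A" and eq: "\<And>f. f \<in> M_b \<Longrightarrow> B f = A f"
  shows "smoothing_bound M q k a e B"
proof (rule smoothing_boundI)
  show "signed_kernel B" by (rule signed_kernel_cong[OF smoothing_boundD(1)[OF A] eq])
  fix C :: "'n oper" and k1 c1 and f :: "real ^ 'n \<Rightarrow> real"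
  assume C: "signed_kernel C" "k1 + k \<le> q" "0 \<le> c1"
    "\<And>f. f \<in> C_b k1 \<Longrightarrow> sup_norm (C f) \<le> ennreal c1 * C_b_norm k1 f" "f \<in> C_b 0"
  show "sup_norm (C (B f)) \<le> ennreal (c1 * (e * M q ^ a)) * sup_norm f"
    using smoothing_boundD(2)[OF A C] eq[OF C_b_imp_M_b[OF C(5)]] by simp
qed

text \<open>Composition is associative: a test operator on the left of \<open>B A\<close> is, together with \<open>B\<close>, a test operator on the left of
  \<open>A\<close> whose order is larger by that of \<open>B\<close>.\<close>
lemma smoothing_bound_comp_left:
  fixes A B :: "'n::finite oper"
  assumes B: "order_bound M k' a' e' B" and A: "smoothing_bound M q k a e A" and e: "0 \<le> e" "0 \<le> e'"
  shows "smoothing_bound M q (k' + k) (a' + a) (e' * e) (\<lambda>f. B (A f))"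
proof (rule smoothing_boundI)
  show "signed_kernel (\<lambda>f. B (A f))"
    by (rule signed_kernel_comp[OF order_boundD(1)[OF B] smoothing_boundD(1)[OF A]])
  fix C :: "'n oper" and k1 c1 and f :: "real ^ 'n \<Rightarrow> real"
  assume C: "signed_kernel C" "k1 + (k' + k) \<le> q" "0 \<le> c1"
    "\<And>f. f \<in> C_b k1 \<Longrightarrow> sup_norm (C f) \<le> ennreal c1 * C_b_norm k1 f" "f \<in> C_b 0"
  have k: "k' + k1 + k \<le> q" using C(2) by simp
  have "sup_norm (C (B (A f))) \<le> ennreal ((c1 * (e' * M q ^ a')) * (e * M q ^ a)) * sup_norm f"
  proof (rule smoothing_boundD(2)[OF A signed_kernel_comp[OF C(1) order_boundD(1)[OF B]] k _ _ C(5)])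
    show "0 \<le> c1 * (e' * M q ^ a')" using C(3) e M_nonneg by simp
    fix g :: "real ^ 'n \<Rightarrow> real" assume g: "g \<in> C_b (k' + k1)"
    have "sup_norm (C (B g)) \<le> ennreal c1 * C_b_norm k1 (B g)" by (rule C(4)[OF order_boundD(3)[OF B g]])
    also have "\<dots> \<le> ennreal c1 * (ennreal (e' * M (k' + k1) ^ a') * C_b_norm (k' + k1) g)"
      by (intro mult_left_mono order_boundD(4)[OF B g]) simp
    also have "\<dots> \<le> ennreal c1 * (ennreal (e' * M q ^ a') * C_b_norm (k' + k1) g)"
      using e k M_nonneg by (intro mult_left_mono mult_right_mono ennreal_leI M_pow_mono) auto
    also have "\<dots> = ennreal (c1 * (e' * M q ^ a')) * C_b_norm (k' + k1) g"
      using C(3) e M_nonneg by (simp add: ennreal_mult mult.assoc)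
    finally show "sup_norm (C (B g)) \<le> ennreal (c1 * (e' * M q ^ a')) * C_b_norm (k' + k1) g" .
  qed
  then show "sup_norm (C (B (A f))) \<le> ennreal (c1 * (e' * e * M q ^ (a' + a))) * sup_norm f"
    by (simp add: power_add mult_ac)
qed

text \<open>The regularizing operator pays for both sides. Let \<open>C\<close> be a test operator of order \<open>k1\<close>. For fixed \<open>x\<close>, the signed
  measure \<open>g \<mapsto> C (R g) x\<close> satisfies \<open>\<bar>C (R (mderiv \<gamma> h)) x\<bar> \<le> c1 * \<rho>\<close> for \<open>\<bar>h\<bar> \<le> 1\<close> and \<open>\<bar>\<gamma>\<bar> \<le> k\<close>, because
  \<open>k1 + k \<le> q\<close>. It is therefore a limit of densities bounded in \<open>C_1 k\<close>, and the dual of \<open>B\<close> maps these to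
  densities bounded in \<open>L\<^sup>1\<close>, which need nothing but the sup norm of \<open>f\<close>.\<close>
lemma smoothing_bound_regularizing:
  fixes R B :: "'n::finite oper"
  assumes R: "regularizing q \<rho> R" and B: "order_bound M k a e B" and e: "0 \<le> e" "0 \<le> \<rho>" and k: "k \<le> q"
  shows "smoothing_bound M q k a (real (card {\<gamma> :: 'n \<Rightarrow> nat. multi_size \<gamma> \<le> q}) * \<rho> * e) (\<lambda>f. R (B f))"
proof (rule smoothing_boundI)
  have Rk: "signed_kernel R" using R unfolding regularizing_def by blast
  show "signed_kernel (\<lambda>f. R (B f))"
    by (rule signed_kernel_comp[OF Rk order_boundD(1)[OF B]])
  fix C :: "'n oper" and k1 c1 and f :: "real ^ 'n \<Rightarrow> real"
  assume C: "signed_kernel C" "k1 + k \<le> q" "0 \<le> c1"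
    "\<And>f. f \<in> C_b k1 \<Longrightarrow> sup_norm (C f) \<le> ennreal c1 * C_b_norm k1 f" and f: "f \<in> C_b 0"
  let ?card = "\<lambda>k. real (card {\<gamma> :: 'n \<Rightarrow> nat. multi_size \<gamma> \<le> k})"
  have Bf: "B f \<in> C_b 0" by (rule order_boundD(2)[OF B f])
  have fM: "f \<in> M_b" by (rule C_b_imp_M_b[OF f])
  define F where "F = enn2real (sup_norm f)"
  have F: "sup_norm f = ennreal F" "0 \<le> F"
    unfolding F_def using sup_norm_finite[OF fM] by auto
  have fF: "\<bar>f y\<bar> \<le> F" for y using sup_norm_upper[of f y] unfolding F(1) using F(2) by simp
  define c where "c = ?card k * (c1 * \<rho>) * (e * M k ^ a)"
  have c0: "0 \<le> c" unfolding c_def using e C(3) M_nonneg by simp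
  have "\<bar>C (R (B f)) x\<bar> \<le> F * c" for x
  proof -
    obtain A1 A2 where A: "positive_kernel A1" "positive_kernel A2"
      "\<And>f. f \<in> M_b \<Longrightarrow> C (R f) = (\<lambda>x. A1 f x - A2 f x)"
      using signed_kernel_comp[OF C(1) Rk] unfolding signed_kernel_def by blast
    obtain \<rho>1 where r1: "finite_measure \<rho>1" "sets \<rho>1 = sets borel" "\<And>f. f \<in> M_b \<Longrightarrow> A1 f x = (\<integral>y. f y \<partial>\<rho>1)"
      using positive_kernel_represented[OF A(1)] by metis
    obtain \<rho>2 where r2: "finite_measure \<rho>2" "sets \<rho>2 = sets borel" "\<And>f. f \<in> M_b \<Longrightarrow> A2 f x = (\<integral>y. f y \<partial>\<rho>2)"
      using positive_kernel_represented[OF A(2)] by metis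
    have rep: "C (R g) x = (\<integral>y. g y \<partial>\<rho>1) - (\<integral>y. g y \<partial>\<rho>2)" if "g \<in> M_b" for g
      using A(3)[OF that] r1(3)[OF that] r2(3)[OF that] by simp
    have H: "\<bar>(\<integral>z. mderiv \<gamma> h z \<partial>\<rho>1) - (\<integral>z. mderiv \<gamma> h z \<partial>\<rho>2)\<bar> \<le> c1 * \<rho>"
      if \<gamma>: "multi_size \<gamma> \<le> k" and h: "h \<in> C_c_infty" "mderiv \<gamma> h \<in> M_b" "\<And>x. \<bar>h x\<bar> \<le> 1" for \<gamma> h
    proof -
      have RC: "R (mderiv \<gamma> h) \<in> C_b k1"
        using R h(2) unfolding regularizing_def C_b_infty_def by blast
      have \<gamma>k: "multi_size \<gamma> + k1 \<le> q" using \<gamma> C(2) by simp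
      have "ennreal \<bar>C (R (mderiv \<gamma> h)) x\<bar> \<le> sup_norm (C (R (mderiv \<gamma> h)))" by (rule sup_norm_upper)
      also have "\<dots> \<le> ennreal c1 * C_b_norm k1 (R (mderiv \<gamma> h))" by (rule C(4)[OF RC])
      also have "\<dots> \<le> ennreal c1 * (ennreal \<rho> * sup_norm h)"
        using R \<gamma>k h(1) unfolding regularizing_def by (intro mult_left_mono) auto
      also have "\<dots> \<le> ennreal c1 * (ennreal \<rho> * ennreal 1)"
        by (intro mult_left_mono sup_norm_leI ennreal_leI h(3)) auto
      also have "\<dots> = ennreal (c1 * \<rho>)" using C(3) e by (simp add: ennreal_mult)
      finally show ?thesis using rep[OF h(2)] C(3) e by simp
    qed
    obtain p :: "nat \<Rightarrow> real ^ 'n \<Rightarrow> real" where p: "\<And>N. p N \<in> C_1 k"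
        "\<And>N. C_1_norm k (p N) \<le> ennreal (?card k * (c1 * \<rho>))"
        "\<And>G. G \<in> C_b 0 \<Longrightarrow> (\<lambda>N. \<integral>y. G y * p N y \<partial>lborel) \<longlonglongrightarrow> (\<integral>z. G z \<partial>\<rho>1) - (\<integral>z. G z \<partial>\<rho>2)"
      using smooth_dual_densities[OF r1(1) r2(1) r1(2) r2(2) H] by blast
    have bound: "\<bar>\<integral>y. B f y * p N y \<partial>lborel\<bar> \<le> F * c" for N
    proof -
      have "p N \<in> C_1 (k + 0)" using p(1) by simp
      then obtain h where h: "h \<in> C_1 0" "is_dual B (p N) h" "C_1_norm 0 h \<le> ennreal (e * M (k + 0) ^ a) * C_1_norm (k + 0) (p N)"
        using order_boundD(5)[OF B, of "p N" 0] by blast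
      have hi: "integrable lborel h" using h(2) unfolding is_dual_def by blast
      have "ennreal (\<integral>y. \<bar>h y\<bar> \<partial>lborel) = L1_norm h"
        unfolding L1_norm_def using hi by (subst nn_integral_eq_integral) auto
      also have "\<dots> \<le> ennreal (e * M k ^ a) * C_1_norm k (p N)" using h(3) by (simp add: C_1_norm_0)
      also have "\<dots> \<le> ennreal (e * M k ^ a) * ennreal (?card k * (c1 * \<rho>))" by (intro mult_left_mono p(2)) simp
      also have "\<dots> = ennreal c" unfolding c_def using e C(3) M_nonneg by (simp add: ennreal_mult mult_ac)
      finally have hc: "(\<integral>y. \<bar>h y\<bar> \<partial>lborel) \<le> c" using c0 by simp
      have "(\<integral>y. B f y * p N y \<partial>lborel) = (\<integral>y. f y * h y \<partial>lborel)"
        using h(2) fM unfolding is_dual_def by blast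
      also have "\<bar>\<dots>\<bar> \<le> (\<integral>y. \<bar>f y * h y\<bar> \<partial>lborel)" by (rule integral_abs_bound)
      also have "\<dots> \<le> (\<integral>y. F * \<bar>h y\<bar> \<partial>lborel)"
      proof (rule integral_mono)
        show "integrable lborel (\<lambda>y. \<bar>f y * h y\<bar>)" by (rule integrable_abs[OF M_b_times_integrable[OF fM hi]])
        show "integrable lborel (\<lambda>y. F * \<bar>h y\<bar>)" using hi by simp
        show "\<bar>f y * h y\<bar> \<le> F * \<bar>h y\<bar>" for y
          unfolding abs_mult by (rule mult_right_mono[OF fF]) simp
      qed
      also have "\<dots> \<le> F * c" using hc F(2) by (simp add: mult_left_mono)
      finally show ?thesis .
    qed
    have "(\<lambda>N. \<bar>\<integral>y. B f y * p N y \<partial>lborel\<bar>) \<longlonglongrightarrow> \<bar>C (R (B f)) x\<bar>"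
      unfolding rep[OF C_b_imp_M_b[OF Bf]] by (intro tendsto_rabs p(3) Bf)
    then show ?thesis by (rule LIMSEQ_le_const2) (use bound in auto)
  qed
  then have "sup_norm (C (R (B f))) \<le> ennreal (F * c)" by (intro sup_norm_leI ennreal_leI)
  also have "\<dots> = ennreal c * sup_norm f" using F c0 by (simp add: ennreal_mult mult.commute)
  also have "\<dots> \<le> ennreal (c1 * (?card q * \<rho> * e * M q ^ a)) * sup_norm f"
  proof (intro mult_right_mono ennreal_leI)
    have "card {\<gamma> :: 'n \<Rightarrow> nat. multi_size \<gamma> \<le> k} \<le> card {\<gamma> :: 'n \<Rightarrow> nat. multi_size \<gamma> \<le> q}"
      using k by (intro card_mono finite_multi_size) auto
    then have "c \<le> ?card q * (c1 * \<rho>) * (e * M q ^ a)"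
      unfolding c_def using C(3) e k M_nonneg by (intro mult_mono mult_nonneg_nonneg M_pow_mono) auto
    then show "c \<le> c1 * (?card q * \<rho> * e * M q ^ a)" by (simp add: mult_ac)
  qed simp
  finally show "sup_norm (C (R (B f))) \<le> ennreal (c1 * (?card q * \<rho> * e * M q ^ a)) * sup_norm f" .
qed

end

section \<open>From continuous to measurable functions\<close>
lemma closed_open_approximation:
  fixes \<mu> :: "(real ^ 'n::finite) measure"
  assumes fin: "finite_measure \<mu>" and sets: "sets \<mu> = sets borel" and B: "B \<in> sets borel" and e: "0 < e"
  shows "\<exists>K U. closed K \<and> open U \<and> K \<subseteq> B \<and> B \<subseteq> U \<and> measure \<mu> (U - K) < e"
proof -
  interpret finite_measure \<mu> by (rule fin)
  have sp: "space \<mu> = UNIV" using sets_eq_imp_space_eq[OF sets] by simp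
  have outer: "\<exists>U. open U \<and> B \<subseteq> U \<and> measure \<mu> (U - B) < e / 2" if B: "B \<in> sets borel" for B
  proof -
    have "(INF U\<in>{U. B \<subseteq> U \<and> open U}. emeasure \<mu> U) = emeasure \<mu> B"
      by (rule outer_regular[symmetric, OF sets _ B]) (use emeasure_finite in auto)
    also have "emeasure \<mu> B < emeasure \<mu> B + ennreal (e / 2)"
      using e by (simp add: emeasure_eq_measure ennreal_plus[symmetric] ennreal_less_iff del: ennreal_plus)
    finally obtain U where U: "B \<subseteq> U" "open U" "emeasure \<mu> U < emeasure \<mu> B + ennreal (e / 2)"
      unfolding INF_less_iff by auto
    have "measure \<mu> U < measure \<mu> B + e / 2"
      using U(3) e by (simp add: emeasure_eq_measure ennreal_plus[symmetric] ennreal_less_iff del: ennreal_plus)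
    moreover have "measure \<mu> (U - B) = measure \<mu> U - measure \<mu> B"
      by (rule finite_measure_Diff) (use U B sets in auto)
    ultimately show ?thesis using U by (intro exI[of _ U]) auto
  qed
  obtain U where U: "open U" "B \<subseteq> U" "measure \<mu> (U - B) < e / 2" using outer[OF B] by blast
  have "- B \<in> sets borel" using B by auto
  then obtain V where V: "open V" "- B \<subseteq> V" "measure \<mu> (V - (- B)) < e / 2" using outer by blast
  have m: "U - B \<in> sets \<mu>" "V - (- B) \<in> sets \<mu>"
    unfolding sets using U V B by auto
  have "measure \<mu> (U - (- V)) \<le> measure \<mu> ((U - B) \<union> (V - (- B)))"
    by (rule finite_measure_mono) (use m in auto)
  also have "\<dots> \<le> measure \<mu> (U - B) + measure \<mu> (V - (- B))"
    by (rule measure_Un_le[OF m])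
  also have "\<dots> < e" using U(3) V(3) by linarith
  finally show ?thesis using U V by (intro exI[of _ "- V"] exI[of _ U]) (auto simp: closed_Compl)
qed

text \<open>For an indicator the approximation comes from regularity of \<open>\<mu>\<close> and Urysohn's lemma, and it passes to nonnegative
  bounded functions by the usual induction. A general \<open>f\<close> is shifted by \<open>c\<close> to become nonnegative, and the
  approximation is truncated to \<open>[-c, c]\<close>, which does not increase the distance to \<open>f\<close>.\<close>
lemma bounded_continuous_dense:
  fixes \<mu> :: "(real ^ 'n::finite) measure"
  assumes fin: "finite_measure \<mu>" and sets: "sets \<mu> = sets borel" and f: "f \<in> M_b"
    and c: "\<And>x. \<bar>f x\<bar> \<le> c" and e: "0 < e"
  shows "\<exists>g\<in>C_b 0. (\<forall>x. \<bar>g x\<bar> \<le> c) \<and> (\<integral>x. \<bar>f x - g x\<bar> \<partial>\<mu>) < e"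
proof -
  have Cb: "g \<in> C_b 0 \<Longrightarrow> h \<in> C_b 0 \<Longrightarrow> (\<lambda>x. a * g x + b * h x) \<in> C_b 0" for g h :: "real ^ 'n \<Rightarrow> real" and a b
    by (rule C_b_lincomb)
  have int: "integrable \<mu> g" if "g \<in> M_b" for g by (rule M_b_integrable[OF that fin sets])
  have absint: "integrable \<mu> (\<lambda>x. \<bar>u x - v x\<bar>)" if "u \<in> M_b" "v \<in> M_b" for u v
    using int[OF M_b_diff[OF that]] by simp
  define dense where "dense u \<longleftrightarrow> (\<forall>e>0. \<exists>g\<in>C_b 0. (\<integral>x. \<bar>u x - g x\<bar> \<partial>\<mu>) < e)" for u
  have nonneg: "(\<exists>c. \<forall>y. u y \<le> c) \<longrightarrow> dense u"
    if "u \<in> borel_measurable borel" "\<And>y. 0 \<le> u y" for u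
    using that
  proof (induction u rule: borel_measurable_induct_real)
    case (set B)
    show ?case
      unfolding dense_def
    proof (intro impI allI)
      fix e :: real assume "0 < e"
      then obtain K U where KU: "closed K" "open U" "K \<subseteq> B" "B \<subseteq> U" "measure \<mu> (U - K) < e"
        using closed_open_approximation[OF fin sets set \<open>0 < e\<close>] by metis
      have "closed (- U)" "K \<inter> - U = {}" using KU by auto
      then obtain g :: "real ^ 'n \<Rightarrow> real" where g: "continuous_on UNIV g" "\<And>x. g x \<in> closed_segment 1 0"
          "\<And>x. x \<in> K \<Longrightarrow> g x = 1" "\<And>x. x \<in> - U \<Longrightarrow> g x = 0"
        using Urysohn[OF KU(1), of "- U" 1 0] by metis
      have g01: "0 \<le> g x" "g x \<le> 1" for x using g(2)[of x] by (auto simp: closed_segment_eq_real_ivl)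
      have gC: "g \<in> C_b 0" unfolding C_b_0_iff using g(1) g01 by (auto simp: bounded_iff intro!: exI[of _ 1])
      have UK: "U - K \<in> sets borel" using KU by auto
      have "(\<integral>x. \<bar>indicator B x - g x\<bar> \<partial>\<mu>) \<le> (\<integral>x. indicator (U - K) x \<partial>\<mu>)"
      proof (rule integral_mono)
        show "integrable \<mu> (\<lambda>x. \<bar>indicator B x - g x\<bar>)"
          by (rule absint[OF M_b_indicator[OF set] C_b_imp_M_b[OF gC]])
        show "integrable \<mu> (\<lambda>x. indicator (U - K) x :: real)" by (rule int[OF M_b_indicator[OF UK]])
        show "\<bar>indicator B x - g x\<bar> \<le> indicator (U - K) x" for x
          using g01[of x] g(3,4)[of x] KU(3,4) by (auto simp: indicator_def)
      qed
      also have "\<dots> < e" using KU(5) UK sets sets_eq_imp_space_eq[OF sets] by simp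
      finally show "\<exists>g\<in>C_b 0. (\<integral>x. \<bar>indicator B x - g x\<bar> \<partial>\<mu>) < e" using gC by blast
    qed
  next
    case (mult u c)
    show ?case
      unfolding dense_def
    proof (intro impI allI)
      fix e :: real assume b: "\<exists>b. \<forall>y. c * u y \<le> b" and e: "0 < e"
      show "\<exists>g\<in>C_b 0. (\<integral>x. \<bar>c * u x - g x\<bar> \<partial>\<mu>) < e"
      proof (cases "c = 0")
        case True
        then show ?thesis using e by (intro bexI[of _ "\<lambda>x. 0"]) (auto simp: C_b_0_iff)
      next
        case False
        then have c: "0 < c" using mult.hyps by simp
        obtain b where "\<And>y. c * u y \<le> b" using b by blast
        then have "u y \<le> b / c" for y using c by (simp add: field_simps)
        then obtain g where g: "g \<in> C_b 0" "(\<integral>x. \<bar>u x - g x\<bar> \<partial>\<mu>) < e / c"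
          using mult.IH e c unfolding dense_def by (metis divide_pos_pos)
        have "(\<integral>x. \<bar>c * u x - c * g x\<bar> \<partial>\<mu>) = c * (\<integral>x. \<bar>u x - g x\<bar> \<partial>\<mu>)"
          using c by (simp add: right_diff_distrib[symmetric] abs_mult)
        also have "\<dots> < e" using g(2) c by (simp add: field_simps)
        finally show ?thesis using Cb[OF g(1) g(1), of c 0] by (intro bexI[of _ "\<lambda>x. c * g x"]) auto
      qed
    qed
  next
    case (add u v)
    show ?case
      unfolding dense_def
    proof (intro impI allI)
      fix e :: real assume b: "\<exists>b. \<forall>y. v y + u y \<le> b" and e: "0 < e"
      obtain b where b: "\<And>y. v y + u y \<le> b" using b by blast
      have bu: "u y \<le> b" "v y \<le> b" for y using b[of y] add.hyps(2)[of y] add.hyps(4)[of y] by linarith+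
      have uM: "u \<in> M_b" using add.hyps bu by (intro M_bI[of _ b]) auto
      have vM: "v \<in> M_b" using add.hyps bu by (intro M_bI[of _ b]) auto
      obtain g where g: "g \<in> C_b 0" "(\<integral>x. \<bar>u x - g x\<bar> \<partial>\<mu>) < e / 2"
        using add.IH(1) bu e unfolding dense_def by (meson half_gt_zero)
      obtain h where h: "h \<in> C_b 0" "(\<integral>x. \<bar>v x - h x\<bar> \<partial>\<mu>) < e / 2"
        using add.IH(2) bu e unfolding dense_def by (meson half_gt_zero)
      note gM = C_b_imp_M_b[OF g(1)] and hM = C_b_imp_M_b[OF h(1)]
      have "(\<integral>x. \<bar>v x + u x - (h x + g x)\<bar> \<partial>\<mu>) \<le> (\<integral>x. \<bar>v x - h x\<bar> + \<bar>u x - g x\<bar> \<partial>\<mu>)"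
      proof (rule integral_mono)
        show "integrable \<mu> (\<lambda>x. \<bar>v x + u x - (h x + g x)\<bar>)"
          by (rule absint[OF M_b_add[OF vM uM] M_b_add[OF hM gM]])
        show "integrable \<mu> (\<lambda>x. \<bar>v x - h x\<bar> + \<bar>u x - g x\<bar>)"
          using absint[OF vM hM] absint[OF uM gM] by simp
      qed linarith
      also have "\<dots> < e" using absint[OF vM hM] absint[OF uM gM] g(2) h(2) by simp
      finally show "\<exists>g\<in>C_b 0. (\<integral>x. \<bar>v x + u x - g x\<bar> \<partial>\<mu>) < e"
        by (rule bexI[OF _ C_b_add[OF h(1) g(1)]])
    qed
  next
    case (seq U)
    show ?case
      unfolding dense_def
    proof (intro impI allI)
      fix e :: real assume b: "\<exists>b. \<forall>y. u y \<le> b" and e: "0 < e"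
      obtain b where b: "\<And>y. u y \<le> b" using b by blast
      have Uu: "U i y \<le> u y" for i y
      proof (rule incseq_le)
        show "incseq (\<lambda>i. U i y)" using seq.hyps(3) by (auto simp: mono_def le_fun_def)
        show "(\<lambda>i. U i y) \<longlonglongrightarrow> u y" using seq.hyps(4)[of y] by auto
      qed
      have Ub: "U i y \<le> b" for i y using order_trans[OF Uu b] .
      have UM: "U i \<in> M_b" for i using seq.hyps Ub by (intro M_bI[of _ b]) auto
      have u0: "0 \<le> u y" for y using order_trans[OF seq.hyps(2)[of 0 y] Uu] .
      have um: "u \<in> borel_measurable borel"
        by (rule borel_measurable_LIMSEQ_real[where u = U]) (use seq.hyps in auto)
      have uM: "u \<in> M_b" using b u0 by (intro M_bI[OF um, of b]) auto
      have "(\<lambda>i. \<integral>x. \<bar>u x - U i x\<bar> \<partial>\<mu>) \<longlonglongrightarrow> (\<integral>x. 0 \<partial>\<mu>)"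
      proof (rule integral_dominated_convergence[where w = u])
        show "AE x in \<mu>. (\<lambda>i. \<bar>u x - U i x\<bar>) \<longlonglongrightarrow> 0"
        proof (intro AE_I2)
          fix x
          have "(\<lambda>i. \<bar>u x - U i x\<bar>) \<longlonglongrightarrow> \<bar>u x - u x\<bar>"
            by (intro tendsto_rabs tendsto_diff tendsto_const) (use seq.hyps(4) in auto)
          then show "(\<lambda>i. \<bar>u x - U i x\<bar>) \<longlonglongrightarrow> 0" by simp
        qed
        show "AE x in \<mu>. norm \<bar>u x - U i x\<bar> \<le> u x" for i
        proof (intro AE_I2)
          show "norm \<bar>u x - U i x\<bar> \<le> u x" for x using Uu[of i x] seq.hyps(2)[of i x] by simp
        qed
      qed (use int[OF uM] borel_measurable_integrable[OF absint[OF uM UM]] in auto)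
      then have "eventually (\<lambda>i. (\<integral>x. \<bar>u x - U i x\<bar> \<partial>\<mu>) < e / 2) sequentially"
        using e by (intro order_tendstoD(2)[where y = "\<integral>x. 0 \<partial>\<mu>"]) auto
      then obtain i where i: "(\<integral>x. \<bar>u x - U i x\<bar> \<partial>\<mu>) < e / 2" by (auto simp: eventually_sequentially)
      obtain g where g: "g \<in> C_b 0" "(\<integral>x. \<bar>U i x - g x\<bar> \<partial>\<mu>) < e / 2"
        using seq.IH[of i] Ub e unfolding dense_def by (meson half_gt_zero)
      note gM = C_b_imp_M_b[OF g(1)]
      have "(\<integral>x. \<bar>u x - g x\<bar> \<partial>\<mu>) \<le> (\<integral>x. \<bar>u x - U i x\<bar> + \<bar>U i x - g x\<bar> \<partial>\<mu>)"
      proof (rule integral_mono)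
        show "integrable \<mu> (\<lambda>x. \<bar>u x - g x\<bar>)" by (rule absint[OF uM gM])
        show "integrable \<mu> (\<lambda>x. \<bar>u x - U i x\<bar> + \<bar>U i x - g x\<bar>)"
          using absint[OF uM UM] absint[OF UM gM] by simp
      qed linarith
      also have "\<dots> < e" using absint[OF uM UM] absint[OF UM gM] i g(2) by simp
      finally show "\<exists>g\<in>C_b 0. (\<integral>x. \<bar>u x - g x\<bar> \<partial>\<mu>) < e" using g(1) by blast
    qed
  qed
  have fm: "f \<in> borel_measurable borel" by (rule M_b_measurable[OF f])
  have cb: "- c \<le> f x" "f x \<le> c" for x using c[of x] by linarith+
  have c0: "0 \<le> c" using c[of 0] by linarith
  have fc: "0 \<le> f x + c" "f x + c \<le> 2 * c" for x using cb[of x] by linarith+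
  have fcm: "(\<lambda>x. f x + c) \<in> borel_measurable borel" using fm by simp
  have "dense (\<lambda>x. f x + c)" using nonneg[OF fcm fc(1)] fc(2) by blast
  then obtain g where g: "g \<in> C_b 0" "(\<integral>x. \<bar>f x + c - g x\<bar> \<partial>\<mu>) < e" using e unfolding dense_def by blast
  define h where "h x = max (- c) (min c (g x - c))" for x
  have hc: "\<bar>h x\<bar> \<le> c" for x unfolding h_def using c0 by (auto simp: max_def min_def)
  have hC: "h \<in> C_b 0"
    unfolding C_b_0_iff h_def using g(1) hc[unfolded h_def] unfolding C_b_0_iff
    by (auto intro!: continuous_intros simp: bounded_iff)
  have cM: "(\<lambda>x. f x + c) \<in> M_b"
    by (rule M_bI[OF fcm, of "2 * c"]) (use fc in simp)
  have "(\<integral>x. \<bar>f x - h x\<bar> \<partial>\<mu>) \<le> (\<integral>x. \<bar>f x + c - g x\<bar> \<partial>\<mu>)"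
  proof (rule integral_mono)
    show "integrable \<mu> (\<lambda>x. \<bar>f x - h x\<bar>)" by (rule absint[OF f C_b_imp_M_b[OF hC]])
    show "integrable \<mu> (\<lambda>x. \<bar>f x + c - g x\<bar>)" by (rule absint[OF cM C_b_imp_M_b[OF g(1)]])
    show "\<bar>f x - h x\<bar> \<le> \<bar>f x + c - g x\<bar>" for x
      unfolding h_def using cb[of x] c0 by (auto simp: max_def min_def)
  qed
  then show ?thesis using g(2) hC hc by (intro bexI[of _ h]) auto
qed

text \<open>At a fixed point \<open>x\<close> the operator is a difference of two finite measures, and density is used in \<open>L\<^sup>1\<close> of their
  sum. The approximants respect the bound of \<open>f\<close>, so the constant is preserved.\<close>
lemma sup_norm_bound_extends:
  fixes A :: "'n::finite oper"
  assumes A: "signed_kernel A" and c: "0 \<le> c"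
    and bound: "\<And>f. f \<in> C_b 0 \<Longrightarrow> sup_norm (A f) \<le> ennreal c * sup_norm f"
    and f: "f \<in> M_b"
  shows "sup_norm (A f) \<le> ennreal c * sup_norm f"
proof -
  obtain A1 A2 where A12: "positive_kernel A1" "positive_kernel A2"
    "\<And>f. f \<in> M_b \<Longrightarrow> A f = (\<lambda>x. A1 f x - A2 f x)" using A unfolding signed_kernel_def by blast
  define F where "F = enn2real (sup_norm f)"
  have F: "sup_norm f = ennreal F" "0 \<le> F"
    unfolding F_def using sup_norm_finite[OF f] by auto
  have fF: "\<bar>f y\<bar> \<le> F" for y using sup_norm_upper[of f y] unfolding F(1) using F(2) by simp
  have "\<bar>A f x\<bar> \<le> c * F" for x
  proof (rule field_le_epsilon)
    fix e :: real assume e: "0 < e"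
    obtain \<mu> where \<mu>: "finite_measure \<mu>" "sets \<mu> = sets borel"
        "\<And>f. f \<in> M_b \<Longrightarrow> A1 f x + A2 f x = (\<integral>y. f y \<partial>\<mu>)"
      using positive_kernel_represented[OF positive_kernel_add[OF A12(1,2)], of x] by metis
    obtain g where g: "g \<in> C_b 0" "\<And>x. \<bar>g x\<bar> \<le> F" "(\<integral>x. \<bar>f x - g x\<bar> \<partial>\<mu>) < e"
      using bounded_continuous_dense[OF \<mu>(1,2) f fF e] by blast
    note gM = C_b_imp_M_b[OF g(1)]
    define d where "d y = \<bar>f y - g y\<bar>" for y
    have dM: "d \<in> M_b"
    proof (rule M_bI[of _ "2 * F"])
      show "d \<in> borel_measurable borel"
        unfolding d_def using M_b_measurable[OF M_b_diff[OF f gM]] by (rule borel_measurable_abs)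
      show "\<bar>d x\<bar> \<le> 2 * F" for x unfolding d_def using fF[of x] g(2)[of x] by linarith
    qed
    have abs_le: "\<bar>B f x - B g x\<bar> \<le> B d x" if B: "positive_kernel B" for B
    proof -
      have 1: "B (\<lambda>y. 1 * f y + (-1) * g y) x \<le> B d x"
        by (rule positive_kernel_mono[OF B M_b_lincomb[OF f gM] dM]) (simp add: d_def)
      have 2: "B (\<lambda>y. 1 * g y + (-1) * f y) x \<le> B d x"
        by (rule positive_kernel_mono[OF B M_b_lincomb[OF gM f] dM]) (simp add: d_def)
      show ?thesis
        using 1 2 unfolding positive_kernelD(2)[OF B f gM] positive_kernelD(2)[OF B gM f] by linarith
    qed
    have "\<bar>A f x - A g x\<bar> \<le> A1 d x + A2 d x"
      using abs_le[OF A12(1)] abs_le[OF A12(2)] A12(3)[OF f] A12(3)[OF gM] by simp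
    also have "\<dots> < e" using g(3) \<mu>(3)[OF dM] unfolding d_def by simp
    finally have fg: "\<bar>A f x - A g x\<bar> < e" .
    have "ennreal \<bar>A g x\<bar> \<le> sup_norm (A g)" by (rule sup_norm_upper)
    also have "\<dots> \<le> ennreal c * sup_norm g" by (rule bound[OF g(1)])
    also have "\<dots> \<le> ennreal c * ennreal F" by (intro mult_left_mono sup_norm_leI ennreal_leI g(2)) simp
    also have "\<dots> = ennreal (c * F)" using c F by (simp add: ennreal_mult)
    finally have "\<bar>A g x\<bar> \<le> c * F" using c F by simp
    then show "\<bar>A f x\<bar> \<le> c * F + e" using fg by linarith
  qed
  then have "sup_norm (A f) \<le> ennreal (c * F)" by (intro sup_norm_leI ennreal_leI)
  then show ?thesis using c F by (simp add: ennreal_mult)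
qed

section \<open>Discrete semigroups and grids\<close>
lemma gridI: "real k * \<delta> \<in> grid \<delta>" unfolding grid_def by blast

lemma grid_le_obtain:
  assumes "0 < \<delta>" "s \<in> grid \<delta>" "t \<in> grid \<delta>" "s \<le> t"
  shows "\<exists>k. t = s + real k * \<delta>"
proof -
  obtain i j where ij: "s = real i * \<delta>" "t = real j * \<delta>" using assms unfolding grid_def by auto
  then have "i \<le> j" using assms by simp
  then have "t = s + real (j - i) * \<delta>" unfolding ij by (simp add: of_nat_diff algebra_simps)
  then show ?thesis ..
qed

lemma grid_add: "s \<in> grid \<delta> \<Longrightarrow> s + real k * \<delta> \<in> grid \<delta>"
  unfolding grid_def by (auto simp: distrib_right[symmetric] of_nat_add[symmetric] simp del: of_nat_add)

text \<open>The transition measures enter only through this lemma; afterwards a discrete semigroup is a family of products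
  of positive kernels.\<close>
lemma discrete_semigroup_one_step:
  assumes "discrete_semigroup \<delta> (Q :: real \<Rightarrow> real \<Rightarrow> 'n::finite oper)"
  shows "\<exists>U. (\<forall>t\<in>grid \<delta>. positive_kernel (U t)) \<and> (\<forall>t\<in>grid \<delta>. \<forall>f\<in>M_b. \<forall>r::nat.
      Q t (t + real (Suc r) * \<delta>) f = Q t (t + real r * \<delta>) (U (t + real r * \<delta>) f))"
proof -
  obtain \<mu> where \<mu>: "transition_measures \<delta> \<mu>" and Q: "\<forall>t\<in>grid \<delta>. \<forall>f\<in>M_b. Q t t f = f \<and>
         (\<forall>r::nat. Q t (t + (real r + 1) * \<delta>) f
            = Q t (t + real r * \<delta>) (\<lambda>x. \<integral>y. f y \<partial>\<mu> (t + real r * \<delta>) x))"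
    using assms unfolding discrete_semigroup_def by blast
  show ?thesis
  proof (rule exI[of _ "\<lambda>t f x. \<integral>y. f y \<partial>\<mu> t x"], intro conjI ballI allI)
    fix t assume t: "t \<in> grid \<delta>"
    define S where "S = (SUP t\<in>grid \<delta>. SUP x. emeasure (\<mu> t x) UNIV)"
    have S: "S < \<infinity>" using \<mu> unfolding transition_measures_def S_def by blast
    show "positive_kernel (\<lambda>f x. \<integral>y. f y \<partial>\<mu> t x)"
    proof (rule positive_kernel_transition[where m = "enn2real S"])
      show "finite_measure (\<mu> t x)" "sets (\<mu> t x) = sets borel" for x
        using \<mu> t unfolding transition_measures_def by blast+
      show "(\<lambda>x. emeasure (\<mu> t x) B) \<in> borel_measurable borel" if "B \<in> sets borel" for B
        using \<mu> t that unfolding transition_measures_def by blast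
      fix x
      have "emeasure (\<mu> t x) UNIV \<le> (SUP x. emeasure (\<mu> t x) UNIV)" by (rule SUP_upper) simp
      also have "\<dots> \<le> S" unfolding S_def by (rule SUP_upper[OF t])
      also have "S = ennreal (enn2real S)" using S by simp
      finally show "emeasure (\<mu> t x) UNIV \<le> ennreal (enn2real S)" .
    qed
  next
    fix t r and f :: "real ^ 'n \<Rightarrow> real"
    assume "t \<in> grid \<delta>" "f \<in> M_b"
    then have "Q t (t + (real r + 1) * \<delta>) f = Q t (t + real r * \<delta>) (\<lambda>x. \<integral>y. f y \<partial>\<mu> (t + real r * \<delta>) x)"
      using Q by blast
    then show "Q t (t + real (Suc r) * \<delta>) f = Q t (t + real r * \<delta>) (\<lambda>x. \<integral>y. f y \<partial>\<mu> (t + real r * \<delta>) x)"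
      by (simp add: add.commute)
  qed
qed

context
  fixes \<delta> :: real and Q :: "real \<Rightarrow> real \<Rightarrow> 'n::finite oper"
  assumes Q: "discrete_semigroup \<delta> Q" and \<delta>: "0 < \<delta>"
begin

lemma semigroup_refl: "t \<in> grid \<delta> \<Longrightarrow> f \<in> M_b \<Longrightarrow> Q t t f = f"
  using Q unfolding discrete_semigroup_def by blast

lemma semigroup_kernel:
  assumes "s \<in> grid \<delta>" "t \<in> grid \<delta>" "s \<le> t"
  shows "signed_kernel (Q s t)"
proof -
  obtain k where k: "t = s + real k * \<delta>" using grid_le_obtain[OF \<delta> assms] by blast
  obtain U where U: "\<And>t. t \<in> grid \<delta> \<Longrightarrow> positive_kernel (U t)"
    "\<And>t f r. t \<in> grid \<delta> \<Longrightarrow> f \<in> M_b \<Longrightarrow>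
      Q t (t + real (Suc r) * \<delta>) f = Q t (t + real r * \<delta>) (U (t + real r * \<delta>) f)"
    using discrete_semigroup_one_step[OF Q] by blast
  have "signed_kernel (Q s (s + real k * \<delta>))"
  proof (induction k)
    case 0
    show ?case
      by (rule signed_kernel_cong[OF positive_imp_signed_kernel[OF positive_kernel_id]])
         (use semigroup_refl[OF assms(1)] in simp)
  next
    case (Suc k)
    show ?case
      by (rule signed_kernel_cong[OF signed_kernel_comp[OF Suc positive_imp_signed_kernel[OF U(1)[OF grid_add[OF assms(1)]]]]])
         (rule U(2)[OF assms(1)])
  qed
  then show ?thesis unfolding k .
qed

lemma semigroup_comp:
  assumes s: "s \<in> grid \<delta>" and t: "t \<in> grid \<delta>" and u: "u \<in> grid \<delta>" and le: "s \<le> t" "t \<le> u" and f: "f \<in> M_b"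
  shows "Q s t (Q t u f) = Q s u f"
proof -
  obtain i where i: "t = s + real i * \<delta>" using grid_le_obtain[OF \<delta> s t le(1)] by blast
  obtain k where k: "u = t + real k * \<delta>" using grid_le_obtain[OF \<delta> t u le(2)] by blast
  obtain U where U: "\<And>t. t \<in> grid \<delta> \<Longrightarrow> positive_kernel (U t)"
    "\<And>t f r. t \<in> grid \<delta> \<Longrightarrow> f \<in> M_b \<Longrightarrow>
      Q t (t + real (Suc r) * \<delta>) f = Q t (t + real r * \<delta>) (U (t + real r * \<delta>) f)"
    using discrete_semigroup_one_step[OF Q] by blast
  have "Q s t (Q t (t + real k * \<delta>) f) = Q s (s + real (i + k) * \<delta>) f"
    using f
  proof (induction k arbitrary: f)
    case 0
    then show ?case using semigroup_refl[OF t] by (simp add: i)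
  next
    case (Suc k)
    have eq: "s + real (i + k) * \<delta> = t + real k * \<delta>" by (simp add: i algebra_simps)
    have Uf: "U (t + real k * \<delta>) f \<in> M_b"
      by (rule positive_kernelD(1)[OF U(1)[OF grid_add[OF t]] Suc.prems])
    have "Q s t (Q t (t + real (Suc k) * \<delta>) f) = Q s (s + real (i + k) * \<delta>) (U (t + real k * \<delta>) f)"
      unfolding U(2)[OF t Suc.prems] by (rule Suc.IH[OF Uf])
    also have "\<dots> = Q s (s + real (Suc (i + k)) * \<delta>) f"
      unfolding U(2)[OF s Suc.prems] eq ..
    finally show ?case by simp
  qed
  moreover have "s + real (i + k) * \<delta> = u" unfolding k i by (simp add: algebra_simps)
  ultimately show ?thesis unfolding k[symmetric] by simp
qed

end

section \<open>Iterated Duhamel expansion\<close>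
definition grid_after :: "real \<Rightarrow> real \<Rightarrow> real \<Rightarrow> real set" where
  "grid_after \<delta> s u = {t \<in> grid \<delta>. s < t \<and> t \<le> u}"

lemma grid_after_eq:
  assumes "0 < \<delta>" "s \<in> grid \<delta>"
  shows "grid_after \<delta> s (s + real N * \<delta>) = (\<lambda>j. s + real (Suc j) * \<delta>) ` {..<N}"
proof (intro equalityI subsetI)
  fix t assume "t \<in> grid_after \<delta> s (s + real N * \<delta>)"
  then have t: "t \<in> grid \<delta>" "s < t" "t \<le> s + real N * \<delta>" unfolding grid_after_def by auto
  obtain k where k: "t = s + real k * \<delta>" using grid_le_obtain[OF assms t(1)] t(2) by force
  have "k \<noteq> 0" using t(2) k by (intro notI) simp
  then obtain j where j: "k = Suc j" using not0_implies_Suc by blast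
  have "real k * \<delta> \<le> real N * \<delta>" using t(3) k by simp
  then have "j < N" using assms(1) j by simp
  then show "t \<in> (\<lambda>j. s + real (Suc j) * \<delta>) ` {..<N}" using k j by blast
next
  fix t assume "t \<in> (\<lambda>j. s + real (Suc j) * \<delta>) ` {..<N}"
  then obtain j where j: "j < N" "t = s + real (Suc j) * \<delta>" by auto
  have "real (Suc j) * \<delta> \<le> real N * \<delta>" using j(1) assms(1) by (intro mult_right_mono) auto
  moreover have "0 < real (Suc j) * \<delta>" using assms(1) by simp
  ultimately show "t \<in> grid_after \<delta> s (s + real N * \<delta>)"
    unfolding grid_after_def using j(2) grid_add[OF assms(2), of "Suc j"] by auto
qed

lemma inj_grid_enumeration: "0 < \<delta> \<Longrightarrow> inj_on (\<lambda>j. s + real (Suc j) * \<delta>) A"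
  by (auto simp: inj_on_def)

lemma grid_after_card:
  assumes "0 < \<delta>" "s \<in> grid \<delta>"
  shows "finite (grid_after \<delta> s (s + real N * \<delta>))" "card (grid_after \<delta> s (s + real N * \<delta>)) = N"
  unfolding grid_after_eq[OF assms] using inj_grid_enumeration[OF assms(1)] by (auto simp: card_image)

lemma grid_after_finite:
  assumes "0 < \<delta>" "s \<in> grid \<delta>" "u \<in> grid \<delta>" "s \<le> u"
  shows "finite (grid_after \<delta> s u)"
  using grid_le_obtain[OF assms] grid_after_card(1)[OF assms(1,2)] by metis

lemma grid_after_step:
  assumes "0 < \<delta>" "s \<in> grid \<delta>" "t \<in> grid_after \<delta> s u"
  shows "t \<in> grid \<delta>" "t - \<delta> \<in> grid \<delta>" "s \<le> t - \<delta>" "t \<le> u" "s < t"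
proof -
  have t: "t \<in> grid \<delta>" "s < t" "t \<le> u" using assms(3) unfolding grid_after_def by auto
  obtain k where k: "t = s + real k * \<delta>" using grid_le_obtain[OF assms(1,2) t(1)] t(2) by force
  have "k \<noteq> 0" using t(2) k by (intro notI) simp
  then obtain j where j: "k = Suc j" using not0_implies_Suc by blast
  have tj: "t - \<delta> = s + real j * \<delta>" unfolding k j by (simp add: algebra_simps)
  show "t - \<delta> \<in> grid \<delta>" unfolding tj by (rule grid_add[OF assms(2)])
  show "s \<le> t - \<delta>" unfolding tj using assms(1) by simp
qed (use assms(3) in \<open>auto simp: grid_after_def\<close>)

lemma time_lists_0: "time_lists \<delta> s u 0 = {[]}"
  unfolding time_lists_def by auto

lemma time_lists_Suc:
  "time_lists \<delta> s u (Suc i) = (\<Union>t\<in>grid_after \<delta> s u. (#) t ` time_lists \<delta> t u i)"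
proof (intro equalityI subsetI)
  fix ts assume "ts \<in> time_lists \<delta> s u (Suc i)"
  then have ts: "length ts = Suc i" "sorted_wrt (<) (s # ts)" "\<forall>r\<in>set ts. r \<in> grid \<delta> \<and> r \<le> u"
    unfolding time_lists_def by auto
  then obtain t ts' where tt: "ts = t # ts'" by (cases ts) auto
  have "t \<in> grid_after \<delta> s u" "ts' \<in> time_lists \<delta> t u i"
    using ts unfolding tt time_lists_def grid_after_def by auto
  then show "ts \<in> (\<Union>t\<in>grid_after \<delta> s u. (#) t ` time_lists \<delta> t u i)" unfolding tt by blast
next
  fix ts assume "ts \<in> (\<Union>t\<in>grid_after \<delta> s u. (#) t ` time_lists \<delta> t u i)"
  then obtain t ts' where "t \<in> grid_after \<delta> s u" "ts' \<in> time_lists \<delta> t u i" "ts = t # ts'" by auto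
  then show "ts \<in> time_lists \<delta> s u (Suc i)"
    unfolding time_lists_def grid_after_def by (auto intro: less_trans)
qed

context
  fixes \<delta> u :: real
  assumes \<delta>: "0 < \<delta>" and u: "u \<in> grid \<delta>"
begin

lemma time_lists_finite: "s \<in> grid \<delta> \<Longrightarrow> s \<le> u \<Longrightarrow> finite (time_lists \<delta> s u i)"
proof (induction i arbitrary: s)
  case (Suc i)
  show ?case
    unfolding time_lists_Suc
    by (intro finite_UN_I finite_imageI grid_after_finite[OF \<delta> Suc.prems(1) u Suc.prems(2)] Suc.IH
        grid_after_step(1,4)[OF \<delta> Suc.prems(1)])
qed (simp add: time_lists_0)

lemma sum_time_lists_Suc:
  fixes F :: "real list \<Rightarrow> real"
  assumes "s \<in> grid \<delta>" "s \<le> u"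
  shows "(\<Sum>ts\<in>time_lists \<delta> s u (Suc i). F ts)
    = (\<Sum>t\<in>grid_after \<delta> s u. \<Sum>ts\<in>time_lists \<delta> t u i. F (t # ts))"
proof -
  have "(\<Sum>ts\<in>time_lists \<delta> s u (Suc i). F ts) = (\<Sum>t\<in>grid_after \<delta> s u. \<Sum>ts\<in>(#) t ` time_lists \<delta> t u i. F ts)"
    unfolding time_lists_Suc
  proof (rule sum.UNION_disjoint)
    show "finite (grid_after \<delta> s u)" by (rule grid_after_finite[OF \<delta> assms(1) u assms(2)])
    show "\<forall>t\<in>grid_after \<delta> s u. finite ((#) t ` time_lists \<delta> t u i)"
      using grid_after_step(1,4)[OF \<delta> assms(1)] time_lists_finite by blast
  qed auto
  also have "\<dots> = (\<Sum>t\<in>grid_after \<delta> s u. \<Sum>ts\<in>time_lists \<delta> t u i. F (t # ts))"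
    by (intro sum.cong refl sum.reindex_cong[where l = "(#) _"]) (auto simp: inj_on_def)
  finally show ?thesis .
qed

lemma time_lists_card:
  assumes "s \<in> grid \<delta>" "u = s + real N * \<delta>"
  shows "real (card (time_lists \<delta> s u i)) \<le> real N ^ i"
  using assms
proof (induction i arbitrary: s N)
  case 0
  then show ?case by (simp add: time_lists_0)
next
  case (Suc i)
  have su: "s \<le> u" using Suc.prems \<delta> by simp
  have "real (card (time_lists \<delta> s u (Suc i))) = (\<Sum>ts\<in>time_lists \<delta> s u (Suc i). 1)" by simp
  also have "\<dots> = (\<Sum>t\<in>grid_after \<delta> s u. real (card (time_lists \<delta> t u i)))"
    unfolding sum_time_lists_Suc[OF Suc.prems(1) su] by simp
  also have "\<dots> \<le> (\<Sum>t\<in>grid_after \<delta> s u. real N ^ i)"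
  proof (rule sum_mono)
    fix t assume t: "t \<in> grid_after \<delta> s u"
    note tg = grid_after_step[OF \<delta> Suc.prems(1) t]
    obtain K where K: "u = t + real K * \<delta>" using grid_le_obtain[OF \<delta> tg(1) u tg(4)] by blast
    have "real K * \<delta> \<le> real N * \<delta>" using K Suc.prems(2) tg(5) by simp
    then have "real K \<le> real N" using \<delta> by simp
    then have "real K ^ i \<le> real N ^ i" by (intro power_mono) auto
    then show "real (card (time_lists \<delta> t u i)) \<le> real N ^ i" by (rule order_trans[OF Suc.IH[OF tg(1) K]])
  qed
  also have "\<dots> = real N ^ Suc i"
    using grid_after_card(2)[OF \<delta> Suc.prems(1), of N] Suc.prems(2) by simp
  finally show ?case .
qed

end

text \<open>The products \<open>chain\<close> with an arbitrary operator \<open>D t\<close> over the step that ends at \<open>t\<close>, and an arbitrary last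
  factor \<open>Z\<close>, so that the products for \<open>P - Q\<close>, those of the scheme and the remainder are instances.\<close>
fun operator_chain :: "real \<Rightarrow> (real \<Rightarrow> real \<Rightarrow> 'n::finite oper) \<Rightarrow> (real \<Rightarrow> 'n oper) \<Rightarrow> (real \<Rightarrow> 'n oper) \<Rightarrow>
    real \<Rightarrow> real list \<Rightarrow> 'n oper" where
  "operator_chain \<delta> Q D Z s [] f = Z s f"
| "operator_chain \<delta> Q D Z s (t # ts) f = Q s (t - \<delta>) (D t (operator_chain \<delta> Q D Z t ts f))"

lemma chain_eq_operator_chain:
  "chain \<delta> Q R u s ts f
    = operator_chain \<delta> Q (\<lambda>t f x. R (t - \<delta>) f x - Q (t - \<delta>) t f x) (\<lambda>s. Q s u) s ts f"
  by (induction ts arbitrary: s) auto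

text \<open>The sum telescopes: its term at \<open>t\<close> is the difference of \<open>Q s r (P r u f)\<close> at \<open>r = t - \<delta>\<close> and \<open>r = t\<close>.\<close>
lemma duhamel_expansion:
  fixes P Q :: "real \<Rightarrow> real \<Rightarrow> 'n::finite oper"
  assumes \<delta>: "0 < \<delta>" and P: "discrete_semigroup \<delta> P" and Q: "discrete_semigroup \<delta> Q"
    and s: "s \<in> grid \<delta>" and u: "u \<in> grid \<delta>" and su: "s \<le> u" and f: "f \<in> M_b"
  shows "P s u f x = Q s u f x + (\<Sum>t\<in>grid_after \<delta> s u.
    Q s (t - \<delta>) (\<lambda>y. P (t - \<delta>) t (P t u f) y - Q (t - \<delta>) t (P t u f) y) x)"
proof -
  obtain N where N: "u = s + real N * \<delta>" using grid_le_obtain[OF \<delta> s u su] by blast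
  define g where "g j = Q s (s + real j * \<delta>) (P (s + real j * \<delta>) u f) x" for j
  let ?F = "\<lambda>t. Q s (t - \<delta>) (\<lambda>y. P (t - \<delta>) t (P t u f) y - Q (t - \<delta>) t (P t u f) y) x"
  have F: "?F (s + real (Suc j) * \<delta>) = g j - g (Suc j)" if j: "j < N" for j
  proof -
    define a where "a = s + real j * \<delta>"
    define b where "b = s + real (Suc j) * \<delta>"
    have ab: "b - \<delta> = a" unfolding a_def b_def by (simp add: algebra_simps)
    have ag: "a \<in> grid \<delta>" and bg: "b \<in> grid \<delta>" unfolding a_def b_def by (rule grid_add[OF s])+
    have "real (Suc j) * \<delta> \<le> real N * \<delta>" using j \<delta> by (intro mult_right_mono) auto
    then have bu: "b \<le> u" unfolding b_def N by simp
    have ab': "a \<le> b" using ab \<delta> by linarith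
    have sa: "s \<le> a" unfolding a_def using \<delta> by simp
    note le = sa ab' bu order_trans[OF sa ab'] order_trans[OF ab' bu]
    have M: "P b u f \<in> M_b" by (rule signed_kernel_M_b[OF semigroup_kernel[OF P \<delta> bg u le(3)] f])
    have Pc: "P a b (P b u f) = P a u f" by (rule semigroup_comp[OF P \<delta> ag bg u le(2,3) f])
    have "Q s a (\<lambda>y. P a b (P b u f) y - Q a b (P b u f) y)
        = (\<lambda>y. Q s a (P a b (P b u f)) y - Q s a (Q a b (P b u f)) y)"
      by (rule signed_kernel_diff[OF semigroup_kernel[OF Q \<delta> s ag le(1)]
            signed_kernel_M_b[OF semigroup_kernel[OF P \<delta> ag bg le(2)] M]
            signed_kernel_M_b[OF semigroup_kernel[OF Q \<delta> ag bg le(2)] M]])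
    also have "\<dots> = (\<lambda>y. Q s a (P a u f) y - Q s b (P b u f) y)"
      unfolding Pc semigroup_comp[OF Q \<delta> s ag bg le(1,2) M] ..
    finally show ?thesis unfolding b_def[symmetric] ab g_def a_def[symmetric] by simp
  qed
  have "(\<Sum>t\<in>grid_after \<delta> s u. ?F t) = (\<Sum>j<N. ?F (s + real (Suc j) * \<delta>))"
    unfolding N grid_after_eq[OF \<delta> s] using inj_grid_enumeration[OF \<delta>] by (subst sum.reindex) auto
  also have "\<dots> = (\<Sum>j<N. g j - g (Suc j))" using F by simp
  also have "\<dots> = g 0 - g N" by (rule sum_lessThan_telescope')
  also have "g 0 = P s u f x"
    unfolding g_def using semigroup_refl[OF Q \<delta> s signed_kernel_M_b[OF semigroup_kernel[OF P \<delta> s u su] f]] by simp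
  also have "g N = Q s u f x"
    unfolding g_def N[symmetric] semigroup_refl[OF P \<delta> u f] ..
  finally show ?thesis by simp
qed

definition admissible :: "real \<Rightarrow> real \<Rightarrow> real \<Rightarrow> real list \<Rightarrow> bool" where
  "admissible \<delta> s u ts \<longleftrightarrow> sorted_wrt (<) (s # ts) \<and> (\<forall>t\<in>set ts. t \<in> grid \<delta> \<and> t \<le> u)"

lemma admissible_Cons: "admissible \<delta> s u (t # ts) \<Longrightarrow> t \<in> grid_after \<delta> s u \<and> admissible \<delta> t u ts"
  unfolding admissible_def grid_after_def by auto

lemma time_lists_admissible: "ts \<in> time_lists \<delta> s u i \<Longrightarrow> length ts = i \<and> admissible \<delta> s u ts"
  unfolding time_lists_def admissible_def by auto

lemma operator_chain_kernel:
  fixes Q :: "real \<Rightarrow> real \<Rightarrow> 'n::finite oper"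
  assumes \<delta>: "0 < \<delta>"
    and Q: "\<And>s t. s \<in> grid \<delta> \<Longrightarrow> t \<in> grid \<delta> \<Longrightarrow> s \<le> t \<Longrightarrow> signed_kernel (Q s t)"
    and D: "\<And>t. t \<in> grid \<delta> \<Longrightarrow> t - \<delta> \<in> grid \<delta> \<Longrightarrow> t \<le> u \<Longrightarrow> signed_kernel (D t)"
    and Z: "\<And>s. s \<in> grid \<delta> \<Longrightarrow> s \<le> u \<Longrightarrow> signed_kernel (Z s)"
  shows "s \<in> grid \<delta> \<Longrightarrow> s \<le> u \<Longrightarrow> admissible \<delta> s u ts \<Longrightarrow> signed_kernel (operator_chain \<delta> Q D Z s ts)"
proof (induction ts arbitrary: s)
  case Nil
  have "operator_chain \<delta> Q D Z s [] = Z s" by (simp add: fun_eq_iff)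
  then show ?case using Z[OF Nil.prems(1,2)] by simp
next
  case (Cons t ts)
  have ta: "t \<in> grid_after \<delta> s u" "admissible \<delta> t u ts" using admissible_Cons[OF Cons.prems(3)] by auto
  note tg = grid_after_step[OF \<delta> Cons.prems(1) ta(1)]
  have "operator_chain \<delta> Q D Z s (t # ts) = (\<lambda>f. Q s (t - \<delta>) (D t (operator_chain \<delta> Q D Z t ts f)))"
    by (simp add: fun_eq_iff)
  then show ?case
    using signed_kernel_comp[OF Q[OF Cons.prems(1) tg(2,3)]
        signed_kernel_comp[OF D[OF tg(1,2,4)] Cons.IH[OF tg(1,4) ta(2)]]] by simp
qed

definition expansion_term :: "real \<Rightarrow> (real \<Rightarrow> real \<Rightarrow> 'n::finite oper) \<Rightarrow> (real \<Rightarrow> 'n oper) \<Rightarrow>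
    (real \<Rightarrow> 'n oper) \<Rightarrow> real \<Rightarrow> nat \<Rightarrow> real \<Rightarrow> 'n oper" where
  "expansion_term \<delta> Q D Z u i s f x = (\<Sum>ts\<in>time_lists \<delta> s u i. operator_chain \<delta> Q D Z s ts f x)"

lemma expansion_term_Suc:
  fixes Q :: "real \<Rightarrow> real \<Rightarrow> 'n::finite oper"
  assumes \<delta>: "0 < \<delta>" and u: "u \<in> grid \<delta>"
    and Q: "\<And>s t. s \<in> grid \<delta> \<Longrightarrow> t \<in> grid \<delta> \<Longrightarrow> s \<le> t \<Longrightarrow> signed_kernel (Q s t)"
    and D: "\<And>t. t \<in> grid \<delta> \<Longrightarrow> t - \<delta> \<in> grid \<delta> \<Longrightarrow> t \<le> u \<Longrightarrow> signed_kernel (D t)"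
    and Z: "\<And>s. s \<in> grid \<delta> \<Longrightarrow> s \<le> u \<Longrightarrow> signed_kernel (Z s)"
    and s: "s \<in> grid \<delta>" and su: "s \<le> u" and f: "f \<in> M_b"
  shows "expansion_term \<delta> Q D Z u (Suc i) s f x
    = (\<Sum>t\<in>grid_after \<delta> s u. Q s (t - \<delta>) (D t (expansion_term \<delta> Q D Z u i t f)) x)"
  unfolding expansion_term_def sum_time_lists_Suc[OF \<delta> u s su] operator_chain.simps
proof (rule sum.cong[OF refl])
  fix t assume t: "t \<in> grid_after \<delta> s u"
  note tg = grid_after_step[OF \<delta> s t]
  have k: "signed_kernel (\<lambda>g. Q s (t - \<delta>) (D t g))"
    by (rule signed_kernel_comp[OF Q[OF s tg(2,3)] D[OF tg(1,2,4)]])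
  have "operator_chain \<delta> Q D Z t ts f \<in> M_b" if "ts \<in> time_lists \<delta> t u i" for ts
    by (rule signed_kernel_M_b[OF operator_chain_kernel[OF \<delta> Q D Z tg(1,4)] f])
       (use time_lists_admissible[OF that] in auto)
  then have "Q s (t - \<delta>) (D t (\<lambda>y. \<Sum>ts\<in>time_lists \<delta> t u i. operator_chain \<delta> Q D Z t ts f y))
      = (\<lambda>y. \<Sum>ts\<in>time_lists \<delta> t u i. Q s (t - \<delta>) (D t (operator_chain \<delta> Q D Z t ts f)) y)"
    by (rule signed_kernel_sum[OF k])
  moreover have "(\<lambda>y. \<Sum>ts\<in>time_lists \<delta> t u i. operator_chain \<delta> Q D Z t ts f y) = expansion_term \<delta> Q D Z u i t f"
    by (simp add: fun_eq_iff expansion_term_def)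
  ultimately show "(\<Sum>ts\<in>time_lists \<delta> t u i. Q s (t - \<delta>) (D t (operator_chain \<delta> Q D Z t ts f)) x)
      = Q s (t - \<delta>) (D t (\<lambda>x. \<Sum>ts\<in>time_lists \<delta> t u i. operator_chain \<delta> Q D Z t ts f x)) x"
    by simp
qed

lemma expansion_term_M_b:
  fixes Q :: "real \<Rightarrow> real \<Rightarrow> 'n::finite oper"
  assumes \<delta>: "0 < \<delta>"
    and Q: "\<And>s t. s \<in> grid \<delta> \<Longrightarrow> t \<in> grid \<delta> \<Longrightarrow> s \<le> t \<Longrightarrow> signed_kernel (Q s t)"
    and D: "\<And>t. t \<in> grid \<delta> \<Longrightarrow> t - \<delta> \<in> grid \<delta> \<Longrightarrow> t \<le> u \<Longrightarrow> signed_kernel (D t)"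
    and Z: "\<And>s. s \<in> grid \<delta> \<Longrightarrow> s \<le> u \<Longrightarrow> signed_kernel (Z s)"
    and s: "s \<in> grid \<delta>" and su: "s \<le> u" and f: "f \<in> M_b"
  shows "expansion_term \<delta> Q D Z u i s f \<in> M_b"
proof -
  have "(\<lambda>x. \<Sum>ts\<in>time_lists \<delta> s u i. operator_chain \<delta> Q D Z s ts f x) \<in> M_b"
    by (intro M_b_sum signed_kernel_M_b[OF operator_chain_kernel[OF \<delta> Q D Z s su] f])
       (use time_lists_admissible in auto)
  moreover have "expansion_term \<delta> Q D Z u i s f = (\<lambda>x. \<Sum>ts\<in>time_lists \<delta> s u i. operator_chain \<delta> Q D Z s ts f x)"
    by (simp add: fun_eq_iff expansion_term_def)
  ultimately show ?thesis by simp
qed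

context
  fixes P Q :: "real \<Rightarrow> real \<Rightarrow> 'n::finite oper" and \<delta> u :: real and D :: "real \<Rightarrow> 'n oper"
  assumes \<delta>: "0 < \<delta>" and P: "discrete_semigroup \<delta> P" and Q: "discrete_semigroup \<delta> Q" and u: "u \<in> grid \<delta>"
  defines "D \<equiv> \<lambda>t f x. P (t - \<delta>) t f x - Q (t - \<delta>) t f x"
begin

lemma step_error_kernel: "t \<in> grid \<delta> \<Longrightarrow> t - \<delta> \<in> grid \<delta> \<Longrightarrow> signed_kernel (D t)"
  unfolding D_def using \<delta>
  by (intro signed_kernel_op_diff semigroup_kernel[OF P \<delta>] semigroup_kernel[OF Q \<delta>]) auto

text \<open>Duhamel's formula applied to the last factor \<open>P\<close> of every product of index \<open>i\<close>.\<close>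
lemma expansion_remainder:
  assumes f: "f \<in> M_b"
  shows "s \<in> grid \<delta> \<Longrightarrow> s \<le> u \<Longrightarrow>
    expansion_term \<delta> Q D (\<lambda>s. P s u) u i s f x
      = expansion_term \<delta> Q D (\<lambda>s. Q s u) u i s f x + expansion_term \<delta> Q D (\<lambda>s. P s u) u (Suc i) s f x"
proof (induction i arbitrary: s x)
  case 0
  have eq: "expansion_term \<delta> Q D (\<lambda>s. P s u) u 0 t f = P t u f" for t
    by (simp add: expansion_term_def time_lists_0 fun_eq_iff)
  have eqQ: "expansion_term \<delta> Q D (\<lambda>s. Q s u) u 0 s f x = Q s u f x"
    by (simp add: expansion_term_def time_lists_0)
  have "expansion_term \<delta> Q D (\<lambda>s. P s u) u (Suc 0) s f x
      = (\<Sum>t\<in>grid_after \<delta> s u. Q s (t - \<delta>) (D t (expansion_term \<delta> Q D (\<lambda>s. P s u) u 0 t f)) x)"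
    by (rule expansion_term_Suc[OF \<delta> u semigroup_kernel[OF Q \<delta>] step_error_kernel semigroup_kernel[OF P \<delta> _ u] 0 f])
  also have "\<dots> = P s u f x - Q s u f x"
    unfolding eq unfolding D_def using duhamel_expansion[OF \<delta> P Q 0(1) u 0(2) f, of x] by simp
  finally show ?case unfolding eq eqQ by simp
next
  case (Suc i)
  note QK = semigroup_kernel[OF Q \<delta>] and ZP = semigroup_kernel[OF P \<delta> _ u] and ZQ = semigroup_kernel[OF Q \<delta> _ u]
  have sP: "expansion_term \<delta> Q D (\<lambda>s. P s u) u (Suc i) s f x
      = (\<Sum>t\<in>grid_after \<delta> s u. Q s (t - \<delta>) (D t (expansion_term \<delta> Q D (\<lambda>s. P s u) u i t f)) x)" for i
    by (rule expansion_term_Suc[OF \<delta> u QK step_error_kernel ZP Suc.prems f])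
  have sQ: "expansion_term \<delta> Q D (\<lambda>s. Q s u) u (Suc i) s f x
      = (\<Sum>t\<in>grid_after \<delta> s u. Q s (t - \<delta>) (D t (expansion_term \<delta> Q D (\<lambda>s. Q s u) u i t f)) x)" for i
    by (rule expansion_term_Suc[OF \<delta> u QK step_error_kernel ZQ Suc.prems f])
  have "Q s (t - \<delta>) (D t (expansion_term \<delta> Q D (\<lambda>s. P s u) u i t f)) x
      = Q s (t - \<delta>) (D t (expansion_term \<delta> Q D (\<lambda>s. Q s u) u i t f)) x
        + Q s (t - \<delta>) (D t (expansion_term \<delta> Q D (\<lambda>s. P s u) u (Suc i) t f)) x"
    if t: "t \<in> grid_after \<delta> s u" for t
  proof -
    note tg = grid_after_step[OF \<delta> Suc.prems(1) t]
    have k: "signed_kernel (\<lambda>g. Q s (t - \<delta>) (D t g))"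
      by (rule signed_kernel_comp[OF QK[OF Suc.prems(1) tg(2,3)] step_error_kernel[OF tg(1,2)]])
    have "expansion_term \<delta> Q D (\<lambda>s. P s u) u i t f
        = (\<lambda>y. expansion_term \<delta> Q D (\<lambda>s. Q s u) u i t f y + expansion_term \<delta> Q D (\<lambda>s. P s u) u (Suc i) t f y)"
      using Suc.IH[OF tg(1,4)] by (simp add: fun_eq_iff)
    moreover have "expansion_term \<delta> Q D (\<lambda>s. Q s u) u i t f \<in> M_b"
      by (rule expansion_term_M_b[OF \<delta> QK step_error_kernel ZQ tg(1,4) f])
    moreover have "expansion_term \<delta> Q D (\<lambda>s. P s u) u (Suc i) t f \<in> M_b"
      by (rule expansion_term_M_b[OF \<delta> QK step_error_kernel ZP tg(1,4) f])
    ultimately show ?thesis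
      using signed_kernel_add[OF k, of "expansion_term \<delta> Q D (\<lambda>s. Q s u) u i t f"
          "expansion_term \<delta> Q D (\<lambda>s. P s u) u (Suc i) t f"] by simp
  qed
  then show ?case unfolding sP sQ by (simp add: sum.distrib)
qed

lemma expansion:
  assumes f: "f \<in> M_b" and s: "s \<in> grid \<delta>" "s \<le> u"
  shows "P s u f x = (\<Sum>i<m. expansion_term \<delta> Q D (\<lambda>s. Q s u) u i s f x)
    + expansion_term \<delta> Q D (\<lambda>s. P s u) u m s f x"
proof (induction m)
  case 0
  show ?case by (simp add: expansion_term_def time_lists_0)
next
  case (Suc m)
  then show ?case using expansion_remainder[OF f s, of m x] by simp
qed

end

text \<open>One of the factors \<open>Q s (t - \<delta>)\<close>, or the last factor, acts over a time of at least \<open>\<tau>\<close>.\<close>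
fun long_gap :: "real \<Rightarrow> real \<Rightarrow> real \<Rightarrow> real \<Rightarrow> real list \<Rightarrow> bool" where
  "long_gap \<tau> \<delta> u s [] \<longleftrightarrow> \<tau> \<le> u - s"
| "long_gap \<tau> \<delta> u s (t # ts) \<longleftrightarrow> \<tau> \<le> t - \<delta> - s \<or> long_gap \<tau> \<delta> u t ts"

text \<open>The steps of length \<open>\<delta>\<close>, one for each time, and the gaps, one more than the times, fill the interval; the gaps cannot
  all be shorter than \<open>\<tau>\<close>.\<close>
lemma long_gap_exists:
  "(real (length ts) + 1) * \<tau> + real (length ts) * \<delta> \<le> u - s \<Longrightarrow> long_gap \<tau> \<delta> u s ts"
proof (induction ts arbitrary: s)
  case (Cons t ts)
  show ?case
  proof (cases "\<tau> \<le> t - \<delta> - s")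
    case False
    then have "(real (length ts) + 1) * \<tau> + real (length ts) * \<delta> \<le> u - t"
      using Cons.prems by (simp add: algebra_simps)
    then show ?thesis using Cons.IH by simp
  qed simp
qed simp

lemma telescope_power:
  fixes e :: real
  shows "e' * e ^ m + e * (real m * e ^ (m - 1) * e') = real (Suc m) * e ^ (Suc m - 1) * e'"
  by (cases m) (auto simp: algebra_simps)

section \<open>Estimates for products of operators\<close>
text \<open>\<open>Q\<close> only contributes constants, while every step operator costs \<open>k\<close> derivatives and brings a factor \<open>e\<close>.\<close>
locale operator_chains =
  fixes M :: "nat \<Rightarrow> real" and \<delta> u :: real and Q :: "real \<Rightarrow> real \<Rightarrow> 'n::finite oper" and k a :: nat and e :: real
  assumes M1: "\<And>r. 1 \<le> M r" and Mm: "mono M" and \<delta>: "0 < \<delta>" and u: "u \<in> grid \<delta>"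
    and Q: "\<And>s t. s \<in> grid \<delta> \<Longrightarrow> t \<in> grid \<delta> \<Longrightarrow> s \<le> t \<Longrightarrow> order_bound M 0 1 1 (Q s t)"
    and e: "0 \<le> e"
begin

lemma M0: "0 \<le> M r" using M1[of r] by linarith

context
  fixes D Z :: "real \<Rightarrow> 'n oper"
  assumes D: "\<And>t. t \<in> grid \<delta> \<Longrightarrow> t - \<delta> \<in> grid \<delta> \<Longrightarrow> order_bound M k a e (D t)"
    and Z: "\<And>s. s \<in> grid \<delta> \<Longrightarrow> s \<le> u \<Longrightarrow> order_bound M 0 1 1 (Z s)"
begin

lemma chain_bound:
  "s \<in> grid \<delta> \<Longrightarrow> s \<le> u \<Longrightarrow> admissible \<delta> s u ts \<Longrightarrow>
    order_bound M (k * length ts) ((a + 1) * length ts + 1) (e ^ length ts) (operator_chain \<delta> Q D Z s ts)"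
proof (induction ts arbitrary: s)
  case Nil
  have "operator_chain \<delta> Q D Z s [] = Z s" by (simp add: fun_eq_iff)
  then show ?case using Z[OF Nil.prems(1,2)] by simp
next
  case (Cons t ts)
  have ta: "t \<in> grid_after \<delta> s u" "admissible \<delta> t u ts" using admissible_Cons[OF Cons.prems(3)] by auto
  note tg = grid_after_step[OF \<delta> Cons.prems(1) ta(1)]
  have "operator_chain \<delta> Q D Z s (t # ts) = (\<lambda>f. Q s (t - \<delta>) (D t (operator_chain \<delta> Q D Z t ts f)))"
    by (simp add: fun_eq_iff)
  then show ?case
    using order_bound_comp[OF M1 Mm Q[OF Cons.prems(1) tg(2,3)]
        order_bound_comp[OF M1 Mm D[OF tg(1,2)] Cons.IH[OF tg(1,4) ta(2)] e zero_le_power[OF e]]] e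
    by (simp add: algebra_simps)
qed

text \<open>If the long gap is the first one, the rest of the product is estimated as an operator with a dual and the first factor
  regularizes it. Otherwise the rest contains the long gap, and the first two factors are taken to its left.\<close>
lemma chain_smoothing:
  assumes Qr: "\<And>s t. s \<in> grid \<delta> \<Longrightarrow> t \<in> grid \<delta> \<Longrightarrow> \<tau> \<le> t - s \<Longrightarrow> regularizing q \<rho> (Q s t)"
    and Zr: "\<And>s. s \<in> grid \<delta> \<Longrightarrow> \<tau> \<le> u - s \<Longrightarrow> regularizing q \<rho> (Z s)"
    and \<rho>: "0 \<le> \<rho>"
  shows "s \<in> grid \<delta> \<Longrightarrow> s \<le> u \<Longrightarrow> admissible \<delta> s u ts \<Longrightarrow> long_gap \<tau> \<delta> u s ts \<Longrightarrow> k * length ts \<le> q \<Longrightarrow>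
    smoothing_bound M q (k * length ts) ((a + 1) * length ts + 1)
      (real (card {\<gamma> :: 'n \<Rightarrow> nat. multi_size \<gamma> \<le> q}) * \<rho> * e ^ length ts) (operator_chain \<delta> Q D Z s ts)"
proof (induction ts arbitrary: s)
  case Nil
  let ?W = "real (card {\<gamma> :: 'n \<Rightarrow> nat. multi_size \<gamma> \<le> q}) * \<rho>"
  have "operator_chain \<delta> Q D Z s [] = (\<lambda>f. Z s f)" by (simp add: fun_eq_iff)
  moreover have "regularizing q \<rho> (Z s)" using Zr Nil.prems by simp
  ultimately have "smoothing_bound M q 0 0 (?W * 1) (operator_chain \<delta> Q D Z s [])"
    using smoothing_bound_regularizing[OF M1 Mm _ order_bound_id, where q = q and \<rho> = \<rho> and R = "Z s"] \<rho> by simp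
  then show ?case by (rule smoothing_bound_mono[OF M1 Mm]) (use \<rho> in auto)
next
  case (Cons t ts)
  let ?W = "real (card {\<gamma> :: 'n \<Rightarrow> nat. multi_size \<gamma> \<le> q}) * \<rho>"
  have W: "0 \<le> ?W" using \<rho> by simp
  have ta: "t \<in> grid_after \<delta> s u" "admissible \<delta> t u ts" using admissible_Cons[OF Cons.prems(3)] by auto
  note tg = grid_after_step[OF \<delta> Cons.prems(1) ta(1)]
  have ch: "operator_chain \<delta> Q D Z s (t # ts) = (\<lambda>f. Q s (t - \<delta>) (D t (operator_chain \<delta> Q D Z t ts f)))"
    by (simp add: fun_eq_iff)
  have kq: "k + k * length ts \<le> q" using Cons.prems(5) by simp
  consider "\<tau> \<le> t - \<delta> - s" | "long_gap \<tau> \<delta> u t ts" using Cons.prems(4) by auto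
  then show ?case
  proof cases
    case 1
    have "smoothing_bound M q (k + k * length ts) (a + ((a + 1) * length ts + 1)) (?W * (e * e ^ length ts))
        (operator_chain \<delta> Q D Z s (t # ts))"
      unfolding ch
      by (rule smoothing_bound_regularizing[OF M1 Mm Qr[OF Cons.prems(1) tg(2) 1]
            order_bound_comp[OF M1 Mm D[OF tg(1,2)] chain_bound[OF tg(1,4) ta(2)] e zero_le_power[OF e]] _ \<rho> kq])
         (use e in simp)
    then show ?thesis
      by (rule smoothing_bound_mono[OF M1 Mm]) (use W e in auto)
  next
    case 2
    have kl: "k * length ts \<le> q" using kq by simp
    have "smoothing_bound M q (0 + k + k * length ts) (1 + a + ((a + 1) * length ts + 1)) (1 * e * (?W * e ^ length ts))
        (operator_chain \<delta> Q D Z s (t # ts))"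
      unfolding ch
      by (rule smoothing_bound_comp_left[OF M1 Mm order_bound_comp[OF M1 Mm Q[OF Cons.prems(1) tg(2,3)] D[OF tg(1,2)]]
            Cons.IH[OF tg(1,4) ta(2) 2 kl]]) (use e W in auto)
    then show ?thesis by (simp add: algebra_simps ch)
  qed
qed

end

context
  fixes D D' Z :: "real \<Rightarrow> 'n oper" and e' :: real
  assumes D: "\<And>t. t \<in> grid \<delta> \<Longrightarrow> t - \<delta> \<in> grid \<delta> \<Longrightarrow> order_bound M k a e (D t)"
    and D': "\<And>t. t \<in> grid \<delta> \<Longrightarrow> t - \<delta> \<in> grid \<delta> \<Longrightarrow> order_bound M k a e (D' t)"
    and DD': "\<And>t. t \<in> grid \<delta> \<Longrightarrow> t - \<delta> \<in> grid \<delta> \<Longrightarrow> order_bound M k a e' (\<lambda>f x. D t f x - D' t f x)"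
    and Z: "\<And>s. s \<in> grid \<delta> \<Longrightarrow> s \<le> u \<Longrightarrow> order_bound M 0 1 1 (Z s)"
    and e': "0 \<le> e'"
begin

abbreviation "chain_difference s ts \<equiv> \<lambda>f x. operator_chain \<delta> Q D Z s ts f x - operator_chain \<delta> Q D' Z s ts f x"

text \<open>Telescoping: \<open>D A - D' A' = (D - D') A + D' (A - A')\<close> with \<open>A\<close>, \<open>A'\<close> the tails of the two products. The
  first form serves when the first factor \<open>Q\<close> regularizes everything behind it, the second when each
  summand contains the long gap further to the right.\<close>
lemma chain_difference_Cons:
  assumes s: "s \<in> grid \<delta>" and adm: "admissible \<delta> s u (t # ts)" and f: "f \<in> M_b"
  shows "chain_difference s (t # ts) f
      = Q s (t - \<delta>) (\<lambda>x. (\<lambda>f x. D t f x - D' t f x) (operator_chain \<delta> Q D Z t ts f) x + D' t (chain_difference t ts f) x)"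
    and "chain_difference s (t # ts) f
      = (\<lambda>x. Q s (t - \<delta>) ((\<lambda>f x. D t f x - D' t f x) (operator_chain \<delta> Q D Z t ts f)) x
           + Q s (t - \<delta>) (D' t (chain_difference t ts f)) x)"
proof -
  have ta: "t \<in> grid_after \<delta> s u" "admissible \<delta> t u ts" using admissible_Cons[OF adm] by auto
  note tg = grid_after_step[OF \<delta> s ta(1)]
  note Qk = order_boundD(1)[OF Q[OF s tg(2,3)]]
    and Dk = order_boundD(1)[OF D[OF tg(1,2)]] and D'k = order_boundD(1)[OF D'[OF tg(1,2)]]
  have c: "operator_chain \<delta> Q D Z t ts f \<in> M_b"
    by (rule signed_kernel_M_b[OF order_boundD(1)[OF chain_bound[OF D Z tg(1,4) ta(2)]] f])
  have c': "operator_chain \<delta> Q D' Z t ts f \<in> M_b"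
    by (rule signed_kernel_M_b[OF order_boundD(1)[OF chain_bound[OF D' Z tg(1,4) ta(2)]] f])
  note Dc = signed_kernel_M_b[OF Dk c] and D'c = signed_kernel_M_b[OF D'k c] and D'c' = signed_kernel_M_b[OF D'k c']
  have "chain_difference s (t # ts) f
      = Q s (t - \<delta>) (\<lambda>x. D t (operator_chain \<delta> Q D Z t ts f) x - D' t (operator_chain \<delta> Q D' Z t ts f) x)"
    using signed_kernel_diff[OF Qk Dc D'c'] by simp
  also have "(\<lambda>x. D t (operator_chain \<delta> Q D Z t ts f) x - D' t (operator_chain \<delta> Q D' Z t ts f) x)
      = (\<lambda>x. (\<lambda>f x. D t f x - D' t f x) (operator_chain \<delta> Q D Z t ts f) x + D' t (chain_difference t ts f) x)"
    using signed_kernel_diff[OF D'k c c'] by (simp add: fun_eq_iff)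
  finally show 1: "chain_difference s (t # ts) f
      = Q s (t - \<delta>) (\<lambda>x. (\<lambda>f x. D t f x - D' t f x) (operator_chain \<delta> Q D Z t ts f) x + D' t (chain_difference t ts f) x)" .
  show "chain_difference s (t # ts) f
      = (\<lambda>x. Q s (t - \<delta>) ((\<lambda>f x. D t f x - D' t f x) (operator_chain \<delta> Q D Z t ts f)) x
           + Q s (t - \<delta>) (D' t (chain_difference t ts f)) x)"
    unfolding 1
    by (rule signed_kernel_add[OF Qk M_b_diff[OF Dc D'c] signed_kernel_M_b[OF D'k M_b_diff[OF c c']]])
qed

lemma chain_difference_tail:
  assumes s: "s \<in> grid \<delta>" and adm: "admissible \<delta> s u (t # ts)"
    and IH: "order_bound M (k * length ts) ((a + 1) * length ts + 1) (real (length ts) * e ^ (length ts - 1) * e')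
      (chain_difference t ts)"
  shows "order_bound M (k + k * length ts) (a + ((a + 1) * length ts + 1)) (real (Suc (length ts)) * e ^ (Suc (length ts) - 1) * e')
    (\<lambda>f x. (\<lambda>f x. D t f x - D' t f x) (operator_chain \<delta> Q D Z t ts f) x + D' t (chain_difference t ts f) x)"
proof -
  have ta: "t \<in> grid_after \<delta> s u" "admissible \<delta> t u ts" using admissible_Cons[OF adm] by auto
  note tg = grid_after_step[OF \<delta> s ta(1)]
  show ?thesis
    unfolding telescope_power[symmetric]
    by (rule order_bound_add[OF order_bound_comp[OF M1 Mm DD'[OF tg(1,2)] chain_bound[OF D Z tg(1,4) ta(2)] e']
          order_bound_comp[OF M1 Mm D'[OF tg(1,2)] IH e]]) (use e e' M0 in auto)
qed

lemma chain_difference_bound: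
  "s \<in> grid \<delta> \<Longrightarrow> s \<le> u \<Longrightarrow> admissible \<delta> s u ts \<Longrightarrow>
    order_bound M (k * length ts) ((a + 1) * length ts + 1) (real (length ts) * e ^ (length ts - 1) * e')
      (chain_difference s ts)"
proof (induction ts arbitrary: s)
  case Nil
  show ?case by (simp add: order_bound_zero)
next
  case (Cons t ts)
  have ta: "t \<in> grid_after \<delta> s u" "admissible \<delta> t u ts" using admissible_Cons[OF Cons.prems(3)] by auto
  note tg = grid_after_step[OF \<delta> Cons.prems(1) ta(1)]
  have "order_bound M (0 + (k + k * length ts)) (1 + (a + ((a + 1) * length ts + 1)))
      (1 * (real (Suc (length ts)) * e ^ (Suc (length ts) - 1) * e')) (chain_difference s (t # ts))"
    by (rule order_bound_cong[OF order_bound_comp[OF M1 Mm Q[OF Cons.prems(1) tg(2,3)]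
            chain_difference_tail[OF Cons.prems(1,3) Cons.IH[OF tg(1,4) ta(2)]]]])
       (use e e' chain_difference_Cons(1)[OF Cons.prems(1,3)] in auto)
  then show ?case by (simp add: algebra_simps)
qed

lemma chain_difference_smoothing:
  assumes Qr: "\<And>s t. s \<in> grid \<delta> \<Longrightarrow> t \<in> grid \<delta> \<Longrightarrow> \<tau> \<le> t - s \<Longrightarrow> regularizing q \<rho> (Q s t)"
    and Zr: "\<And>s. s \<in> grid \<delta> \<Longrightarrow> \<tau> \<le> u - s \<Longrightarrow> regularizing q \<rho> (Z s)"
    and \<rho>: "0 \<le> \<rho>"
  shows "s \<in> grid \<delta> \<Longrightarrow> s \<le> u \<Longrightarrow> admissible \<delta> s u ts \<Longrightarrow> long_gap \<tau> \<delta> u s ts \<Longrightarrow> k * length ts \<le> q \<Longrightarrow>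
    smoothing_bound M q (k * length ts) ((a + 1) * length ts + 1)
      (real (card {\<gamma> :: 'n \<Rightarrow> nat. multi_size \<gamma> \<le> q}) * \<rho> * (real (length ts) * e ^ (length ts - 1) * e'))
      (chain_difference s ts)"
proof (induction ts arbitrary: s)
  case Nil
  show ?case by (simp add: smoothing_bound_zero[OF M1 Mm])
next
  case (Cons t ts)
  let ?W = "real (card {\<gamma> :: 'n \<Rightarrow> nat. multi_size \<gamma> \<le> q}) * \<rho>"
  have W: "0 \<le> ?W" using \<rho> by simp
  have ta: "t \<in> grid_after \<delta> s u" "admissible \<delta> t u ts" using admissible_Cons[OF Cons.prems(3)] by auto
  note tg = grid_after_step[OF \<delta> Cons.prems(1) ta(1)]
  have kq: "k + k * length ts \<le> q" using Cons.prems(5) by simp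
  let ?e = "real (Suc (length ts)) * e ^ (Suc (length ts) - 1) * e'"
  have e0: "0 \<le> ?e" using e e' by simp
  consider "\<tau> \<le> t - \<delta> - s" | "long_gap \<tau> \<delta> u t ts" using Cons.prems(4) by auto
  then show ?case
  proof cases
    case 1
    have "smoothing_bound M q (k + k * length ts) (a + ((a + 1) * length ts + 1)) (?W * ?e) (chain_difference s (t # ts))"
      by (rule smoothing_bound_cong[OF M1 Mm smoothing_bound_regularizing[OF M1 Mm Qr[OF Cons.prems(1) tg(2) 1]
            chain_difference_tail[OF Cons.prems(1,3) chain_difference_bound[OF tg(1,4) ta(2)]] e0 \<rho> kq]
            chain_difference_Cons(1)[OF Cons.prems(1,3)]])
    then show ?thesis
      by (rule smoothing_bound_mono[OF M1 Mm]) (use W e0 in auto)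
  next
    case 2
    have kl: "k * length ts \<le> q" using kq by simp
    let ?c = "real (length ts) * e ^ (length ts - 1) * e'"
    have c0: "0 \<le> ?c" using e e' by simp
    have 3: "smoothing_bound M q (0 + k + k * length ts) (1 + a + ((a + 1) * length ts + 1)) (1 * e' * (?W * e ^ length ts))
        (\<lambda>f. Q s (t - \<delta>) ((\<lambda>f x. D t f x - D' t f x) (operator_chain \<delta> Q D Z t ts f)))"
      by (rule smoothing_bound_comp_left[OF M1 Mm order_bound_comp[OF M1 Mm Q[OF Cons.prems(1) tg(2,3)] DD'[OF tg(1,2)]]
            chain_smoothing[OF D Z Qr Zr \<rho> tg(1,4) ta(2) 2 kl]]) (use e e' W in auto)
    have 4: "smoothing_bound M q (0 + k + k * length ts) (1 + a + ((a + 1) * length ts + 1)) (1 * e * (?W * ?c))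
        (\<lambda>f. Q s (t - \<delta>) (D' t (chain_difference t ts f)))"
      by (rule smoothing_bound_comp_left[OF M1 Mm order_bound_comp[OF M1 Mm Q[OF Cons.prems(1) tg(2,3)] D'[OF tg(1,2)]]
            Cons.IH[OF tg(1,4) ta(2) 2 kl]]) (use e e' W c0 in auto)
    have "smoothing_bound M q (0 + k + k * length ts) (1 + a + ((a + 1) * length ts + 1))
        (1 * e' * (?W * e ^ length ts) + 1 * e * (?W * ?c)) (chain_difference s (t # ts))"
      by (rule smoothing_bound_cong[OF M1 Mm smoothing_bound_add[OF M1 Mm 3 4] chain_difference_Cons(2)[OF Cons.prems(1,3)]])
         (use e e' W c0 in auto)
    moreover have eq: "1 * e' * (?W * e ^ length ts) + 1 * e * (?W * ?c) = ?W * ?e"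
      unfolding telescope_power[symmetric] by (simp add: algebra_simps)
    ultimately have "smoothing_bound M q (0 + k + k * length ts) (1 + a + ((a + 1) * length ts + 1)) (?W * ?e)
        (chain_difference s (t # ts))"
      by (simp only: eq)
    then show ?thesis by (simp add: algebra_simps)
  qed
qed

end

end

section \<open>Constants and parameters\<close>
text \<open>A single increasing weight, at least 1, that dominates the constants \<open>K r\<close> of all orders.\<close>
definition majorant :: "(nat \<Rightarrow> real) \<Rightarrow> nat \<Rightarrow> real" where
  "majorant K r = 1 + (\<Sum>j\<le>r. \<bar>K j\<bar>)"

lemma majorant_ge_1: "1 \<le> majorant K r"
  unfolding majorant_def by (simp add: sum_nonneg)

lemma mono_majorant: "mono (majorant K)"
  unfolding majorant_def by (rule monoI) (intro add_left_mono sum_mono2, auto)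

lemma le_majorant: "r \<le> s \<Longrightarrow> K r \<le> majorant K s"
proof -
  assume "r \<le> s"
  have "\<bar>K r\<bar> \<le> (\<Sum>j\<le>r. \<bar>K j\<bar>)" by (rule member_le_sum) auto
  then have "K r \<le> majorant K r" unfolding majorant_def by linarith
  also have "\<dots> \<le> majorant K s" by (rule monoD[OF mono_majorant \<open>r \<le> s\<close>])
  finally show ?thesis .
qed

lemma order_bound_of_propagation:
  assumes k: "signed_kernel (A s t)" and p: "propagates_regularity I A K"
    and d: "dually_propagates_regularity I A K" and st: "(s, t) \<in> I"
  shows "order_bound (majorant K) 0 1 1 (A s t)"
proof (rule order_boundI[OF k])
  have c: "ennreal (K r) \<le> ennreal (1 * majorant K (0 + r) ^ 1)" for r
    by (rule ennreal_leI) (simp add: le_majorant)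
  have p': "A s t f \<in> C_b r" "C_b_norm r (A s t f) \<le> ennreal (K r) * C_b_norm r f" if "f \<in> C_b r" for f r
    using p st that unfolding propagates_regularity_def by blast+
  show "A s t f \<in> C_b 0" if "f \<in> C_b 0" for f using p'(1)[OF that] .
  show "A s t f \<in> C_b r" if "f \<in> C_b (0 + r)" for f r using p'(1)[of f r] that by simp
  show "C_b_norm r (A s t f) \<le> ennreal (1 * majorant K (0 + r) ^ 1) * C_b_norm (0 + r) f"
    if "f \<in> C_b (0 + r)" for f r
    using order_trans[OF p'(2)[of f r] mult_right_mono[OF c]] that by simp
  show "\<exists>h\<in>C_1 r. is_dual (A s t) f h \<and> C_1_norm r h \<le> ennreal (1 * majorant K (0 + r) ^ 1) * C_1_norm (0 + r) f"
    if "f \<in> C_1 (0 + r)" for f r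
  proof -
    have "f \<in> C_1 r" using that by simp
    then obtain h where h: "h \<in> C_1 r" "is_dual (A s t) f h" "C_1_norm r h \<le> ennreal (K r) * C_1_norm r f"
      using d st unfolding dually_propagates_regularity_def by blast
    have "C_1_norm r h \<le> ennreal (1 * majorant K (0 + r) ^ 1) * C_1_norm (0 + r) f"
      using order_trans[OF h(3) mult_right_mono[OF c]] by simp
    then show ?thesis using h(1,2) by blast
  qed
qed

lemma order_bound_step_error:
  assumes P: "order_bound M 0 1 1 (P t (t + \<delta>))" and Q: "order_bound M 0 1 1 (Q t (t + \<delta>))"
    and s: "short_time_estimate \<delta> \<alpha> \<beta> P Q K" and d: "dual_short_time_estimate \<delta> \<alpha> \<beta> P Q K" and t: "t \<in> grid \<delta>"
  shows "order_bound (majorant K) \<beta> 1 (\<delta> powr (\<alpha> + 1)) (\<lambda>f x. P t (t + \<delta>) f x - Q t (t + \<delta>) f x)"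
proof (rule order_boundI)
  have c: "ennreal (K r * \<delta> powr (\<alpha> + 1)) \<le> ennreal (\<delta> powr (\<alpha> + 1) * majorant K (\<beta> + r) ^ 1)" for r
    by (rule ennreal_leI) (simp add: le_majorant mult_right_mono mult.commute)
  show "signed_kernel (\<lambda>f x. P t (t + \<delta>) f x - Q t (t + \<delta>) f x)"
    by (rule signed_kernel_op_diff[OF order_boundD(1)[OF P] order_boundD(1)[OF Q]])
  show "(\<lambda>x. P t (t + \<delta>) f x - Q t (t + \<delta>) f x) \<in> C_b 0" if "f \<in> C_b 0" for f
    by (rule C_b_diff[OF order_boundD(2)[OF P that] order_boundD(2)[OF Q that]])
  show "(\<lambda>x. P t (t + \<delta>) f x - Q t (t + \<delta>) f x) \<in> C_b r" if "f \<in> C_b (\<beta> + r)" for f r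
  proof -
    have f: "f \<in> C_b (0 + r)" using C_b_mono[OF that] by simp
    show ?thesis by (rule C_b_diff[OF order_boundD(3)[OF P f] order_boundD(3)[OF Q f]])
  qed
  show "C_b_norm r (\<lambda>x. P t (t + \<delta>) f x - Q t (t + \<delta>) f x)
      \<le> ennreal (\<delta> powr (\<alpha> + 1) * majorant K (\<beta> + r) ^ 1) * C_b_norm (\<beta> + r) f"
    if f: "f \<in> C_b (\<beta> + r)" for f r
  proof -
    have "C_b_norm r (\<lambda>x. P t (t + \<delta>) f x - Q t (t + \<delta>) f x) \<le> ennreal (K r * \<delta> powr (\<alpha> + 1)) * C_b_norm (\<beta> + r) f"
      using s f t unfolding short_time_estimate_def by blast
    also have "\<dots> \<le> ennreal (\<delta> powr (\<alpha> + 1) * majorant K (\<beta> + r) ^ 1) * C_b_norm (\<beta> + r) f"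
      by (rule mult_right_mono[OF c]) simp
    finally show ?thesis .
  qed
  show "\<exists>h\<in>C_1 r. is_dual (\<lambda>f x. P t (t + \<delta>) f x - Q t (t + \<delta>) f x) f h \<and>
      C_1_norm r h \<le> ennreal (\<delta> powr (\<alpha> + 1) * majorant K (\<beta> + r) ^ 1) * C_1_norm (\<beta> + r) f"
    if f: "f \<in> C_1 (\<beta> + r)" for f r
  proof -
    obtain h k where hk: "h \<in> C_1 r" "k \<in> C_1 r" "is_dual (P t (t + \<delta>)) f h" "is_dual (Q t (t + \<delta>)) f k"
        "C_1_norm r (\<lambda>x. h x - k x) \<le> ennreal (K r * \<delta> powr (\<alpha> + 1)) * C_1_norm (\<beta> + r) f"
      using d f t unfolding dual_short_time_estimate_def by blast
    note hk(5)
    also have "ennreal (K r * \<delta> powr (\<alpha> + 1)) * C_1_norm (\<beta> + r) f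
        \<le> ennreal (\<delta> powr (\<alpha> + 1) * majorant K (\<beta> + r) ^ 1) * C_1_norm (\<beta> + r) f"
      by (rule mult_right_mono[OF c]) simp
    finally show ?thesis
      using C_1_diff[OF hk(1,2)]
        is_dual_diff[OF hk(3,4) order_boundD(1)[OF P] order_boundD(1)[OF Q] C_1_integrable[OF f]] by blast
  qed
qed

context
  fixes \<alpha> :: real and l \<mu> :: nat
  assumes \<alpha>: "0 < \<alpha>"
begin

lemma level_exponent_pos: "0 < (1 + \<alpha>) * real l + \<alpha>"
  using \<alpha> by (simp add: add_nonneg_pos)

lemma m_par_ge: "real \<mu> \<le> real (m_par \<alpha> l \<mu>) * ((1 + \<alpha>) * real l + \<alpha>)"
proof -
  have "real \<mu> / ((1 + \<alpha>) * real l + \<alpha>) \<le> real (m_par \<alpha> l \<mu>)"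
    unfolding m_par_def by linarith
  then show ?thesis using level_exponent_pos by (simp add: field_simps)
qed

lemma m_par_pos: "1 \<le> \<mu> \<Longrightarrow> 1 \<le> m_par \<alpha> l \<mu>"
  using m_par_ge level_exponent_pos by (cases "m_par \<alpha> l \<mu>") auto

lemma m_par_upper:
  assumes "1 \<le> i" "i \<le> m_par \<alpha> l \<mu>"
  shows "(real i - 1) * ((1 + \<alpha>) * real l + \<alpha>) < real \<mu>"
proof -
  have "int i \<le> \<lceil>real \<mu> / ((1 + \<alpha>) * real l + \<alpha>)\<rceil>" using assms unfolding m_par_def by linarith
  then have "real i - 1 < real \<mu> / ((1 + \<alpha>) * real l + \<alpha>)" by linarith
  then show ?thesis using level_exponent_pos by (simp add: field_simps)
qed

lemma q_par_ge:
  assumes "1 \<le> i" "i \<le> m_par \<alpha> l \<mu>"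
  shows "real \<mu> + real i - (1 + \<alpha>) * (real l + 1) * (real i - 1) \<le> real (q_par \<alpha> l \<mu> i)"
  using int_q_par[OF \<alpha> assms] by linarith

text \<open>The accuracy required one level down is never below that of a single step there. Hence the difference between the
  scheme and \<open>Q\<close> is as small as the difference between \<open>P\<close> and \<open>Q\<close>.\<close>
lemma q_par_ge_step:
  assumes i: "1 \<le> i" "i \<le> m_par \<alpha> l \<mu> - 1"
  shows "(real l + 1) * (1 + \<alpha>) \<le> real (q_par \<alpha> l \<mu> i)"
proof -
  have "(real (Suc i) - 1) * ((1 + \<alpha>) * real l + \<alpha>) < real \<mu>" by (rule m_par_upper) (use i in auto)
  moreover have "real \<mu> + real i - (1 + \<alpha>) * (real l + 1) * (real i - 1) \<le> real (q_par \<alpha> l \<mu> i)"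
    by (rule q_par_ge) (use i in auto)
  ultimately show ?thesis by (simp add: algebra_simps)
qed

lemma q_par_le:
  assumes i: "1 \<le> i" "i \<le> m_par \<alpha> l \<mu>"
  shows "q_par \<alpha> l \<mu> i \<le> \<mu> + 1"
proof -
  have "0 \<le> ((1 + \<alpha>) * real l + \<alpha>) * (real i - 1)" using level_exponent_pos i by simp
  then have "real i - (1 + \<alpha>) * (real l + 1) * (real i - 1) \<le> 1" by (simp add: algebra_simps)
  then show ?thesis unfolding q_par_def by linarith
qed

lemma kappa_ge:
  shows "\<beta> * m_par \<alpha> l \<mu> \<le> kappa \<alpha> \<beta> l \<mu>"
    and "1 \<le> i \<Longrightarrow> i \<le> m_par \<alpha> l \<mu> - 1 \<Longrightarrow> i * kappa \<alpha> \<beta> (Suc l) (q_par \<alpha> l \<mu> i) \<le> kappa \<alpha> \<beta> l \<mu>"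
proof -
  have k: "kappa \<alpha> \<beta> l \<mu> = Max (insert (\<beta> * m_par \<alpha> l \<mu>)
      ((\<lambda>i. i * kappa \<alpha> \<beta> (Suc l) (q_par \<alpha> l \<mu> i)) ` {1..m_par \<alpha> l \<mu> - 1}))"
    using \<alpha> by (subst kappa.simps) simp
  show "\<beta> * m_par \<alpha> l \<mu> \<le> kappa \<alpha> \<beta> l \<mu>" unfolding k by (rule Max_ge) auto
  show "1 \<le> i \<Longrightarrow> i \<le> m_par \<alpha> l \<mu> - 1 \<Longrightarrow> i * kappa \<alpha> \<beta> (Suc l) (q_par \<alpha> l \<mu> i) \<le> kappa \<alpha> \<beta> l \<mu>"
    unfolding k by (rule Max_ge) auto
qed

end

lemma kappa_ge_order: "0 < \<alpha> \<Longrightarrow> 1 \<le> \<mu> \<Longrightarrow> \<beta> \<le> kappa \<alpha> \<beta> l \<mu>"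
  using order_trans[OF mult_le_mono2[OF m_par_pos] kappa_ge(1)] by simp

text \<open>The short time estimates are given for the levels up to \<open>l_par\<close> only. A correction at level \<open>l\<close>
  uses the scheme of level \<open>l + 1\<close>, whose error is analysed on the grid of level \<open>l + 2\<close>. The bound \<open>\<mu> \<le> \<nu> + l\<close> is preserved by the
  recursion because a level raises the accuracy by at most one (\<open>q_par_le\<close>).\<close>
lemma next_level_available:
  assumes \<alpha>: "0 < \<alpha>" and m: "2 \<le> m_par \<alpha> l \<mu>" and \<mu>: "\<mu> \<le> \<nu> + l"
  shows "Suc (Suc l) \<le> l_par \<alpha> \<nu>"
proof -
  have "(real 2 - 1) * ((1 + \<alpha>) * real l + \<alpha>) < real \<mu>" by (rule m_par_upper[OF \<alpha> _ m]) simp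
  then have "\<alpha> * (real l + 1) < real \<nu>" using \<mu> by (simp add: algebra_simps)
  then have "real l + 1 < real \<nu> / \<alpha>" using \<alpha> by (simp add: field_simps)
  then show ?thesis unfolding l_par_def by linarith
qed

section \<open>The recursive scheme\<close>
text \<open>A sum over at most \<open>n ^ i\<close> lists of times, of products with \<open>j\<close> factors of size \<open>n powr (- w)\<close> and one of size
  \<open>n powr (- q)\<close>.\<close>
lemma powr_count:
  assumes n: "1 \<le> (n::nat)" and le: "real i - w * real j - q \<le> - \<mu>"
  shows "real n ^ i * (real n powr (- w)) ^ j * real n powr (- q) \<le> real n powr (- \<mu>)"
proof -
  have n0: "0 < real n" using n by simp
  have "real n ^ i * (real n powr (- w)) ^ j * real n powr (- q) = real n powr (real i - w * real j - q)"
    using n0 by (simp add: powr_realpow[symmetric] powr_powr powr_add[symmetric] powr_diff powr_minus field_simps)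
  also have "\<dots> \<le> real n powr (- \<mu>)" using n le by (intro powr_mono) auto
  finally show ?thesis .
qed

text \<open>A product with \<open>i\<close> step operators, each with exponent \<open>a i + 1\<close>, has \<open>i + 1\<close> further factors from the
  semigroups, hence exponent \<open>(a i + 2) * i + 1\<close>. The last summand belongs to the remainder, whose
  step operators have exponent 1.\<close>
definition error_power :: "nat \<Rightarrow> (nat \<Rightarrow> nat) \<Rightarrow> nat" where
  "error_power m a = (\<Sum>i\<in>{1..m - 1}. (a i + 2) * i + 1) + (2 * m + 1)"

definition error_constant :: "real \<Rightarrow> nat \<Rightarrow> (nat \<Rightarrow> real) \<Rightarrow> real" where
  "error_constant c m E = (\<Sum>i\<in>{1..m - 1}. real i * (c + E i) ^ (i - 1) * E i) + c ^ m"

lemma error_constant_nonneg: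
  "0 \<le> c \<Longrightarrow> (\<And>i. i \<in> {1..m - 1} \<Longrightarrow> 0 \<le> E i) \<Longrightarrow> 0 \<le> error_constant c m E"
  unfolding error_constant_def by (intro add_nonneg_nonneg sum_nonneg mult_nonneg_nonneg zero_le_power) auto

lemma error_power_ge:
  shows "i \<in> {1..m - 1} \<Longrightarrow> (a i + 1 + 1) * i + 1 \<le> error_power m a" and "(1 + 1) * m + 1 \<le> error_power m a"
proof -
  assume "i \<in> {1..m - 1}"
  then have "(a i + 2) * i + 1 \<le> (\<Sum>i\<in>{1..m - 1}. (a i + 2) * i + 1)" by (rule member_le_sum) auto
  then show "(a i + 1 + 1) * i + 1 \<le> error_power m a" unfolding error_power_def by simp
qed (simp add: error_power_def)

text \<open>The hypotheses for one choice of \<open>n\<close>, \<open>P\<close> and \<open>Q\<close>; constants that must not depend on these are fixed outside. The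
  short time estimates are assumed up to level \<open>L\<close>.\<close>
locale scheme =
  fixes T \<alpha> :: real and \<beta> L n :: nat and K :: "nat \<Rightarrow> real"
    and P :: "real \<Rightarrow> real \<Rightarrow> 'n::finite oper" and Q :: "real \<Rightarrow> real \<Rightarrow> real \<Rightarrow> 'n oper"
  assumes T: "0 < T" and \<alpha>: "0 < \<alpha>" and n: "1 \<le> n"
    and P: "grid_independent_family P" and Q: "discrete_semigroup (step T n l) (Q (step T n l))"
    and P_prop: "propagates_regularity all_grid_pairs P K"
    and Q_prop: "propagates_regularity (grid_pairs (step T n l)) (Q (step T n l)) K"
    and P_dual: "dually_propagates_regularity all_grid_pairs P K"
    and Q_dual: "dually_propagates_regularity (grid_pairs (step T n l)) (Q (step T n l)) K"
    and short: "l \<in> {1..L} \<Longrightarrow> short_time_estimate (step T n l) \<alpha> \<beta> P (Q (step T n l)) K"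
    and dual_short: "l \<in> {1..L} \<Longrightarrow> dual_short_time_estimate (step T n l) \<alpha> \<beta> P (Q (step T n l)) K"
begin

abbreviation "\<delta> l \<equiv> step T n l"
abbreviation "M \<equiv> majorant K"
abbreviation "\<omega> l \<equiv> real n powr (- ((real l + 1) * (1 + \<alpha>)))"

lemma step_pos: "0 < \<delta> l"
  unfolding step_def using T n by simp

lemma step_refine: "\<delta> l = real n * \<delta> (Suc l)"
  unfolding step_def using n by simp

lemma grid_refine: "t \<in> grid (\<delta> l) \<Longrightarrow> t \<in> grid (\<delta> (Suc l))"
  unfolding grid_def step_refine[of l] by (auto simp: mult.assoc[symmetric] of_nat_mult[symmetric] simp del: of_nat_mult)

lemma grid_next: "t \<in> grid (\<delta> l) \<Longrightarrow> t + \<delta> l \<in> grid (\<delta> (Suc l))"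
  using grid_add[OF grid_refine, of t l n] step_refine[of l] by simp

lemma step_powr: "\<delta> (Suc l) powr (\<alpha> + 1) = T powr (\<alpha> + 1) * \<omega> l"
proof -
  have "\<delta> (Suc l) = T * real n powr (- (real l + 1))"
  proof -
    have "real n powr (real l + 1) = real n ^ Suc l"
      using n powr_realpow[of "real n" "Suc l"] by (simp add: add.commute)
    then show ?thesis unfolding step_def powr_minus by (simp add: divide_inverse)
  qed
  then show ?thesis using T n by (simp add: powr_mult powr_powr algebra_simps)
qed

lemma P_semigroup: "0 < d \<Longrightarrow> discrete_semigroup d P"
  using P unfolding grid_independent_family_def by blast

lemma P_bound:
  assumes "0 < d" "s \<in> grid d" "t \<in> grid d" "s \<le> t"
  shows "order_bound M 0 1 1 (P s t)"
  by (rule order_bound_of_propagation[OF semigroup_kernel[OF P_semigroup[OF assms(1)] assms] P_prop P_dual])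
     (use assms in \<open>auto simp: all_grid_pairs_def grid_pairs_def\<close>)

lemma Q_bound:
  assumes "s \<in> grid (\<delta> l)" "t \<in> grid (\<delta> l)" "s \<le> t"
  shows "order_bound M 0 1 1 (Q (\<delta> l) s t)"
  by (rule order_bound_of_propagation[OF semigroup_kernel[OF Q step_pos assms] Q_prop Q_dual])
     (use assms in \<open>auto simp: grid_pairs_def\<close>)

definition step_error :: "nat \<Rightarrow> real \<Rightarrow> 'n oper" where
  "step_error l t f x = P (t - \<delta> l) t f x - Q (\<delta> l) (t - \<delta> l) t f x"

definition step_correction :: "nat \<Rightarrow> nat \<Rightarrow> real \<Rightarrow> 'n oper" where
  "step_correction l \<mu> t f x = Q_hat \<alpha> T n Q l \<mu> (t - \<delta> l) f x - Q (\<delta> l) (t - \<delta> l) t f x"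

definition local_error :: "nat \<Rightarrow> nat \<Rightarrow> real \<Rightarrow> 'n oper" where
  "local_error l \<mu> t f x = P t (t + \<delta> l) f x - Q_hat \<alpha> T n Q l \<mu> t f x"

lemma step_error_bound:
  assumes l: "Suc l \<le> L" and t: "t \<in> grid (\<delta> (Suc l))" "t - \<delta> (Suc l) \<in> grid (\<delta> (Suc l))"
  shows "order_bound M \<beta> 1 (T powr (\<alpha> + 1) * \<omega> l) (step_error (Suc l) t)"
proof -
  let ?d = "\<delta> (Suc l)"
  have eq: "t - ?d + ?d = t" by simp
  have le: "t - ?d \<le> t" using step_pos[of "Suc l"] by simp
  have "order_bound M \<beta> 1 (?d powr (\<alpha> + 1))
      (\<lambda>f x. P (t - ?d) (t - ?d + ?d) f x - Q ?d (t - ?d) (t - ?d + ?d) f x)"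
  proof (rule order_bound_step_error[where M = M])
    show "order_bound M 0 1 1 (P (t - ?d) (t - ?d + ?d))"
      unfolding eq by (rule P_bound[OF step_pos t(2,1) le])
    show "order_bound M 0 1 1 (Q ?d (t - ?d) (t - ?d + ?d))"
      unfolding eq by (rule Q_bound[OF t(2,1) le])
  qed (use short[of "Suc l"] dual_short[of "Suc l"] l t in auto)
  moreover have "step_error (Suc l) t = (\<lambda>f x. P (t - ?d) t f x - Q ?d (t - ?d) t f x)"
    by (simp add: fun_eq_iff step_error_def)
  ultimately show ?thesis unfolding eq step_powr by simp
qed

text \<open>The scheme is the expansion of \<open>P\<close> with the remainder dropped and the step errors replaced; the terms without
  step operators coincide and cancel.\<close>
lemma local_error_expansion:
  assumes t: "t \<in> grid (\<delta> l)" and f: "f \<in> M_b" and m: "1 \<le> m_par \<alpha> l \<mu>"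
  defines "u \<equiv> t + \<delta> l" and "d \<equiv> \<delta> (Suc l)"
  shows "local_error l \<mu> t f x =
    (\<Sum>i\<in>{1..m_par \<alpha> l \<mu> - 1}. \<Sum>ts\<in>time_lists d t u i.
        operator_chain d (Q d) (step_error (Suc l)) (\<lambda>s. Q d s u) t ts f x
      - operator_chain d (Q d) (step_correction (Suc l) (q_par \<alpha> l \<mu> i)) (\<lambda>s. Q d s u) t ts f x)
    + (\<Sum>ts\<in>time_lists d t u (m_par \<alpha> l \<mu>). operator_chain d (Q d) (step_error (Suc l)) (\<lambda>s. P s u) t ts f x)"
proof -
  let ?m = "m_par \<alpha> l \<mu>"
  have tu: "t \<le> u" unfolding u_def using step_pos[of l] by simp
  have D: "(\<lambda>t f x. P (t - d) t f x - Q d (t - d) t f x) = step_error (Suc l)"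
    by (simp add: fun_eq_iff step_error_def d_def)
  have D': "(\<lambda>t f x. Q_hat \<alpha> T n Q (Suc l) \<mu>' (t - d) f x - Q d (t - d) t f x) = step_correction (Suc l) \<mu>'" for \<mu>'
    by (simp add: fun_eq_iff step_correction_def d_def)
  have range: "{..<?m} = insert 0 {1..?m - 1}" using m by auto
  have "P t u f x = (\<Sum>i<?m. expansion_term d (Q d) (step_error (Suc l)) (\<lambda>s. Q d s u) u i t f x)
      + expansion_term d (Q d) (step_error (Suc l)) (\<lambda>s. P s u) u ?m t f x"
    using expansion[of d P "Q d" u f t x ?m, unfolded D] tu f P_semigroup[OF step_pos] Q[of "Suc l"] step_pos[of "Suc l"]
      grid_next[OF t] grid_refine[OF t] unfolding d_def u_def by blast
  also have "(\<Sum>i<?m. expansion_term d (Q d) (step_error (Suc l)) (\<lambda>s. Q d s u) u i t f x)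
      = Q d t u f x + (\<Sum>i\<in>{1..?m - 1}. expansion_term d (Q d) (step_error (Suc l)) (\<lambda>s. Q d s u) u i t f x)"
    unfolding range by (subst sum.insert) (auto simp: expansion_term_def time_lists_0)
  finally have Pu: "P t u f x = Q d t u f x
      + (\<Sum>i\<in>{1..?m - 1}. expansion_term d (Q d) (step_error (Suc l)) (\<lambda>s. Q d s u) u i t f x)
      + expansion_term d (Q d) (step_error (Suc l)) (\<lambda>s. P s u) u ?m t f x" .
  have Qu: "Q_hat \<alpha> T n Q l \<mu> t f x = Q d t u f x
      + (\<Sum>i\<in>{1..?m - 1}. expansion_term d (Q d) (step_correction (Suc l) (q_par \<alpha> l \<mu> i)) (\<lambda>s. Q d s u) u i t f x)"
    by (subst Q_hat.simps)
       (simp add: \<alpha> I_hat_def chain_eq_operator_chain expansion_term_def D' flip: d_def u_def)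
  show ?thesis
    unfolding local_error_def u_def[symmetric] Pu Qu
    by (simp add: expansion_term_def sum_subtractf)
qed

context
  fixes l \<mu> :: nat and a :: "nat \<Rightarrow> nat" and E :: "nat \<Rightarrow> real"
  assumes l: "Suc l \<le> L" and \<mu>: "1 \<le> \<mu>"
    and IH: "\<And>i s. i \<in> {1..m_par \<alpha> l \<mu> - 1} \<Longrightarrow> s \<in> grid (\<delta> (Suc l)) \<Longrightarrow>
      order_bound M (kappa \<alpha> \<beta> (Suc l) (q_par \<alpha> l \<mu> i)) (a i) (E i * real n powr (- real (q_par \<alpha> l \<mu> i)))
        (local_error (Suc l) (q_par \<alpha> l \<mu> i) s)"
    and E: "\<And>i. i \<in> {1..m_par \<alpha> l \<mu> - 1} \<Longrightarrow> 0 \<le> E i"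
begin

abbreviation "m \<equiv> m_par \<alpha> l \<mu>"
abbreviation "q i \<equiv> q_par \<alpha> l \<mu> i"
abbreviation "ord i \<equiv> kappa \<alpha> \<beta> (Suc l) (q i)"
abbreviation "T\<alpha> \<equiv> T powr (\<alpha> + 1)"
abbreviation "d \<equiv> \<delta> (Suc l)"

text \<open>The two kinds of step operators are brought to a common bound, as \<open>operator_chains\<close> requires. The one for the
  correction comes from writing it as the step error minus the local error.\<close>
lemma step_operators:
  assumes i: "i \<in> {1..m - 1}" and t: "t \<in> grid d" "t - d \<in> grid d"
  shows "order_bound M (ord i) (a i + 1) ((T\<alpha> + E i) * \<omega> l) (step_error (Suc l) t)"
    and "order_bound M (ord i) (a i + 1) ((T\<alpha> + E i) * \<omega> l) (step_correction (Suc l) (q i) t)"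
    and "order_bound M (ord i) (a i + 1) (E i * real n powr (- real (q i)))
      (\<lambda>f x. step_error (Suc l) t f x - step_correction (Suc l) (q i) t f x)"
proof -
  have i': "1 \<le> i" "i \<le> m - 1" using i by auto
  have qi: "(real l + 1) * (1 + \<alpha>) \<le> real (q i)" by (rule q_par_ge_step[OF \<alpha> i'])
  have "1 * 1 \<le> (real l + 1) * (1 + \<alpha>)" using \<alpha> by (intro mult_mono) auto
  then have "1 \<le> q i" using qi by simp
  then have ord: "\<beta> \<le> ord i" by (rule kappa_ge_order[OF \<alpha>])
  have om: "real n powr (- real (q i)) \<le> \<omega> l" using qi n by (intro powr_mono) auto
  have nn: "0 \<le> E i" "0 \<le> T\<alpha> * \<omega> l" "0 \<le> E i * real n powr (- real (q i))" using E[OF i] by auto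
  note mono = order_bound_mono[OF majorant_ge_1 mono_majorant]
  show 1: "order_bound M (ord i) (a i + 1) ((T\<alpha> + E i) * \<omega> l) (step_error (Suc l) t)"
    by (rule mono[OF step_error_bound[OF l t] ord]) (use nn in \<open>auto simp: distrib_right\<close>)
  have eq: "local_error (Suc l) (q i) (t - d) = (\<lambda>f x. step_error (Suc l) t f x - step_correction (Suc l) (q i) t f x)"
    by (simp add: fun_eq_iff local_error_def step_error_def step_correction_def)
  show 2: "order_bound M (ord i) (a i + 1) (E i * real n powr (- real (q i)))
      (\<lambda>f x. step_error (Suc l) t f x - step_correction (Suc l) (q i) t f x)"
    unfolding eq[symmetric] by (rule mono[OF IH[OF i t(2)]]) (use nn in auto)
  have 3: "order_bound M (ord i) (a i + 1) (T\<alpha> * \<omega> l) (step_error (Suc l) t)"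
    by (rule mono[OF step_error_bound[OF l t] ord]) (use nn in auto)
  have "order_bound M (ord i) (a i + 1) (T\<alpha> * \<omega> l + E i * real n powr (- real (q i)))
      (\<lambda>f x. step_error (Suc l) t f x - (step_error (Suc l) t f x - step_correction (Suc l) (q i) t f x))"
    by (rule order_bound_diff[OF 3 2 nn(2,3)]) (use majorant_ge_1[of K] order_trans zero_le_one in blast)
  then have "order_bound M (ord i) (a i + 1) (T\<alpha> * \<omega> l + E i * real n powr (- real (q i)))
      (step_correction (Suc l) (q i) t)" by simp
  then show "order_bound M (ord i) (a i + 1) ((T\<alpha> + E i) * \<omega> l) (step_correction (Suc l) (q i) t)"
    by (rule mono) (use nn om mult_left_mono[OF om nn(1)] in \<open>auto simp: distrib_right\<close>)
qed

lemma chains_correction: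
  assumes i: "i \<in> {1..m - 1}" and t: "t \<in> grid (\<delta> l)"
  shows "operator_chains M d (t + \<delta> l) (Q d) ((T\<alpha> + E i) * \<omega> l)"
  by unfold_locales
     (use E[OF i] majorant_ge_1 mono_majorant step_pos grid_next[OF t] Q_bound in auto)

lemma chains_remainder:
  assumes t: "t \<in> grid (\<delta> l)"
  shows "operator_chains M d (t + \<delta> l) (Q d) (T\<alpha> * \<omega> l)"
  by unfold_locales
     (use majorant_ge_1 mono_majorant step_pos grid_next[OF t] Q_bound in auto)

text \<open>There are \<open>i\<close> positions for the factor \<open>D - D'\<close> in the telescoped product. The exponent \<open>q i\<close> is the smallest
  integer for which the powers of \<open>n\<close> balance.\<close>
lemma correction_count:
  assumes i: "i \<in> {1..m - 1}" and c: "0 \<le> c"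
  shows "real n ^ i * (c * (real i * ((T\<alpha> + E i) * \<omega> l) ^ (i - 1) * (E i * real n powr (- real (q i)))))
    \<le> c * (real i * (T\<alpha> + E i) ^ (i - 1) * E i * real n powr (- real \<mu>))"
proof -
  have i1: "1 \<le> i" "i \<le> m" using i by auto
  have "real i - ((real l + 1) * (1 + \<alpha>)) * real (i - 1) - real (q i) \<le> - real \<mu>"
    using q_par_ge[OF \<alpha> i1] i1 by (simp add: of_nat_diff algebra_simps)
  from powr_count[OF n this]
  have "real n ^ i * \<omega> l ^ (i - 1) * real n powr (- real (q i)) \<le> real n powr (- real \<mu>)" .
  from mult_left_mono[OF this, of "c * (real i * (T\<alpha> + E i) ^ (i - 1) * E i)"]
  show ?thesis using E[OF i] c by (simp add: power_mult_distrib mult_ac)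
qed

text \<open>The number \<open>m\<close> of factors is the smallest one for which the powers of \<open>n\<close> balance, as each factor, together with
  the choice of its time, gains \<open>n powr (- ((1 + \<alpha>) * l + \<alpha>))\<close>.\<close>
lemma remainder_count:
  assumes c: "0 \<le> c"
  shows "real n ^ m * (c * (T\<alpha> * \<omega> l) ^ m) \<le> c * (T\<alpha> ^ m * real n powr (- real \<mu>))"
proof -
  have "real m - ((real l + 1) * (1 + \<alpha>)) * real m - 0 \<le> - real \<mu>"
    using m_par_ge[OF \<alpha>, of \<mu> l] by (simp add: algebra_simps)
  from powr_count[OF n this]
  have "real n ^ m * \<omega> l ^ m \<le> real n powr (- real \<mu>)" using n by simp
  from mult_left_mono[OF this, of "c * T\<alpha> ^ m"]
  show ?thesis using c by (simp add: power_mult_distrib mult_ac)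
qed

lemma card_times:
  assumes t: "t \<in> grid (\<delta> l)"
  shows "finite (time_lists d t (t + \<delta> l) i)" "real (card (time_lists d t (t + \<delta> l) i)) \<le> real n ^ i"
proof -
  have eq: "t + \<delta> l = t + real n * d" using step_refine[of l] by simp
  have le: "t \<le> t + \<delta> l" using step_pos[of l] by simp
  show "finite (time_lists d t (t + \<delta> l) i)"
    by (rule time_lists_finite[OF step_pos grid_next[OF t] grid_refine[OF t] le])
  show "real (card (time_lists d t (t + \<delta> l) i)) \<le> real n ^ i"
    by (rule time_lists_card[OF step_pos grid_next[OF t] grid_refine[OF t] eq])
qed

lemma local_error_as_sum:
  assumes t: "t \<in> grid (\<delta> l)" and f: "f \<in> M_b"
  shows "local_error l \<mu> t f = (\<lambda>x. (\<Sum>i\<in>{1..m - 1}. \<Sum>ts\<in>time_lists d t (t + \<delta> l) i.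
        operator_chain d (Q d) (step_error (Suc l)) (\<lambda>s. Q d s (t + \<delta> l)) t ts f x
      - operator_chain d (Q d) (step_correction (Suc l) (q i)) (\<lambda>s. Q d s (t + \<delta> l)) t ts f x)
    + (\<Sum>ts\<in>time_lists d t (t + \<delta> l) m. operator_chain d (Q d) (step_error (Suc l)) (\<lambda>s. P s (t + \<delta> l)) t ts f x))"
  by (rule ext) (rule local_error_expansion[OF t f m_par_pos[OF \<alpha> \<mu>]])

text \<open>Both \<open>order_bound\<close> and \<open>smoothing_bound\<close> are additive in the size \<open>e\<close>, and only this is used to sum the estimates
  over times and indices. The predicate \<open>B\<close> stands for either, \<open>W\<close> for the factor contributed by
  regularization.\<close>
lemma local_error_assembled:
  fixes B :: "real \<Rightarrow> 'n oper \<Rightarrow> bool" and W :: real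
  assumes cong: "\<And>e A A'. B e A \<Longrightarrow> (\<And>f. f \<in> M_b \<Longrightarrow> A' f = A f) \<Longrightarrow> B e A'"
    and zero: "B 0 (\<lambda>f x. 0)"
    and add: "\<And>e e' A A'. B e A \<Longrightarrow> B e' A' \<Longrightarrow> 0 \<le> e \<Longrightarrow> 0 \<le> e' \<Longrightarrow> B (e + e') (\<lambda>f x. A f x + A' f x)"
    and mono: "\<And>e e' A. B e A \<Longrightarrow> 0 \<le> e \<Longrightarrow> e \<le> e' \<Longrightarrow> B e' A"
    and W: "0 \<le> W" and t: "t \<in> grid (\<delta> l)"
    and corrections: "\<And>i ts. i \<in> {1..m - 1} \<Longrightarrow> ts \<in> time_lists d t (t + \<delta> l) i \<Longrightarrow>
      B (W * (real i * ((T\<alpha> + E i) * \<omega> l) ^ (i - 1) * (E i * real n powr (- real (q i)))))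
        (\<lambda>f x. operator_chain d (Q d) (step_error (Suc l)) (\<lambda>s. Q d s (t + \<delta> l)) t ts f x
          - operator_chain d (Q d) (step_correction (Suc l) (q i)) (\<lambda>s. Q d s (t + \<delta> l)) t ts f x)"
    and remainder: "\<And>ts. ts \<in> time_lists d t (t + \<delta> l) m \<Longrightarrow>
      B (W * (T\<alpha> * \<omega> l) ^ m) (operator_chain d (Q d) (step_error (Suc l)) (\<lambda>s. P s (t + \<delta> l)) t ts)"
  shows "B (W * (error_constant T\<alpha> m E * real n powr (- real \<mu>))) (local_error l \<mu> t)"
proof -
  let ?X = "real n powr (- real \<mu>)"
  have sum: "B (\<Sum>i\<in>S. e i) (\<lambda>f x. \<Sum>i\<in>S. A i f x)"
    if "finite S" "\<And>i. i \<in> S \<Longrightarrow> B (e i) (A i)" "\<And>i. i \<in> S \<Longrightarrow> 0 \<le> e i"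
    for S :: "'i set" and e and A :: "'i \<Rightarrow> 'n oper"
    using that by (induction S) (auto intro!: zero add sum_nonneg)
  have times: "B c (\<lambda>f x. \<Sum>ts\<in>time_lists d t (t + \<delta> l) i. A ts f x)"
    if A: "\<And>ts. ts \<in> time_lists d t (t + \<delta> l) i \<Longrightarrow> B b (A ts)" and b: "0 \<le> b" and c: "real n ^ i * b \<le> c"
    for i b c and A :: "real list \<Rightarrow> 'n oper"
  proof (rule mono[OF sum[OF card_times(1)[OF t] A]])
    show "(\<Sum>ts\<in>time_lists d t (t + \<delta> l) i. b) \<le> c"
      using order_trans[OF mult_right_mono[OF card_times(2)[OF t] b] c] by simp
  qed (use b in \<open>auto intro!: sum_nonneg\<close>)
  let ?c = "\<lambda>i. W * (real i * (T\<alpha> + E i) ^ (i - 1) * E i * ?X)"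
  have "B ((\<Sum>i\<in>{1..m - 1}. ?c i) + W * (T\<alpha> ^ m * ?X)) (local_error l \<mu> t)"
  proof (rule cong[OF add[OF sum times]])
    show "B (?c i) (\<lambda>f x. \<Sum>ts\<in>time_lists d t (t + \<delta> l) i.
        operator_chain d (Q d) (step_error (Suc l)) (\<lambda>s. Q d s (t + \<delta> l)) t ts f x
      - operator_chain d (Q d) (step_correction (Suc l) (q i)) (\<lambda>s. Q d s (t + \<delta> l)) t ts f x)"
      if i: "i \<in> {1..m - 1}" for i
      by (rule times[OF corrections[OF i] _ correction_count[OF i W]]) (use E[OF i] W in auto)
  qed (use remainder remainder_count[OF W] local_error_as_sum[OF t] E W in \<open>auto intro!: sum_nonneg\<close>)
  moreover have "(\<Sum>i\<in>{1..m - 1}. ?c i) + W * (T\<alpha> ^ m * ?X) = W * (error_constant T\<alpha> m E * ?X)"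
    unfolding error_constant_def by (simp only: sum_distrib_left sum_distrib_right distrib_left distrib_right mult.assoc)
  ultimately show ?thesis by simp
qed

lemma local_error_bound:
  assumes t: "t \<in> grid (\<delta> l)"
  shows "order_bound M (kappa \<alpha> \<beta> l \<mu>) (error_power m a)
    (error_constant T\<alpha> m E * real n powr (- real \<mu>)) (local_error l \<mu> t)"
proof -
  have td: "t \<in> grid d" by (rule grid_refine[OF t])
  have tu: "t \<le> t + \<delta> l" using step_pos[of l] by simp
  have M0: "0 \<le> M r" for r using majorant_ge_1[of K r] by linarith
  note mono = order_bound_mono[OF majorant_ge_1 mono_majorant]
  have "order_bound M (kappa \<alpha> \<beta> l \<mu>) (error_power m a)
    (1 * (error_constant T\<alpha> m E * real n powr (- real \<mu>))) (local_error l \<mu> t)"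
  proof (rule local_error_assembled[where W = 1 and
        B = "\<lambda>e. order_bound M (kappa \<alpha> \<beta> l \<mu>) (error_power m a) e", OF _ _ _ _ _ t])
    fix i ts assume i: "i \<in> {1..m - 1}" and ts: "ts \<in> time_lists d t (t + \<delta> l) i"
    let ?e = "(T\<alpha> + E i) * \<omega> l"
    interpret operator_chains M d "t + \<delta> l" "Q d" "ord i" "a i + 1" ?e by (rule chains_correction[OF i t])
    have len: "length ts = i" "admissible d t (t + \<delta> l) ts" using time_lists_admissible[OF ts] by auto
    have "order_bound M (ord i * length ts) ((a i + 1 + 1) * length ts + 1)
        (real (length ts) * ?e ^ (length ts - 1) * (E i * real n powr (- real (q i))))
      (\<lambda>f x. operator_chain d (Q d) (step_error (Suc l)) (\<lambda>s. Q d s (t + \<delta> l)) t ts f x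
          - operator_chain d (Q d) (step_correction (Suc l) (q i)) (\<lambda>s. Q d s (t + \<delta> l)) t ts f x)"
      by (rule chain_difference_bound[OF step_operators[OF i] Q_bound[OF _ grid_next[OF t]] _ td tu len(2)])
         (use E[OF i] in auto)
    then show "order_bound M (kappa \<alpha> \<beta> l \<mu>) (error_power m a)
        (1 * (real i * ?e ^ (i - 1) * (E i * real n powr (- real (q i)))))
      (\<lambda>f x. operator_chain d (Q d) (step_error (Suc l)) (\<lambda>s. Q d s (t + \<delta> l)) t ts f x
          - operator_chain d (Q d) (step_correction (Suc l) (q i)) (\<lambda>s. Q d s (t + \<delta> l)) t ts f x)"
      unfolding len(1)
      by (rule mono) (use kappa_ge(2)[OF \<alpha>, of i l \<mu> \<beta>] i error_power_ge(1)[OF i, of a] E[OF i]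
          in \<open>auto simp: mult.commute\<close>)
  next
    fix ts assume ts: "ts \<in> time_lists d t (t + \<delta> l) m"
    interpret operator_chains M d "t + \<delta> l" "Q d" \<beta> 1 "T\<alpha> * \<omega> l" by (rule chains_remainder[OF t])
    have len: "length ts = m" "admissible d t (t + \<delta> l) ts" using time_lists_admissible[OF ts] by auto
    have "order_bound M (\<beta> * length ts) ((1 + 1) * length ts + 1) ((T\<alpha> * \<omega> l) ^ length ts)
        (operator_chain d (Q d) (step_error (Suc l)) (\<lambda>s. P s (t + \<delta> l)) t ts)"
      by (rule chain_bound[OF step_error_bound[OF l] P_bound[OF step_pos _ grid_next[OF t]] td tu len(2)])
    then show "order_bound M (kappa \<alpha> \<beta> l \<mu>) (error_power m a) (1 * (T\<alpha> * \<omega> l) ^ m)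
        (operator_chain d (Q d) (step_error (Suc l)) (\<lambda>s. P s (t + \<delta> l)) t ts)"
      unfolding len(1) by (rule mono) (use kappa_ge(1)[OF \<alpha>] error_power_ge(2)[of m a] in auto)
  qed (auto intro: order_bound_cong order_bound_add[OF _ _ _ _ M0] order_bound_zero mono)
  then show ?thesis by simp
qed

lemma local_error_smoothing:
  assumes p: "\<And>i. i \<in> {1..m - 1} \<Longrightarrow> ord i * i \<le> p" "\<beta> * m \<le> p"
    and t: "t \<in> grid (\<delta> l)" and \<rho>: "0 \<le> \<rho>" and \<tau>: "0 \<le> \<tau>" "(real m + 1) * \<tau> + real m * d \<le> \<delta> l"
    and Qr: "\<And>r s. r \<in> grid d \<Longrightarrow> s \<in> grid d \<Longrightarrow> \<tau> \<le> s - r \<Longrightarrow> regularizing p \<rho> (Q d r s)"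
    and Pr: "\<And>r s. r \<in> grid d \<Longrightarrow> s \<in> grid d \<Longrightarrow> \<tau> \<le> s - r \<Longrightarrow> regularizing p \<rho> (P r s)"
  shows "smoothing_bound M p p (error_power m a)
    (real (card {\<gamma> :: 'n \<Rightarrow> nat. multi_size \<gamma> \<le> p}) * \<rho> * (error_constant T\<alpha> m E * real n powr (- real \<mu>)))
    (local_error l \<mu> t)"
proof -
  let ?W = "real (card {\<gamma> :: 'n \<Rightarrow> nat. multi_size \<gamma> \<le> p}) * \<rho>"
  have W: "0 \<le> ?W" using \<rho> by simp
  have td: "t \<in> grid d" by (rule grid_refine[OF t])
  have tu: "t \<le> t + \<delta> l" using step_pos[of l] by simp
  note mono = smoothing_bound_mono[OF majorant_ge_1 mono_majorant]
  have gap: "long_gap \<tau> d (t + \<delta> l) t ts" if "length ts \<le> m" for ts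
  proof (rule long_gap_exists)
    have "(real (length ts) + 1) * \<tau> + real (length ts) * d \<le> (real m + 1) * \<tau> + real m * d"
      using that \<tau>(1) step_pos[of "Suc l"] by (intro add_mono mult_right_mono) auto
    then show "(real (length ts) + 1) * \<tau> + real (length ts) * d \<le> t + \<delta> l - t" using \<tau>(2) by simp
  qed
  show ?thesis
  proof (rule local_error_assembled[where B = "\<lambda>e. smoothing_bound M p p (error_power m a) e", OF _ _ _ _ W t])
    fix i ts assume i: "i \<in> {1..m - 1}" and ts: "ts \<in> time_lists d t (t + \<delta> l) i"
    let ?e = "(T\<alpha> + E i) * \<omega> l"
    interpret operator_chains M d "t + \<delta> l" "Q d" "ord i" "a i + 1" ?e by (rule chains_correction[OF i t])
    have len: "length ts = i" "admissible d t (t + \<delta> l) ts" using time_lists_admissible[OF ts] by auto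
    have g: "long_gap \<tau> d (t + \<delta> l) t ts" by (rule gap) (use len i in auto)
    have k: "ord i * length ts \<le> p" unfolding len(1) by (rule p(1)[OF i])
    have "smoothing_bound M p (ord i * length ts) ((a i + 1 + 1) * length ts + 1)
        (?W * (real (length ts) * ?e ^ (length ts - 1) * (E i * real n powr (- real (q i)))))
      (\<lambda>f x. operator_chain d (Q d) (step_error (Suc l)) (\<lambda>s. Q d s (t + \<delta> l)) t ts f x
          - operator_chain d (Q d) (step_correction (Suc l) (q i)) (\<lambda>s. Q d s (t + \<delta> l)) t ts f x)"
      by (rule chain_difference_smoothing[OF step_operators[OF i] Q_bound[OF _ grid_next[OF t]] _
            Qr Qr[OF _ grid_next[OF t]] \<rho> td tu len(2) g k])
         (use E[OF i] in auto)
    then show "smoothing_bound M p p (error_power m a)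
        (?W * (real i * ?e ^ (i - 1) * (E i * real n powr (- real (q i)))))
      (\<lambda>f x. operator_chain d (Q d) (step_error (Suc l)) (\<lambda>s. Q d s (t + \<delta> l)) t ts f x
          - operator_chain d (Q d) (step_correction (Suc l) (q i)) (\<lambda>s. Q d s (t + \<delta> l)) t ts f x)"
      unfolding len(1) by (rule mono) (use p(1)[OF i] error_power_ge(1)[OF i, of a] E[OF i] W in auto)
  next
    fix ts assume ts: "ts \<in> time_lists d t (t + \<delta> l) m"
    interpret operator_chains M d "t + \<delta> l" "Q d" \<beta> 1 "T\<alpha> * \<omega> l" by (rule chains_remainder[OF t])
    have len: "length ts = m" "admissible d t (t + \<delta> l) ts" using time_lists_admissible[OF ts] by auto
    have g: "long_gap \<tau> d (t + \<delta> l) t ts" by (rule gap) (use len in auto)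
    have k: "\<beta> * length ts \<le> p" unfolding len(1) by (rule p(2))
    have "smoothing_bound M p (\<beta> * length ts) ((1 + 1) * length ts + 1) (?W * (T\<alpha> * \<omega> l) ^ length ts)
        (operator_chain d (Q d) (step_error (Suc l)) (\<lambda>s. P s (t + \<delta> l)) t ts)"
      by (rule chain_smoothing[OF step_error_bound[OF l] P_bound[OF step_pos _ grid_next[OF t]]
            Qr Pr[OF _ grid_next[OF t]] \<rho> td tu len(2) g k])
    then show "smoothing_bound M p p (error_power m a) (?W * (T\<alpha> * \<omega> l) ^ m)
        (operator_chain d (Q d) (step_error (Suc l)) (\<lambda>s. P s (t + \<delta> l)) t ts)"
      unfolding len(1) by (rule mono) (use p(2) error_power_ge(2)[of m a] W in auto)
  qed (auto intro: smoothing_bound_cong[OF majorant_ge_1 mono_majorant]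
      smoothing_bound_add[OF majorant_ge_1 mono_majorant] smoothing_bound_zero[OF majorant_ge_1 mono_majorant] mono)
qed

end

end

text \<open>The exponents and constants are chosen before \<open>n\<close>, \<open>P\<close> and \<open>Q\<close>. This is why the lemma lives outside the
  locale and quantifies over its instances. The induction follows \<open>depth\<close>, the termination measure of the scheme; when
  \<open>m_par\<close> is 1 there is nothing to choose.\<close>
lemma uniform_correction_bounds:
  fixes T \<alpha> :: real and K :: "nat \<Rightarrow> real"
  assumes T: "0 < T" and \<alpha>: "0 < \<alpha>"
  shows "1 \<le> \<mu> \<Longrightarrow> \<mu> \<le> \<nu> + l \<Longrightarrow> \<exists>a E. (\<forall>i\<in>{1..m_par \<alpha> l \<mu> - 1}. 0 \<le> E i) \<and>
    (\<forall>n P (Q :: real \<Rightarrow> real \<Rightarrow> real \<Rightarrow> 'n::finite oper). \<forall>i\<in>{1..m_par \<alpha> l \<mu> - 1}. \<forall>s\<in>grid (step T n (Suc l)).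
      scheme T \<alpha> \<beta> (l_par \<alpha> \<nu>) n K P Q \<longrightarrow>
      order_bound (majorant K) (kappa \<alpha> \<beta> (Suc l) (q_par \<alpha> l \<mu> i)) (a i) (E i * real n powr (- real (q_par \<alpha> l \<mu> i)))
        (scheme.local_error T \<alpha> n P Q (Suc l) (q_par \<alpha> l \<mu> i) s))"
proof (induction "depth \<alpha> l \<mu>" arbitrary: l \<mu> rule: less_induct)
  case less
  let ?m = "m_par \<alpha> l \<mu>" and ?q = "q_par \<alpha> l \<mu>"
  have "\<forall>i\<in>{1..?m - 1}. \<exists>a E. 0 \<le> E \<and> (\<forall>n P (Q :: real \<Rightarrow> real \<Rightarrow> real \<Rightarrow> 'n oper). \<forall>s\<in>grid (step T n (Suc l)).
      scheme T \<alpha> \<beta> (l_par \<alpha> \<nu>) n K P Q \<longrightarrow>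
      order_bound (majorant K) (kappa \<alpha> \<beta> (Suc l) (?q i)) a (E * real n powr (- real (?q i)))
        (scheme.local_error T \<alpha> n P Q (Suc l) (?q i) s))"
  proof
    fix i assume "i \<in> {1..?m - 1}"
    then have i: "1 \<le> i" "i \<le> ?m - 1" by auto
    have level: "Suc (Suc l) \<le> l_par \<alpha> \<nu>" by (rule next_level_available[OF \<alpha> _ less.prems(2)]) (use i in simp)
    have "1 * 1 \<le> (real l + 1) * (1 + \<alpha>)" using \<alpha> by (intro mult_mono) auto
    then have q1: "1 \<le> ?q i" using q_par_ge_step[OF \<alpha> i] by simp
    have "?q i \<le> \<mu> + 1" by (rule q_par_le[OF \<alpha> i(1)]) (use i in linarith)
    then have q2: "?q i \<le> \<nu> + Suc l" using less.prems(2) by simp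
    let ?m' = "m_par \<alpha> (Suc l) (?q i)" and ?q' = "q_par \<alpha> (Suc l) (?q i)"
    obtain a E where E: "\<forall>j\<in>{1..?m' - 1}. 0 \<le> E j"
      and bound: "\<forall>n P (Q :: real \<Rightarrow> real \<Rightarrow> real \<Rightarrow> 'n oper). \<forall>j\<in>{1..?m' - 1}. \<forall>s\<in>grid (step T n (Suc (Suc l))).
        scheme T \<alpha> \<beta> (l_par \<alpha> \<nu>) n K P Q \<longrightarrow>
        order_bound (majorant K) (kappa \<alpha> \<beta> (Suc (Suc l)) (?q' j)) (a j) (E j * real n powr (- real (?q' j)))
          (scheme.local_error T \<alpha> n P Q (Suc (Suc l)) (?q' j) s)"
      using less.hyps[OF depth_decreases[OF \<alpha> i] q1 q2] by (elim exE conjE) (rule that)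
    show "\<exists>a E. 0 \<le> E \<and> (\<forall>n P (Q :: real \<Rightarrow> real \<Rightarrow> real \<Rightarrow> 'n oper). \<forall>s\<in>grid (step T n (Suc l)).
      scheme T \<alpha> \<beta> (l_par \<alpha> \<nu>) n K P Q \<longrightarrow>
      order_bound (majorant K) (kappa \<alpha> \<beta> (Suc l) (?q i)) a (E * real n powr (- real (?q i)))
        (scheme.local_error T \<alpha> n P Q (Suc l) (?q i) s))"
    proof (intro exI conjI allI impI ballI)
      show "0 \<le> error_constant (T powr (\<alpha> + 1)) ?m' E"
        by (rule error_constant_nonneg) (use E in auto)
      fix n P and Q :: "real \<Rightarrow> real \<Rightarrow> real \<Rightarrow> 'n oper" and s
      assume s: "s \<in> grid (step T n (Suc l))" and scheme: "scheme T \<alpha> \<beta> (l_par \<alpha> \<nu>) n K P Q"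
      show "order_bound (majorant K) (kappa \<alpha> \<beta> (Suc l) (?q i)) (error_power ?m' a)
          (error_constant (T powr (\<alpha> + 1)) ?m' E * real n powr (- real (?q i)))
          (scheme.local_error T \<alpha> n P Q (Suc l) (?q i) s)"
        by (rule scheme.local_error_bound[OF scheme level q1 bound[rule_format, OF _ _ scheme] E[rule_format] s])
    qed
  qed
  then obtain a E where "\<And>i. i \<in> {1..?m - 1} \<Longrightarrow> 0 \<le> E i"
    "\<And>n P (Q :: real \<Rightarrow> real \<Rightarrow> real \<Rightarrow> 'n oper) i s. i \<in> {1..?m - 1} \<Longrightarrow> s \<in> grid (step T n (Suc l)) \<Longrightarrow>
      scheme T \<alpha> \<beta> (l_par \<alpha> \<nu>) n K P Q \<Longrightarrow>
      order_bound (majorant K) (kappa \<alpha> \<beta> (Suc l) (?q i)) (a i) (E i * real n powr (- real (?q i)))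
        (scheme.local_error T \<alpha> n P Q (Suc l) (?q i) s)"
    by (metis (no_types, lifting) bchoice)
  then show ?case by (intro exI[of _ a] exI[of _ E]) blast
qed

section \<open>The error of the scheme at time T\<close>
text \<open>With \<open>m\<close> steps of length \<open>T / n\<close> removed, \<open>m + 1\<close> gaps of length \<open>\<tau>\<close> fill \<open>[0, T]\<close> exactly. A gap is a multiple of the
  mesh, so if it is at least \<open>\<tau>\<close> it is at least the smallest multiple with this property.\<close>
lemma T_nu_lower:
  assumes T: "0 < T" and n: "1 \<le> n" and pos: "T_nu T \<alpha> n \<nu> \<noteq> 0"
  defines "\<tau> \<equiv> T * ((real n - real (m_par \<alpha> 0 \<nu>)) / (real n * (real (m_par \<alpha> 0 \<nu>) + 1)))"
  shows "0 < T_nu T \<alpha> n \<nu>" and "0 \<le> \<tau>"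
    and "r \<in> grid (step T n 1) \<Longrightarrow> s \<in> grid (step T n 1) \<Longrightarrow> \<tau> \<le> s - r \<Longrightarrow> T_nu T \<alpha> n \<nu> \<le> s - r"
    and "(real (m_par \<alpha> 0 \<nu>) + 1) * \<tau> + real (m_par \<alpha> 0 \<nu>) * step T n 1 \<le> T"
proof -
  let ?d = "step T n 1" and ?m = "real (m_par \<alpha> 0 \<nu>)"
  define S where "S = {t \<in> grid ?d. t \<ge> \<tau>}"
  have d: "0 < ?d" unfolding step_def using T n by simp
  have TS: "T_nu T \<alpha> n \<nu> = Inf S" unfolding T_nu_def S_def \<tau>_def ..
  have nonneg: "0 \<le> t" if "t \<in> S" for t using that d unfolding S_def grid_def by auto
  have bdd: "bdd_below S" using nonneg by (intro bdd_belowI[of _ 0])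
  obtain k where "\<tau> / ?d < real k" using reals_Archimedean2 by blast
  then have "real k * ?d \<in> S" unfolding S_def using d gridI[of k ?d] by (simp add: divide_less_eq)
  then have "0 \<le> Inf S" by (intro cInf_greatest nonneg) auto
  then show "0 < T_nu T \<alpha> n \<nu>" using pos TS by simp
  show \<tau>: "0 \<le> \<tau>"
  proof (rule ccontr)
    assume "\<not> 0 \<le> \<tau>"
    then have "0 \<in> S" unfolding S_def using gridI[of 0 ?d] by simp
    then have "Inf S \<le> 0" by (intro cInf_lower bdd)
    then show False using \<open>0 < T_nu T \<alpha> n \<nu>\<close> TS by simp
  qed
  show "T_nu T \<alpha> n \<nu> \<le> s - r" if rs: "r \<in> grid ?d" "s \<in> grid ?d" "\<tau> \<le> s - r"
  proof -
    have "r \<le> s" using rs(3) \<tau> by simp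
    then obtain j where "s = r + real j * ?d" using grid_le_obtain[OF d rs(1,2)] by blast
    then have "s - r \<in> S" unfolding S_def using rs(3) gridI[of j ?d] by simp
    then show ?thesis unfolding TS by (intro cInf_lower bdd)
  qed
  have gaps: "(?m + 1) * \<tau> = T * (real n - ?m) / real n"
  proof -
    have "a * (T * (x / (y * a))) = T * x / y" if "a \<noteq> 0" for a x y :: real using that by simp
    then show ?thesis unfolding \<tau>_def by (simp add: add_nonneg_eq_0_iff)
  qed
  have "(?m + 1) * \<tau> + ?m * ?d = T" unfolding gaps step_def using n by (simp add: field_simps)
  then show "(?m + 1) * \<tau> + ?m * ?d \<le> T" by simp
qed

text \<open>As \<open>\<eta>\<close> is nonnegative, the singular factor is largest for the shortest gap.\<close>
lemma regularizing_of_gap: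
  fixes A :: "real \<Rightarrow> real \<Rightarrow> 'n::finite oper"
  assumes R: "regularizes I A p \<eta> K'" and st: "(s, t) \<in> I" and k: "signed_kernel (A s t)"
    and gap: "0 < \<tau>" "\<tau> \<le> t - s" and \<eta>: "0 \<le> \<eta> (real p)"
  shows "regularizing p (max 0 K' / \<tau> powr \<eta> (real p)) (A s t)"
  unfolding regularizing_def
proof (intro conjI ballI allI impI)
  have lt: "s < t" using gap by simp
  show "signed_kernel (A s t)" by (rule k)
  show "A s t f \<in> C_b_infty" if "f \<in> M_b" for f
    using R st lt that unfolding regularizes_def by blast
  fix r and \<gamma> :: "'n \<Rightarrow> nat" and f :: "real ^ 'n \<Rightarrow> real"
  assume h: "multi_size \<gamma> + r \<le> p" "f \<in> C_c_infty"
  have "C_b_norm r (A s t (mderiv \<gamma> f)) \<le> ennreal (K' / (t - s) powr \<eta> (real p)) * sup_norm f"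
    using R st lt h unfolding regularizes_def by blast
  also have "\<dots> \<le> ennreal (max 0 K' / \<tau> powr \<eta> (real p)) * sup_norm f"
  proof (intro mult_right_mono ennreal_leI)
    have "\<tau> powr \<eta> (real p) \<le> (t - s) powr \<eta> (real p)" using gap \<eta> by (intro powr_mono2) auto
    then show "K' / (t - s) powr \<eta> (real p) \<le> max 0 K' / \<tau> powr \<eta> (real p)"
      using gap by (intro frac_le) auto
  qed simp
  finally show "C_b_norm r (A s t (mderiv \<gamma> f)) \<le> ennreal (max 0 K' / \<tau> powr \<eta> (real p)) * sup_norm f" .
qed

lemma q_nu_ge:
  assumes "i \<in> {1..m_par \<alpha> 0 \<nu>}"
  shows "i * max \<beta> (kappa \<alpha> \<beta> 1 (q_par \<alpha> 0 \<nu> i)) \<le> q_nu \<alpha> \<beta> \<nu>"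
  unfolding q_nu_def by (rule Max_ge) (use assms in auto)

theorem theorem1p1:
  fixes T \<alpha> :: real and \<nu> \<beta> :: nat and \<eta> :: "real \<Rightarrow> real"
    and K :: "nat \<Rightarrow> real" and K' :: real
  assumes "0 < T" and "1 \<le> \<nu>" and "0 < \<alpha>"
    and "mono_on {0..} \<eta>" and "\<And>x. 0 \<le> x \<Longrightarrow> 0 \<le> \<eta> x"
  shows "\<exists>C\<ge>0. \<forall>(n::nat) (P :: real \<Rightarrow> real \<Rightarrow> 'n::finite oper)
           (Q :: real \<Rightarrow> real \<Rightarrow> real \<Rightarrow> 'n oper).
      1 \<le> n \<longrightarrow>
      grid_independent_family P \<longrightarrow>
      (\<forall>l. discrete_semigroup (step T n l) (Q (step T n l))) \<longrightarrow>
      propagates_regularity all_grid_pairs P K \<longrightarrow>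
      (\<forall>l. propagates_regularity (grid_pairs (step T n l)) (Q (step T n l)) K) \<longrightarrow>
      dually_propagates_regularity all_grid_pairs P K \<longrightarrow>
      (\<forall>l. dually_propagates_regularity (grid_pairs (step T n l)) (Q (step T n l)) K) \<longrightarrow>
      (\<forall>l\<in>{1..l_par \<alpha> \<nu>}.
         short_time_estimate (step T n l) \<alpha> \<beta> P (Q (step T n l)) K \<and>
         dual_short_time_estimate (step T n l) \<alpha> \<beta> P (Q (step T n l)) K) \<longrightarrow>
      regularizes (grid_pairs (step T n 1)) (Q (step T n 1)) (q_nu \<alpha> \<beta> \<nu>) \<eta> K' \<longrightarrow>
      regularizes all_grid_pairs P (q_nu \<alpha> \<beta> \<nu>) \<eta> K' \<longrightarrow>
      (\<forall>f\<in>M_b.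
         sup_norm (\<lambda>x. P 0 T f x - Q_hat \<alpha> T n Q 0 \<nu> 0 f x)
           \<le> (if T_nu T \<alpha> n \<nu> = 0 then \<infinity>
              else ennreal (C / T_nu T \<alpha> n \<nu> powr \<eta> (real (q_nu \<alpha> \<beta> \<nu>))) * sup_norm f
                     * ennreal (1 / real n ^ \<nu>)))"
proof -
  note T = assms(1) and \<nu> = assms(2) and \<alpha> = assms(3)
  let ?L = "l_par \<alpha> \<nu>" and ?m = "m_par \<alpha> 0 \<nu>" and ?q = "q_par \<alpha> 0 \<nu>" and ?p = "q_nu \<alpha> \<beta> \<nu>"
  have "0 < real \<nu> / \<alpha>" using \<nu> \<alpha> by simp
  then have L: "Suc 0 \<le> ?L" unfolding l_par_def by linarith
  obtain a E where E: "\<forall>i\<in>{1..?m - 1}. 0 \<le> E i"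
    and bound: "\<forall>n P (Q :: real \<Rightarrow> real \<Rightarrow> real \<Rightarrow> 'n oper). \<forall>i\<in>{1..?m - 1}. \<forall>s\<in>grid (step T n (Suc 0)).
      scheme T \<alpha> \<beta> ?L n K P Q \<longrightarrow>
      order_bound (majorant K) (kappa \<alpha> \<beta> (Suc 0) (?q i)) (a i) (E i * real n powr (- real (?q i)))
        (scheme.local_error T \<alpha> n P Q (Suc 0) (?q i) s)"
    using uniform_correction_bounds[OF T \<alpha> \<nu> le_add1[of \<nu> 0], where \<beta> = \<beta> and K = K]
    by (elim exE conjE) (rule that)
  let ?A = "error_power ?m a" and ?B = "error_constant (T powr (\<alpha> + 1)) ?m E"
  have B: "0 \<le> ?B" by (rule error_constant_nonneg) (use E in auto)
  let ?card = "real (card {\<gamma> :: 'n \<Rightarrow> nat. multi_size \<gamma> \<le> ?p})"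
  \<comment> \<open>Regularization contributes the first two factors, counting the third, and propagation of regularity the fourth.\<close>
  define C where "C = ?card * max 0 K' * ?B * majorant K ?p ^ ?A"
  have M0: "0 \<le> majorant K ?p" using majorant_ge_1[of K ?p] by linarith
  have C0: "0 \<le> C" unfolding C_def using B M0 by simp
  have main: "sup_norm (\<lambda>x. P 0 T f x - Q_hat \<alpha> T n Q 0 \<nu> 0 f x)
      \<le> ennreal (C / T_nu T \<alpha> n \<nu> powr \<eta> (real ?p)) * sup_norm f * ennreal (1 / real n ^ \<nu>)"
    if s: "scheme T \<alpha> \<beta> ?L n K P Q" and T\<nu>: "T_nu T \<alpha> n \<nu> \<noteq> 0"
      and Qreg: "regularizes (grid_pairs (step T n 1)) (Q (step T n 1)) ?p \<eta> K'"
      and Preg: "regularizes all_grid_pairs P ?p \<eta> K'" and f: "f \<in> M_b"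
    for n P f and Q :: "real \<Rightarrow> real \<Rightarrow> real \<Rightarrow> 'n oper"
  proof -
    interpret scheme T \<alpha> \<beta> ?L n K P Q by (rule s)
    let ?\<tau> = "T * ((real n - real ?m) / (real n * (real ?m + 1)))"
    let ?N = "T_nu T \<alpha> n \<nu>"
    let ?\<rho> = "max 0 K' / ?N powr \<eta> (real ?p)"
    note TN = T_nu_lower[OF T n T\<nu>]
    have \<eta>: "0 \<le> \<eta> (real ?p)" by (rule assms(5)) simp
    have \<rho>: "0 \<le> ?\<rho>" by simp
    have pairs: "(r, s) \<in> grid_pairs (step T n 1)" "r \<le> s"
      if "r \<in> grid (step T n 1)" "s \<in> grid (step T n 1)" "?\<tau> \<le> s - r" for r s
      using that TN(2) unfolding grid_pairs_def by auto
    have smoothing: "smoothing_bound (majorant K) ?p ?p ?A (?card * ?\<rho> * (?B * real n powr (- real \<nu>))) (local_error 0 \<nu> 0)"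
    proof (rule local_error_smoothing[OF L \<nu> bound[rule_format, OF _ _ s] E[rule_format]])
      show "kappa \<alpha> \<beta> (Suc 0) (?q i) * i \<le> ?p" if "i \<in> {1..?m - 1}" for i
      proof -
        have "i * kappa \<alpha> \<beta> 1 (?q i) \<le> i * max \<beta> (kappa \<alpha> \<beta> 1 (?q i))" by simp
        also have "\<dots> \<le> ?p" by (rule q_nu_ge) (use that in auto)
        finally show ?thesis by (simp add: mult.commute)
      qed
      have "\<beta> * ?m \<le> ?m * max \<beta> (kappa \<alpha> \<beta> 1 (?q ?m))" by (simp add: mult.commute)
      also have "\<dots> \<le> ?p" by (rule q_nu_ge) (use m_par_pos[OF \<alpha> \<nu>] in auto)
      finally show "\<beta> * ?m \<le> ?p" .
      show "0 \<in> grid (step T n 0)" using gridI[of 0] by simp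
      show "0 \<le> ?\<rho>" by (rule \<rho>)
      show "0 \<le> ?\<tau>" by (rule TN(2))
      show "(real ?m + 1) * ?\<tau> + real ?m * step T n (Suc 0) \<le> step T n 0"
        using TN(4) by (simp add: step_def)
      show "regularizing ?p ?\<rho> (Q (step T n (Suc 0)) r s)"
        if "r \<in> grid (step T n (Suc 0))" "s \<in> grid (step T n (Suc 0))" "?\<tau> \<le> s - r" for r s
        using that pairs[of r s] TN(3)[of r s] order_boundD(1)[OF Q_bound[of r 1 s]]
        by (intro regularizing_of_gap[OF Qreg[unfolded One_nat_def] _ _ TN(1) _ \<eta>]) auto
      show "regularizing ?p ?\<rho> (P r s)"
        if "r \<in> grid (step T n (Suc 0))" "s \<in> grid (step T n (Suc 0))" "?\<tau> \<le> s - r" for r s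
      proof (rule regularizing_of_gap[OF Preg _ _ TN(1) _ \<eta>])
        show "(r, s) \<in> all_grid_pairs"
          unfolding all_grid_pairs_def using pairs[of r s] that step_pos[of 1] by auto
        show "signed_kernel (P r s)"
          using order_boundD(1)[OF P_bound[OF step_pos[of 1], of r s]] pairs[of r s] that by simp
        show "?N \<le> s - r" using TN(3)[of r s] that by simp
      qed
    qed
    have err: "local_error 0 \<nu> 0 f = (\<lambda>x. P 0 T f x - Q_hat \<alpha> T n Q 0 \<nu> 0 f x)" for f
      by (simp add: fun_eq_iff local_error_def step_def)
    let ?c = "?card * ?\<rho> * (?B * real n powr (- real \<nu>)) * majorant K ?p ^ ?A"
    have c0: "0 \<le> ?c" using \<rho> B M0 by simp
    have "sup_norm (local_error 0 \<nu> 0 f) \<le> ennreal ?c * sup_norm f"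
    proof (rule sup_norm_bound_extends[OF smoothing_boundD(1)[OF smoothing] c0 _ f])
      fix g :: "real ^ 'n \<Rightarrow> real" assume g: "g \<in> C_b 0"
      \<comment> \<open>The identity serves as the test operator, of order 0.\<close>
      have "sup_norm ((\<lambda>f. f) (local_error 0 \<nu> 0 g)) \<le> ennreal (1 * ?c) * sup_norm g"
        by (rule smoothing_boundD(2)[OF smoothing
              positive_imp_signed_kernel[OF positive_kernel_id], where ?k1.0 = 0])
           (use g in \<open>auto simp: C_b_norm_0\<close>)
      then show "sup_norm (local_error 0 \<nu> 0 g) \<le> ennreal ?c * sup_norm g" by simp
    qed
    also have "?c = C / ?N powr \<eta> (real ?p) * (1 / real n ^ \<nu>)"
      unfolding C_def using n by (simp add: powr_minus powr_realpow divide_inverse mult_ac)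
    also have "ennreal (C / ?N powr \<eta> (real ?p) * (1 / real n ^ \<nu>)) * sup_norm f
        = ennreal (C / ?N powr \<eta> (real ?p)) * sup_norm f * ennreal (1 / real n ^ \<nu>)"
      using C0 by (subst ennreal_mult) (auto simp: mult_ac)
    finally show ?thesis unfolding err .
  qed
  show ?thesis
  proof (intro exI[of _ C] conjI allI impI ballI C0)
    fix n P and Q :: "real \<Rightarrow> real \<Rightarrow> real \<Rightarrow> 'n oper" and f :: "real ^ 'n \<Rightarrow> real"
    assume h: "1 \<le> n" "grid_independent_family P" "\<forall>l. discrete_semigroup (step T n l) (Q (step T n l))"
      "propagates_regularity all_grid_pairs P K"
      "\<forall>l. propagates_regularity (grid_pairs (step T n l)) (Q (step T n l)) K"
      "dually_propagates_regularity all_grid_pairs P K"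
      "\<forall>l. dually_propagates_regularity (grid_pairs (step T n l)) (Q (step T n l)) K"
      "\<forall>l\<in>{1..?L}. short_time_estimate (step T n l) \<alpha> \<beta> P (Q (step T n l)) K \<and>
         dual_short_time_estimate (step T n l) \<alpha> \<beta> P (Q (step T n l)) K"
      "regularizes (grid_pairs (step T n 1)) (Q (step T n 1)) ?p \<eta> K'"
      "regularizes all_grid_pairs P ?p \<eta> K'" "f \<in> M_b"
    have s: "scheme T \<alpha> \<beta> ?L n K P Q"
      by unfold_locales (use h T \<alpha> in auto)
    show "sup_norm (\<lambda>x. P 0 T f x - Q_hat \<alpha> T n Q 0 \<nu> 0 f x)
        \<le> (if T_nu T \<alpha> n \<nu> = 0 then \<infinity>
          else ennreal (C / T_nu T \<alpha> n \<nu> powr \<eta> (real ?p)) * sup_norm f * ennreal (1 / real n ^ \<nu>))"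
      using main[OF s _ h(9-11)] by simp
  qed
qed

end
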